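(* Let $(\mu_n)_{n\ge1}$ be a sequence of positive real numbers such that $\lim_{n\to\infty}\frac{\mu_n}{n}=c$ for some constant $c$. Let $(X_n)_{n\ge1}$ be a sequence of Hermitian random matrices defined on the same probability space and such that, for every $n$, the distribution of $X_n$ is $\mathbb{P}_{n,\mu_n}$. Let $b=\sqrt{1+c+\sqrt{1+2c}}$, and let $\lambda_{\max}(X_n)$ and $\lambda_{\min}(X_n)$ denote the largest and the smallest eigenvalue of $X_n$. Then 1. $\displaystyle\lim_{n\to+\infty}\frac{\lambda_{\max}(X_n)}{\sqrt n}=b$ almost surely; 2. $\displaystyle\lim_{n\to+\infty}\frac{\lambda_{\min}(X_n)}{\sqrt n}=-b$ almost surely.
   Context: $H_n=\mathrm{Herm}(n,\mathbb{C})$ is the real vector space of $n\times n$ Hermitian matrices, with inner product $\langle x,y\rangle=\operatorname{tr}(xy)$ and associated Euclidean (Lebesgue) measure $m_n$. For $\mu>-\frac12$, $\mathbb{P}_{n,\mu}$ is the probability measure on $H_n$ given by $$\mathbb{P}_{n,\mu}(dx)=\frac{1}{C_n}|\det(x)|^{2\mu}e^{-\operatorname{tr}(x^2)}m_n(dx),$$ where $C_n$ is the normalizing constant. *)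

theory Defs
  imports "HOL-Probability.Probability" "Jordan_Normal_Form.Spectral_Radius"
begin

text \<open>Matrices are those of \<open>Jordan_Normal_Form\<close>, since the size \<open>n\<close> varies inside the
  statement.\<close>

hide_const (open) Determinants.det Determinants.trace

definition mat_trace :: "'a :: comm_monoid_add mat \<Rightarrow> 'a" where
  "mat_trace A = (\<Sum>i<dim_row A. A $$ (i, i))"

definition Herm :: "nat \<Rightarrow> complex mat set" where
  "Herm n = {A \<in> carrier_mat n n. mat_adjoint A = A}"

text \<open>The Borel sigma-algebra on \<open>Herm n\<close>: the coarsest one making all entries measurable.\<close>

definition herm_borel :: "nat \<Rightarrow> complex mat measure" where
  "herm_borel n = vimage_algebra (Herm n) (\<lambda>A. \<lambda>p\<in>{..<n} \<times> {..<n}. A $$ p)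
     (\<Pi>\<^sub>M p\<in>{..<n} \<times> {..<n}. borel)"

text \<open>Coordinates with respect to the orthonormal basis of \<open>Herm n\<close> (for the inner product
  \<open>tr (x y)\<close>) formed by \<open>E\<^sub>i\<^sub>i\<close>, \<open>(E\<^sub>i\<^sub>j + E\<^sub>j\<^sub>i) / sqrt 2\<close> and \<open>\<i> (E\<^sub>i\<^sub>j - E\<^sub>j\<^sub>i) / sqrt 2\<close>, where \<open>i < j\<close>.
  The coefficients of the last two are stored at positions \<open>(i, j)\<close> and \<open>(j, i)\<close>.\<close>

definition herm_of :: "nat \<Rightarrow> (nat \<times> nat \<Rightarrow> real) \<Rightarrow> complex mat" where
  "herm_of n c = mat n n (\<lambda>(i, j).
     if i = j then complex_of_real (c (i, i))
     else if i < j then Complex (c (i, j)) (c (j, i)) / complex_of_real (sqrt 2)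
     else Complex (c (j, i)) (- c (i, j)) / complex_of_real (sqrt 2))"

definition herm_lebesgue :: "nat \<Rightarrow> complex mat measure" where
  "herm_lebesgue n = distr (\<Pi>\<^sub>M p\<in>{..<n} \<times> {..<n}. lborel) (herm_borel n) (herm_of n)"

text \<open>\<open>tr (x\<^sup>2)\<close> is real for Hermitian \<open>x\<close>.\<close>

definition herm_weight :: "real \<Rightarrow> complex mat \<Rightarrow> real" where
  "herm_weight \<mu> x = cmod (det x) powr (2 * \<mu>) * exp (- Re (mat_trace (x * x)))"

definition herm_const :: "nat \<Rightarrow> real \<Rightarrow> real" where
  "herm_const n \<mu> = (\<integral>x. herm_weight \<mu> x \<partial>herm_lebesgue n)"

definition herm_measure :: "nat \<Rightarrow> real \<Rightarrow> complex mat measure" where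
  "herm_measure n \<mu> =
     density (herm_lebesgue n) (\<lambda>x. ennreal (herm_weight \<mu> x / herm_const n \<mu>))"

definition lambda_max :: "complex mat \<Rightarrow> real" where
  "lambda_max A = Max {t. eigenvalue A (complex_of_real t)}"

definition lambda_min :: "complex mat \<Rightarrow> real" where
  "lambda_min A = Min {t. eigenvalue A (complex_of_real t)}"

lemma mem_Herm_iff:
  "A \<in> Herm n \<longleftrightarrow> A \<in> carrier_mat n n \<and> (\<forall>i<n. \<forall>j<n. A $$ (j, i) = cnj (A $$ (i, j)))"
proof (cases "A \<in> carrier_mat n n")
  case True
  then have dim: "dim_row A = n" "dim_col A = n" by auto
  have adj: "mat_adjoint A \<in> carrier_mat n n"
    "\<And>i j. i < n \<Longrightarrow> j < n \<Longrightarrow> mat_adjoint A $$ (i, j) = cnj (A $$ (j, i))"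
    using dim by (auto simp: mat_adjoint_def mat_of_rows_def)
  have "mat_adjoint A = A \<longleftrightarrow> (\<forall>i<n. \<forall>j<n. mat_adjoint A $$ (j, i) = A $$ (j, i))"
    using adj(1) dim unfolding mat_eq_iff by auto
  also have "\<dots> \<longleftrightarrow> (\<forall>i<n. \<forall>j<n. cnj (A $$ (i, j)) = A $$ (j, i))"
    by (simp add: adj(2) cong: all_cong)
  finally show ?thesis
    using True unfolding Herm_def mem_Collect_eq by metis
qed (simp add: Herm_def)

text \<open>The coordinate map is a measurable linear isometry onto \<open>Herm n\<close>, so \<^const>\<open>herm_lebesgue\<close>
  is the Euclidean measure of the inner product \<open>tr (x y)\<close>.\<close>

lemma herm_of_bij:
  "bij_betw (herm_of n) (({..<n} \<times> {..<n}) \<rightarrow>\<^sub>E UNIV) (Herm n)"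
proof (rule bij_betwI[where g = "\<lambda>A. \<lambda>(i, j)\<in>{..<n} \<times> {..<n}.
    if i = j then Re (A $$ (i, i)) else if i < j then sqrt 2 * Re (A $$ (i, j))
    else sqrt 2 * Im (A $$ (j, i))"], goal_cases)
  case 1
  then show ?case by (auto simp: mem_Herm_iff herm_of_def complex_eq_iff)
next
  case 2
  then show ?case by (auto simp: PiE_def extensional_def restrict_def)
next
  case (3 c)
  show ?case
  proof (rule ext)
    fix p :: "nat \<times> nat"
    obtain i j where p: "p = (i, j)" by (cases p)
    have "p \<notin> {..<n} \<times> {..<n} \<Longrightarrow> c p = undefined"
      using 3 by (rule PiE_arb)
    then show "(\<lambda>(i, j)\<in>{..<n} \<times> {..<n}.
        if i = j then Re (herm_of n c $$ (i, i)) else if i < j then sqrt 2 * Re (herm_of n c $$ (i, j))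
        else sqrt 2 * Im (herm_of n c $$ (j, i))) p = c p"
      by (simp add: p herm_of_def restrict_def)
  qed
next
  case (4 A)
  then have A: "A \<in> carrier_mat n n"
    and h: "\<And>i j. i < n \<Longrightarrow> j < n \<Longrightarrow> A $$ (j, i) = cnj (A $$ (i, j))"
    unfolding mem_Herm_iff by blast+
  have d: "Im (A $$ (i, i)) = 0" if "i < n" for i
    using arg_cong[where f = Im, OF h[OF that that]] by simp
  show ?case
  proof (rule eq_matI)
    fix i j assume "i < dim_row A" "j < dim_col A"
    with A have ij: "i < n" "j < n" by auto
    then have "Re (A $$ (j, i)) = Re (A $$ (i, j))" "Im (A $$ (j, i)) = - Im (A $$ (i, j))"
      using arg_cong[where f = Re, OF h[OF ij]] arg_cong[where f = Im, OF h[OF ij]] by simp_all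
    with ij d[OF ij(1)] show "herm_of n (\<lambda>(i, j)\<in>{..<n} \<times> {..<n}.
      if i = j then Re (A $$ (i, i)) else if i < j then sqrt 2 * Re (A $$ (i, j))
      else sqrt 2 * Im (A $$ (j, i))) $$ (i, j) = A $$ (i, j)"
      by (auto simp: herm_of_def complex_eq_iff)
  qed (use A in \<open>auto simp: herm_of_def\<close>)
qed

lemma herm_of_isometry:
  "mat_trace (herm_of n c * herm_of n d) =
     complex_of_real (\<Sum>p\<in>{..<n} \<times> {..<n}. c p * d p)"
proof -
  define f where "f = (\<lambda>i j. herm_of n c $$ (i, j) * herm_of n d $$ (j, i))"
  define g where "g = (\<lambda>i j. complex_of_real (c (i, j) * d (i, j)))"
  have fg: "f i j + f j i = g i j + g j i" if "i < n" "j < n" for i j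
    using that
    by (cases i j rule: linorder_cases)
      (auto simp: f_def g_def herm_of_def complex_eq_iff field_simps)
  have "2 * (\<Sum>i<n. \<Sum>j<n. f i j) = (\<Sum>i<n. \<Sum>j<n. f i j) + (\<Sum>i<n. \<Sum>j<n. f j i)"
    using sum.swap[of f "{..<n}" "{..<n}"] by simp
  also have "\<dots> = (\<Sum>i<n. \<Sum>j<n. g i j) + (\<Sum>i<n. \<Sum>j<n. g j i)"
    unfolding sum.distrib[symmetric] by (intro sum.cong refl fg) auto
  also have "\<dots> = 2 * (\<Sum>i<n. \<Sum>j<n. g i j)"
    using sum.swap[of g "{..<n}" "{..<n}"] by simp
  finally have "(\<Sum>i<n. \<Sum>j<n. f i j) = (\<Sum>i<n. \<Sum>j<n. g i j)" by simp
  moreover have "dim_row (herm_of n c) = n" "dim_col (herm_of n c) = n"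
    "dim_row (herm_of n d) = n" "dim_col (herm_of n d) = n" by (auto simp: herm_of_def)
  ultimately show ?thesis
    by (simp add: mat_trace_def scalar_prod_def f_def g_def atLeast0LessThan
      sum.cartesian_product case_prod_unfold)
qed

lemma herm_of_measurable:
  "herm_of n \<in> (\<Pi>\<^sub>M p\<in>{..<n} \<times> {..<n}. lborel) \<rightarrow>\<^sub>M herm_borel n"
  unfolding herm_borel_def
proof (rule measurable_vimage_algebra2)
  show "herm_of n \<in> space (\<Pi>\<^sub>M p\<in>{..<n} \<times> {..<n}. lborel) \<rightarrow> Herm n"
    using herm_of_bij[of n] by (auto simp: space_PiM bij_betw_def)
  have "(\<lambda>c. herm_of n c $$ (i, j)) \<in> borel_measurable (\<Pi>\<^sub>M p\<in>{..<n} \<times> {..<n}. lborel)"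
    if ij: "i < n" "j < n" for i j
  proof -
    let ?L = "\<Pi>\<^sub>M p\<in>{..<n} \<times> {..<n}. (lborel :: real measure)"
    have [measurable]: "(\<lambda>c. c p) \<in> borel_measurable ?L" if "p \<in> {..<n} \<times> {..<n}" for p
      using measurable_component_singleton[OF that, of "\<lambda>_. lborel"] by simp
    have [measurable]: "(i, j) \<in> {..<n} \<times> {..<n}" "(j, i) \<in> {..<n} \<times> {..<n}"
      "(i, i) \<in> {..<n} \<times> {..<n}" using ij by auto
    consider "i = j" | "i < j" | "j < i" by linarith
    then show ?thesis
    proof cases
      case 1
      have "(\<lambda>c. complex_of_real (c (i, i))) \<in> borel_measurable ?L" by measurable
      then show ?thesis using 1 ij by (simp add: herm_of_def)
    next
      case 2
      have "(\<lambda>c. (complex_of_real (c (i, j)) + \<i> * complex_of_real (c (j, i)))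
          / complex_of_real (sqrt 2)) \<in> borel_measurable ?L" by measurable
      then show ?thesis using 2 ij by (simp add: herm_of_def Complex_eq)
    next
      case 3
      have "(\<lambda>c. (complex_of_real (c (j, i)) + \<i> * complex_of_real (- c (i, j)))
          / complex_of_real (sqrt 2)) \<in> borel_measurable ?L" by measurable
      then show ?thesis using 3 ij by (simp add: herm_of_def Complex_eq)
    qed
  qed
  then show "(\<lambda>c. \<lambda>p\<in>{..<n} \<times> {..<n}. herm_of n c $$ p)
      \<in> (\<Pi>\<^sub>M p\<in>{..<n} \<times> {..<n}. lborel) \<rightarrow>\<^sub>M (\<Pi>\<^sub>M p\<in>{..<n} \<times> {..<n}. borel)"
    by (intro measurable_restrict) auto
qed

end

theory Submission
  imports Defs "HOL-Real_Asymp.Real_Asymp"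
begin

text \<open>
  For a polynomial \<open>Q\<close> the product \<open>\<Prod> Q(\<lambda>\<^sub>i)\<close> over the eigenvalues of \<open>x\<close> is a polynomial in the traces
  \<open>tr (x\<^sup>k)\<close>.  Its Gaussian integral over Hermitian matrices is, up to a factor depending only on \<open>n\<close>,
  the Gaussian integral of \<open>\<Prod> Q(\<lambda>\<^sub>i)\<close> over \<open>\<lambda> \<in> \<real>\<^sup>n\<close> against the squared Vandermonde product.  This polynomial
  form of Weyl's integration formula (\<open>integral_spec_prod\<close>) is proved without a change of variables:
  integration by parts along the vector field \<open>x\<^sup>k\<close> yields loop equations, which are the same on both sides
  and lower the degree, so that they determine the integrals of products of power sums up to a
  constant (\<open>loop_functional_unique\<close>).  Newton's identities then express \<open>\<Prod> Q(\<lambda>\<^sub>i)\<close> by power sums.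

  For a natural number \<open>m\<close> the factor \<open>det(x)\<^sup>2\<^sup>m\<close> is itself such a product, with \<open>Q = X\<^sup>2\<^sup>m\<close>.  If \<open>h \<ge> 0\<close> is a
  polynomial, Andreief's identity turns the expectation of \<open>\<Prod> h(\<lambda>\<^sub>i)\<close> under the weight with exponent \<open>2m\<close>
  into the determinant of the Gram matrix of \<open>h\<close> with respect to the orthonormal polynomials
  \<open>p\<^sub>0, \<dots>, p\<^sub>n\<^sub>-\<^sub>1\<close> of \<open>x\<^sup>2\<^sup>m exp(-x\<^sup>2)\<close>.  This matrix is positive semidefinite, and \<open>e \<le> exp(e - 1)\<close> for each of
  its eigenvalues gives
    \<open>E [\<Prod> h(\<lambda>\<^sub>i)] \<le> exp (\<Sum>j<n. \<integral> (h - 1) d\<nu>\<^sub>j)\<close>, where \<open>d\<nu>\<^sub>j = p\<^sub>j\<^sup>2 x\<^sup>2\<^sup>m exp(-x\<^sup>2) dx\<close>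
  (\<open>vander_int_herm\<close>).  All that has to be known about the joint law of the eigenvalues is contained in this
  inequality; what remains concerns the one-dimensional measures \<open>\<nu>\<^sub>j\<close>.

  The \<open>p\<^sub>j\<close> are generalized Hermite polynomials.  Their recurrence coefficients satisfy \<open>a\<^sub>j\<^sup>2 = j/2\<close> for even
  and \<open>a\<^sub>j\<^sup>2 = j/2 + m\<close> for odd \<open>j\<close>, so the moments of \<open>\<nu>\<^sub>j\<close> count weighted lattice paths, and they grow like
  the powers of \<open>a\<^sub>j + a\<^sub>j\<^sub>+\<^sub>1\<close>, that is, of \<open>sqrt (j/2) + sqrt (j/2 + m)\<close> (\<open>nu_monom_le\<close>, \<open>nu_monom_ge\<close>).  With
  \<open>j = n\<close> and \<open>m = c n\<close> this number is \<open>b sqrt n\<close>.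

  A real exponent \<open>\<mu>\<close> lies between \<open>m = \<lfloor>\<mu>\<rfloor>\<close> and \<open>m + 1\<close>.  Bounding the missing fractional power of \<open>det(x)\<^sup>2\<close> from
  above and below by polynomials compares the law for \<open>\<mu>\<close> with those for \<open>m\<close> and \<open>m + 1\<close>, at the price of
  a factor of order \<open>n\<^sup>2\<close> (\<open>herm_measure_spec_real_le\<close>).

  Two test polynomials finish the proof.  With \<open>h = 1 + s x\<^sup>2\<^sup>k\<close>, where \<open>k\<close> is a small multiple of \<open>n\<close>, an
  eigenvalue outside \<open>[- T sqrt n, T sqrt n]\<close> with \<open>T > b\<close> makes the product exponentially large, while its
  expectation is bounded.  For \<open>t < b\<close> there is an \<open>h \<ge> 0\<close> with \<open>h \<ge> 1\<close> on \<open>(-\<infinity>, t sqrt n]\<close> and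
  \<open>\<Sum>j<n. \<integral> (h - 1) d\<nu>\<^sub>j \<le> - \<delta> n\<close>; if no eigenvalue exceeds \<open>t sqrt n\<close>, the product is at least \<open>1\<close>, which
  therefore has exponentially small probability.  The mirror image of \<open>h\<close> treats the smallest eigenvalue,
  and the Borel-Cantelli lemma concludes.
\<close>

hide_const (open) module.smult

section \<open>Gaussian integration of polynomial functions\<close>

definition gauss_moment :: "nat \<Rightarrow> real" where
  "gauss_moment k = (\<integral>x. x ^ k * exp (- x\<^sup>2) \<partial>lborel)"

lemma has_gauss_moment_even:
  "has_bochner_integral lborel (\<lambda>x. x ^ (2 * k) * exp (- x\<^sup>2))
     (sqrt pi * (fact (2 * k) / (2 ^ (2 * k) * fact k)))"
  using has_bochner_integral_even_function[OF gaussian_moment_even_pos[where k = k]]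
  by (simp add: mult.commute)

lemma has_gauss_moment_odd:
  "has_bochner_integral lborel (\<lambda>x::real. x ^ (2 * k + 1) * exp (- x\<^sup>2)) 0"
proof -
  have "has_bochner_integral lborel (\<lambda>x. exp (- x\<^sup>2) * x ^ (2 * k + 1) :: real) 0"
    using gaussian_moment_odd_pos by (rule has_bochner_integral_odd_function) simp
  then show ?thesis by (simp add: mult.commute)
qed

lemma integrable_gauss_moment: "integrable lborel (\<lambda>x::real. x ^ k * exp (- x\<^sup>2))"
proof (cases "even k")
  case True
  then obtain j where "k = 2 * j" by (elim evenE)
  then show ?thesis using has_gauss_moment_even[of j] by (auto simp: has_bochner_integral_iff)
next
  case False
  then obtain j where "k = 2 * j + 1" by (elim oddE)
  then show ?thesis using has_gauss_moment_odd[of j] by (auto simp: has_bochner_integral_iff)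
qed

lemma gauss_moment_odd: "odd k \<Longrightarrow> gauss_moment k = 0"
  using has_gauss_moment_odd
  by (auto simp: gauss_moment_def has_bochner_integral_iff elim!: oddE)

lemma gauss_moment_even_pos: "gauss_moment (2 * k) > 0"
  using has_gauss_moment_even[of k] by (auto simp: gauss_moment_def has_bochner_integral_iff)

lemma gauss_moment_Suc_Suc: "2 * gauss_moment (Suc (Suc k)) = real (Suc k) * gauss_moment k"
proof (cases "even k")
  case True
  then obtain j where k: "k = 2 * j" by (elim evenE)
  have *: "gauss_moment (2 * j) = sqrt pi * (fact (2 * j) / (2 ^ (2 * j) * fact j))" for j
    using has_gauss_moment_even[of j] by (auto simp: gauss_moment_def has_bochner_integral_iff)
  have f: "fact (2 * Suc j) = real (2 * Suc j) * (real (2 * j + 1) * fact (2 * j))"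
    "fact (Suc j) = real (Suc j) * fact j" "(2::real) ^ (2 * Suc j) = 4 * 2 ^ (2 * j)" by simp_all
  have "Suc (Suc k) = 2 * Suc j" using k by simp
  then have "2 * gauss_moment (Suc (Suc k)) =
      2 * (sqrt pi * (real (2 * Suc j) * (real (2 * j + 1) * fact (2 * j)) /
        (4 * 2 ^ (2 * j) * (real (Suc j) * fact j))))"
    by (simp only: * f)
  also have "\<dots> = real (2 * j + 1) * (sqrt pi * (fact (2 * j) / (2 ^ (2 * j) * fact j)))"
    by (simp add: divide_simps)
  finally show ?thesis unfolding k * by simp
next
  case False
  then show ?thesis by (simp add: gauss_moment_odd)
qed

lemma gauss_moment_rec: "2 * gauss_moment (Suc k) = real k * gauss_moment (k - 1)"
  by (cases k) (auto simp: gauss_moment_odd gauss_moment_Suc_Suc)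

definition gauss_int :: "'i set \<Rightarrow> (('i \<Rightarrow> real) \<Rightarrow> complex) \<Rightarrow> complex" where
  "gauss_int I f =
     (\<integral>c. f c * of_real (exp (- (\<Sum>i\<in>I. (c i)\<^sup>2))) \<partial>(\<Pi>\<^sub>M i\<in>I. lborel))"

definition gauss_integrable :: "'i set \<Rightarrow> (('i \<Rightarrow> real) \<Rightarrow> complex) \<Rightarrow> bool" where
  "gauss_integrable I f =
     integrable (\<Pi>\<^sub>M i\<in>I. lborel) (\<lambda>c. f c * of_real (exp (- (\<Sum>i\<in>I. (c i)\<^sup>2))))"

interpretation lborel_product: product_sigma_finite "\<lambda>_. lborel :: real measure"
  by unfold_locales

lemma gauss_prod:
  fixes f :: "'i \<Rightarrow> real \<Rightarrow> complex"
  assumes "finite I"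
    and "\<And>i. i \<in> I \<Longrightarrow> integrable lborel (\<lambda>x. f i x * of_real (exp (- x\<^sup>2)))"
  shows "gauss_integrable I (\<lambda>c. \<Prod>i\<in>I. f i (c i))"
    and "gauss_int I (\<lambda>c. \<Prod>i\<in>I. f i (c i)) =
           (\<Prod>i\<in>I. \<integral>x. f i x * of_real (exp (- x\<^sup>2)) \<partial>lborel)"
proof -
  have eq: "(\<Prod>i\<in>I. f i (c i)) * of_real (exp (- (\<Sum>i\<in>I. (c i)\<^sup>2))) =
      (\<Prod>i\<in>I. f i (c i) * of_real (exp (- (c i)\<^sup>2)))" for c
    using assms(1) by (simp add: prod.distrib sum_negf[symmetric] exp_sum del: sum_negf)
  show "gauss_integrable I (\<lambda>c. \<Prod>i\<in>I. f i (c i))"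
    unfolding gauss_integrable_def eq using assms
    by (rule lborel_product.product_integrable_prod)
  show "gauss_int I (\<lambda>c. \<Prod>i\<in>I. f i (c i)) =
      (\<Prod>i\<in>I. \<integral>x. f i x * of_real (exp (- x\<^sup>2)) \<partial>lborel)"
    unfolding gauss_int_def eq using assms
    by (rule lborel_product.product_integral_prod)
qed

lemma gauss_integrable_add:
  "gauss_integrable I f \<Longrightarrow> gauss_integrable I g \<Longrightarrow> gauss_integrable I (\<lambda>c. f c + g c)"
  by (simp add: gauss_integrable_def distrib_right)

lemma gauss_int_add:
  "gauss_integrable I f \<Longrightarrow> gauss_integrable I g \<Longrightarrow>
     gauss_int I (\<lambda>c. f c + g c) = gauss_int I f + gauss_int I g"
  by (simp add: gauss_int_def gauss_integrable_def distrib_right)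

lemma gauss_int_scale: "gauss_int I (\<lambda>c. a * f c) = a * gauss_int I f"
  by (simp add: gauss_int_def mult.assoc)

text \<open>Polynomial functions of the coordinates in \<open>I\<close>.  Generating them by monomials and sums reduces every
  linear statement about their Gaussian integrals to monomials.\<close>

inductive polyf :: "'i set \<Rightarrow> (('i \<Rightarrow> real) \<Rightarrow> complex) \<Rightarrow> bool" for I where
  monomial: "polyf I (\<lambda>c. a * (\<Prod>i\<in>I. of_real (c i) ^ e i))"
| add: "polyf I f \<Longrightarrow> polyf I g \<Longrightarrow> polyf I (\<lambda>c. f c + g c)"

lemma gauss_int_monomial:
  assumes "finite I"
  shows "gauss_integrable I (\<lambda>c. a * (\<Prod>i\<in>I. of_real (c i) ^ e i))"
    and "gauss_int I (\<lambda>c. a * (\<Prod>i\<in>I. of_real (c i) ^ e i)) =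
           a * of_real (\<Prod>i\<in>I. gauss_moment (e i))"
proof -
  have i: "integrable lborel (\<lambda>x. complex_of_real x ^ k * of_real (exp (- x\<^sup>2)))" for k
    using integrable_of_real[OF integrable_gauss_moment[of k], where 'a = complex] by simp
  have m: "(\<integral>x. complex_of_real x ^ k * of_real (exp (- x\<^sup>2)) \<partial>lborel) = of_real (gauss_moment k)" for k
    unfolding gauss_moment_def integral_complex_of_real[symmetric] by simp
  show "gauss_integrable I (\<lambda>c. a * (\<Prod>i\<in>I. of_real (c i) ^ e i))"
    using gauss_prod(1)[OF assms, of "\<lambda>i x. of_real x ^ e i"] i
    by (simp add: gauss_integrable_def mult.assoc)
  show "gauss_int I (\<lambda>c. a * (\<Prod>i\<in>I. of_real (c i) ^ e i)) =
           a * of_real (\<Prod>i\<in>I. gauss_moment (e i))"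
    using gauss_prod(2)[OF assms, of "\<lambda>i x. of_real x ^ e i"] i
    by (simp add: gauss_int_scale m)
qed

lemma polyf_gauss_integrable:
  assumes "finite I" "polyf I f" shows "gauss_integrable I f"
  using assms(2)
  by (induction rule: polyf.induct) (auto intro: gauss_int_monomial gauss_integrable_add assms(1))

lemma polyf_scale: "polyf I f \<Longrightarrow> polyf I (\<lambda>c. b * f c)"
proof (induction rule: polyf.induct)
  case (monomial a e)
  show ?case using polyf.monomial[of I "b * a" e] by (simp add: mult.assoc)
next
  case (add f g)
  then show ?case using polyf.add by (simp add: distrib_left)
qed

lemma polyf_monomial_mult:
  "polyf I f \<Longrightarrow> polyf I (\<lambda>c. (a * (\<Prod>i\<in>I. of_real (c i) ^ e i)) * f c)"
proof (induction rule: polyf.induct)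
  case (monomial a' e')
  show ?case using polyf.monomial[of I "a * a'" "\<lambda>i. e i + e' i"]
    by (simp add: mult_ac power_add prod.distrib)
next
  case (add f g)
  then show ?case using polyf.add by (simp add: distrib_left)
qed

lemma polyf_mult: "polyf I f \<Longrightarrow> polyf I g \<Longrightarrow> polyf I (\<lambda>c. f c * g c)"
proof (induction rule: polyf.induct)
  case (monomial a e)
  then show ?case by (rule polyf_monomial_mult)
next
  case (add f g)
  then show ?case using polyf.add by (simp add: distrib_right)
qed

lemma polyf_const: "polyf I (\<lambda>c. a)"
  using polyf.monomial[of I a "\<lambda>_. 0"] by simp

lemma polyf_coord: "finite I \<Longrightarrow> p \<in> I \<Longrightarrow> polyf I (\<lambda>c. of_real (c p))"
  using polyf.monomial[of I 1 "\<lambda>i. if i = p then 1 else 0"]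
  by (simp add: if_distrib[where f = "\<lambda>x. _ ^ x"] prod.delta cong: if_cong)

lemma polyf_sum: "(\<And>i. i \<in> A \<Longrightarrow> polyf I (f i)) \<Longrightarrow> polyf I (\<lambda>c. \<Sum>i\<in>A. f i c)"
  by (induction A rule: infinite_finite_induct) (auto intro: polyf_const polyf.add)

lemma polyf_prod: "(\<And>i. i \<in> A \<Longrightarrow> polyf I (f i)) \<Longrightarrow> polyf I (\<lambda>c. \<Prod>i\<in>A. f i c)"
  by (induction A rule: infinite_finite_induct) (auto intro: polyf_const polyf_mult)

lemma polyf_power: "polyf I f \<Longrightarrow> polyf I (\<lambda>c. f c ^ k)"
  by (induction k) (auto intro: polyf_const polyf_mult)

lemma polyf_diff: "polyf I f \<Longrightarrow> polyf I g \<Longrightarrow> polyf I (\<lambda>c. f c - g c)"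
  using polyf.add[OF _ polyf_scale[of I g "-1"]] by simp

lemma polyf_prod_list: "(\<And>x. x \<in> set xs \<Longrightarrow> polyf I (f x)) \<Longrightarrow> polyf I (\<lambda>c. \<Prod>x\<leftarrow>xs. f x c)"
  by (induction xs) (auto intro: polyf_const polyf_mult)

lemma polyf_sum_list: "(\<And>x. x \<in> set xs \<Longrightarrow> polyf I (f x)) \<Longrightarrow> polyf I (\<lambda>c. \<Sum>x\<leftarrow>xs. f x c)"
  by (induction xs) (auto intro: polyf_const polyf.add)

lemmas polyf_intros = polyf_const polyf.add polyf_diff polyf_mult polyf_power polyf_sum polyf_prod
  polyf_prod_list polyf_sum_list

lemma gauss_int_sum:
  assumes "finite I" "\<And>i. i \<in> A \<Longrightarrow> polyf I (f i)"
  shows "gauss_int I (\<lambda>c. \<Sum>i\<in>A. f i c) = (\<Sum>i\<in>A. gauss_int I (f i))"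
  using assms(2)
proof (induction A rule: infinite_finite_induct)
  case (insert x A)
  have "gauss_integrable I (f x)" "gauss_integrable I (\<lambda>c. \<Sum>i\<in>A. f i c)"
    using insert.prems by (auto intro: polyf_gauss_integrable polyf_sum assms(1))
  with insert show ?case by (simp add: gauss_int_add)
qed (auto simp: gauss_int_def)

definition has_pderiv :: "'i \<Rightarrow> (('i \<Rightarrow> real) \<Rightarrow> complex) \<Rightarrow> (('i \<Rightarrow> real) \<Rightarrow> complex) \<Rightarrow> bool" where
  "has_pderiv p f f' \<longleftrightarrow>
     (\<forall>c. ((\<lambda>t. f (c(p := t))) has_vector_derivative f' c) (at (c p)))"

lemma has_pderiv_const: "has_pderiv p (\<lambda>c. a) (\<lambda>c. 0)"
  by (simp add: has_pderiv_def)

lemma has_pderiv_add: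
  "has_pderiv p f f' \<Longrightarrow> has_pderiv p g g' \<Longrightarrow> has_pderiv p (\<lambda>c. f c + g c) (\<lambda>c. f' c + g' c)"
  by (auto simp: has_pderiv_def intro!: has_vector_derivative_add)

lemma has_pderiv_mult:
  "has_pderiv p f f' \<Longrightarrow> has_pderiv p g g' \<Longrightarrow>
     has_pderiv p (\<lambda>c. f c * g c) (\<lambda>c. f' c * g c + f c * g' c)"
  unfolding has_pderiv_def
proof
  fix c
  assume "\<forall>c. ((\<lambda>t. f (c(p := t))) has_vector_derivative f' c) (at (c p))"
    and "\<forall>c. ((\<lambda>t. g (c(p := t))) has_vector_derivative g' c) (at (c p))"
  then have "((\<lambda>t. f (c(p := t)) * g (c(p := t))) has_vector_derivative
      f (c(p := c p)) * g' c + f' c * g (c(p := c p))) (at (c p))"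
    by (intro has_vector_derivative_mult) auto
  then show "((\<lambda>t. f (c(p := t)) * g (c(p := t))) has_vector_derivative
      f' c * g c + f c * g' c) (at (c p))" by (simp add: add.commute)
qed

lemma has_pderiv_coord: "has_pderiv p (\<lambda>c. of_real (c q)) (\<lambda>c. if q = p then 1 else 0)"
proof -
  have "(complex_of_real has_vector_derivative 1) (at x)" for x :: real
    using has_vector_derivative_of_real[of "\<lambda>x. x" 1 "at x", where 'a = complex] by simp
  then show ?thesis by (auto simp: has_pderiv_def)
qed

lemma has_pderiv_cong: "has_pderiv p f f' \<Longrightarrow> (\<And>c. f' c = g' c) \<Longrightarrow> has_pderiv p f g'"
  by (auto simp: has_pderiv_def)

lemma has_pderiv_scale: "has_pderiv p f f' \<Longrightarrow> has_pderiv p (\<lambda>c. a * f c) (\<lambda>c. a * f' c)"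
  by (rule has_pderiv_cong[OF has_pderiv_mult[OF has_pderiv_const]]) auto

lemma has_pderiv_sum:
  "(\<And>i. i \<in> A \<Longrightarrow> has_pderiv p (f i) (f' i)) \<Longrightarrow>
     has_pderiv p (\<lambda>c. \<Sum>i\<in>A. f i c) (\<lambda>c. \<Sum>i\<in>A. f' i c)"
  by (induction A rule: infinite_finite_induct) (auto intro: has_pderiv_add has_pderiv_const)

lemma has_pderiv_power:
  "has_pderiv p f f' \<Longrightarrow> has_pderiv p (\<lambda>c. f c ^ k) (\<lambda>c. of_nat k * f c ^ (k - 1) * f' c)"
proof (induction k)
  case (Suc k)
  show ?case unfolding power_Suc
    by (rule has_pderiv_cong[OF has_pderiv_mult[OF Suc.prems Suc.IH[OF Suc.prems]]])
      (cases k; simp add: algebra_simps)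
qed (simp add: has_pderiv_const)

lemma has_pderiv_unique: "has_pderiv p f f' \<Longrightarrow> has_pderiv p f g' \<Longrightarrow> f' = g'"
  unfolding has_pderiv_def by (auto intro!: ext vector_derivative_unique_at)

text \<open>On a monomial, integration by parts is the recursion of the one-dimensional Gaussian moments.\<close>

lemma gauss_int_by_parts_exists:
  assumes I: "finite I" "p \<in> I" and "polyf I f"
  shows "\<exists>f'. polyf I f' \<and> has_pderiv p f f' \<and>
           2 * gauss_int I (\<lambda>c. of_real (c p) * f c) = gauss_int I f'"
  using assms(3)
proof (induction rule: polyf.induct)
  case (monomial a e)
  let ?r = "\<lambda>c. \<Prod>i\<in>I - {p}. complex_of_real (c i) ^ e i"
  let ?e = "e(p := e p - 1)"
  have split: "(\<Prod>i\<in>I. complex_of_real (c i) ^ (e(p := k)) i) = of_real (c p) ^ k * ?r c" for c k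
    by (subst prod.remove[OF I]) (auto intro!: arg_cong2[where f = "(*)"] prod.cong)
  have split': "(\<Prod>i\<in>I. complex_of_real (c i) ^ e i) = of_real (c p) ^ e p * ?r c" for c
    using split[of c "e p"] by simp
  have splitr: "(\<Prod>i\<in>I. g i) = g p * (\<Prod>i\<in>I - {p}. g i)" for g :: "'a \<Rightarrow> real"
    using I by (rule prod.remove)
  have updr: "(\<Prod>i\<in>I - {p}. gauss_moment ((e(p := k)) i)) = (\<Prod>i\<in>I - {p}. gauss_moment (e i))" for k
    by (rule prod.cong) auto
  let ?f' = "\<lambda>c. (of_nat (e p) * a) * (\<Prod>i\<in>I. of_real (c i) ^ ?e i)"
  have "has_pderiv p (\<lambda>c. a * (of_real (c p) ^ e p * ?r c))
      (\<lambda>c. a * ((of_nat (e p) * of_real (c p) ^ (e p - 1) * 1) * ?r c + of_real (c p) ^ e p * 0))"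
  proof (intro has_pderiv_scale has_pderiv_mult)
    show "has_pderiv p (\<lambda>c. of_real (c p) ^ e p) (\<lambda>c. of_nat (e p) * of_real (c p) ^ (e p - 1) * 1)"
      using has_pderiv_power[OF has_pderiv_coord[of p p]] by simp
    have "?r (c(p := t)) = ?r c" for c t by (rule prod.cong) auto
    then show "has_pderiv p ?r (\<lambda>c. 0)" by (simp add: has_pderiv_def)
  qed
  then have d: "has_pderiv p (\<lambda>c. a * (\<Prod>i\<in>I. of_real (c i) ^ e i)) ?f'"
    unfolding split split' by (simp add: mult_ac)
  have "2 * gauss_int I (\<lambda>c. of_real (c p) * (a * (\<Prod>i\<in>I. of_real (c i) ^ e i))) =
        2 * gauss_int I (\<lambda>c. a * (\<Prod>i\<in>I. of_real (c i) ^ (e(p := Suc (e p))) i))"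
    unfolding split split' by (simp add: mult_ac)
  also have "\<dots> = a * of_real ((2 * gauss_moment (Suc (e p))) * (\<Prod>i\<in>I - {p}. gauss_moment (e i)))"
    unfolding gauss_int_monomial[OF I(1)] splitr[of "\<lambda>i. gauss_moment ((e(p := Suc (e p))) i)"] updr
    by simp
  also have "\<dots> = gauss_int I ?f'"
    unfolding gauss_int_monomial[OF I(1)] splitr[of "\<lambda>i. gauss_moment (?e i)"] updr gauss_moment_rec
    by simp
  finally show ?case using d polyf.monomial[of I "of_nat (e p) * a" ?e] by blast
next
  case (add f g)
  then obtain f' g' where *: "polyf I f'" "has_pderiv p f f'"
      "2 * gauss_int I (\<lambda>c. of_real (c p) * f c) = gauss_int I f'"
      "polyf I g'" "has_pderiv p g g'" "2 * gauss_int I (\<lambda>c. of_real (c p) * g c) = gauss_int I g'"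
    by blast
  have "2 * gauss_int I (\<lambda>c. of_real (c p) * (f c + g c)) = gauss_int I (\<lambda>c. f' c + g' c)"
    unfolding distrib_left
    by (subst (1 2) gauss_int_add)
      (auto intro!: polyf_gauss_integrable polyf_intros polyf_coord I add.hyps * simp: distrib_left *)
  with * show ?case by (intro exI[of _ "\<lambda>c. f' c + g' c"]) (auto intro: polyf.add has_pderiv_add)
qed

text \<open>Since a partial derivative is unique, the formula applies to whichever derivative the usual rules
  produce; in particular that derivative is again a polynomial function.\<close>

lemma gauss_int_by_parts:
  assumes "finite I" "p \<in> I" "polyf I f" "has_pderiv p f f'"
  shows "2 * gauss_int I (\<lambda>c. of_real (c p) * f c) = gauss_int I f'"
    and "polyf I f'"
  using gauss_int_by_parts_exists[OF assms(1-3)] has_pderiv_unique[OF assms(4)] by auto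

section \<open>Loop equations\<close>

lemma sum_rotate3:
  "(\<Sum>i\<in>A. \<Sum>a\<in>B. \<Sum>u\<in>C. f i a u) = (\<Sum>a\<in>B. \<Sum>u\<in>C. \<Sum>i\<in>A. f i a u :: 'z :: comm_monoid_add)"
  by (subst sum.swap) (rule sum.cong[OF refl], rule sum.swap)

lemma sum_rotate4:
  "(\<Sum>i\<in>A. \<Sum>a\<in>B. \<Sum>u\<in>C. \<Sum>v\<in>D. f i a u v) =
     (\<Sum>a\<in>B. \<Sum>u\<in>C. \<Sum>v\<in>D. \<Sum>i\<in>A. f i a u v :: 'z :: comm_monoid_add)"
  by (subst sum.swap) (rule sum.cong[OF refl], rule sum_rotate3)

lemma sum_rotate5:
  "(\<Sum>i\<in>A. \<Sum>a\<in>B. \<Sum>u\<in>C. \<Sum>v\<in>D. \<Sum>w\<in>E. f i a u v w) =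
     (\<Sum>a\<in>B. \<Sum>u\<in>C. \<Sum>v\<in>D. \<Sum>w\<in>E. \<Sum>i\<in>A. f i a u v w :: 'z :: comm_monoid_add)"
  by (subst sum.swap) (rule sum.cong[OF refl], rule sum_rotate4)

lemma sum2_product:
  "(\<Sum>i\<in>A. \<Sum>j\<in>B. f i j) * (\<Sum>u\<in>C. \<Sum>v\<in>D. g u v) =
     (\<Sum>i\<in>A. \<Sum>j\<in>B. \<Sum>u\<in>C. \<Sum>v\<in>D. f i j * g u v :: 'z :: comm_ring_1)"
  by (simp only: sum_distrib_right, simp only: sum_distrib_left)

text \<open>The derivative of a product of power sums \<open>p\<^sub>m\<close>, for \<open>m\<close> in \<open>ms\<close>, along the vector field \<open>x\<^sup>k\<close> replaces one
  factor \<open>p\<^sub>m\<close> by \<open>m\<close> times the power sum of index \<open>k + m - 1\<close>.  The list collects the resulting terms with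
  their coefficients; where the subtraction is truncated the coefficient is \<open>0\<close>.\<close>

fun contract :: "nat \<Rightarrow> nat list \<Rightarrow> (nat \<times> nat list) list" where
  "contract k [] = []"
| "contract k (m # ms) = (m, (k + m - 1) # ms) # map (\<lambda>(a, l). (a, m # l)) (contract k ms)"

text \<open>Here \<open>L ms\<close> stands for the integral of the product of the power sums \<open>p\<^sub>m\<close> with \<open>m\<close> in \<open>ms\<close>.  The second
  clause is integration by parts along \<open>x\<^sup>k\<close>: the Gaussian contributes the left-hand side, the divergence of
  the field the first sum, and the derivative of the other factors the second.\<close>

definition loop_functional :: "nat \<Rightarrow> (nat list \<Rightarrow> complex) \<Rightarrow> bool" where
  "loop_functional n L \<longleftrightarrow>
     (\<forall>ms. L (0 # ms) = of_nat n * L ms) \<and>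
     (\<forall>k ms. 2 * L (Suc k # ms) =
        (\<Sum>a<k. L (a # (k - 1 - a) # ms)) + (\<Sum>(a, l)\<leftarrow>contract k ms. of_nat a * L l))"

lemma contract_sum_length:
  "(a, l) \<in> set (contract k ms) \<Longrightarrow>
     length l = length ms \<and> (a > 0 \<longrightarrow> Suc (sum_list l) = k + sum_list ms)"
proof (induction ms arbitrary: a l)
  case (Cons m ms)
  from Cons.prems consider "a = m" "l = (k + m - 1) # ms"
    | l' where "l = m # l'" "(a, l') \<in> set (contract k ms)" by auto
  then show ?case by cases (use Cons.IH in fastforce)+
qed simp

text \<open>Each equation expresses a value by values at lists with smaller sum of entries, or with the same sum and
  smaller length.  Adding the two makes every term on the right smaller, although the divergence terms
  lengthen the list by one.\<close>

lemma loop_functional_unique: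
  assumes "loop_functional n L" "loop_functional n L'"
  shows "L ms * L' [] = L' ms * L []"
proof (induction "sum_list ms + length ms" arbitrary: ms rule: less_induct)
  case less
  show ?case
  proof (cases ms)
    case (Cons m rest)
    show ?thesis
    proof (cases m)
      case 0
      have "L rest * L' [] = L' rest * L []" by (rule less) (simp add: Cons 0)
      with assms show ?thesis by (simp add: loop_functional_def Cons 0)
    next
      case (Suc k)
      have rec: "2 * K (Suc k # rest) =
          (\<Sum>a<k. K (a # (k - 1 - a) # rest)) + (\<Sum>(a, l)\<leftarrow>contract k rest. of_nat a * K l)"
        if "loop_functional n K" for K
        using that unfolding loop_functional_def by blast
      have 1: "(\<Sum>a<k. L (a # (k - 1 - a) # rest)) * L' [] = (\<Sum>a<k. L' (a # (k - 1 - a) # rest)) * L []"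
        unfolding sum_distrib_right
        by (intro sum.cong refl less) (auto simp: Cons Suc)
      have "map (\<lambda>x. (case x of (a, l) \<Rightarrow> of_nat a * L l) * L' []) (contract k rest) =
          map (\<lambda>x. (case x of (a, l) \<Rightarrow> of_nat a * L' l) * L []) (contract k rest)"
      proof (rule map_cong[OF refl])
        fix x assume x: "x \<in> set (contract k rest)"
        obtain a l where [simp]: "x = (a, l)" by fastforce
        show "(case x of (a, l) \<Rightarrow> of_nat a * L l) * L' [] = (case x of (a, l) \<Rightarrow> of_nat a * L' l) * L []"
        proof (cases "a > 0")
          case True
          have "L l * L' [] = L' l * L []"
            by (rule less) (use contract_sum_length[of a l k rest] x True in \<open>simp add: Cons Suc\<close>)
          then show ?thesis by (simp add: mult.assoc)
        qed simp
      qed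
      from arg_cong[OF this, of sum_list]
      have 2: "(\<Sum>(a, l)\<leftarrow>contract k rest. of_nat a * L l) * L' [] =
          (\<Sum>(a, l)\<leftarrow>contract k rest. of_nat a * L' l) * L []"
        by (simp only: sum_list_mult_const)
      have "2 * L ms * L' [] = 2 * L' ms * L []"
        unfolding Cons Suc rec[OF assms(1)] rec[OF assms(2)] distrib_right 1 2 ..
      then show ?thesis by simp
    qed
  qed simp
qed

definition pprod :: "(nat \<Rightarrow> 'c \<Rightarrow> complex) \<Rightarrow> nat list \<Rightarrow> 'c \<Rightarrow> complex" where
  "pprod P ms c = (\<Prod>m\<leftarrow>ms. P m c)"

lemma pprod_simps [simp]: "pprod P [] c = 1" "pprod P (m # ms) c = P m c * pprod P ms c"
  by (simp_all add: pprod_def)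

lemma polyf_pprod: "(\<And>m. polyf I (P m)) \<Longrightarrow> polyf I (pprod P ms)"
  unfolding pprod_def by (intro polyf_intros)

text \<open>The vector field \<open>v\<close> and the weight \<open>W\<close> are kept abstract because the argument is used twice: for matrices
  with \<open>W = 1\<close>, and for eigenvalues with the squared Vandermonde product.\<close>

lemma gauss_int_loop:
  fixes P :: "nat \<Rightarrow> ('i \<Rightarrow> real) \<Rightarrow> complex"
  assumes I: "finite I" and W: "polyf I W" and P: "\<And>m. polyf I (P m)" and v: "\<And>p. p \<in> I \<Longrightarrow> polyf I (v p)"
    and dP: "\<And>m p. p \<in> I \<Longrightarrow> has_pderiv p (P m) (dP m p)"
    and dvW: "\<And>p. p \<in> I \<Longrightarrow> has_pderiv p (\<lambda>c. v p c * W c) (dvW p)"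
    and along: "\<And>m c. (\<Sum>p\<in>I. v p c * dP m p c) = of_nat m * P (k + m - 1) c"
    and radial: "\<And>c. (\<Sum>p\<in>I. of_real (c p) * v p c) = P (Suc k) c"
    and diverg: "\<And>c. (\<Sum>p\<in>I. dvW p c) = W c * (\<Sum>a<k. P a c * P (k - 1 - a) c)"
  shows "2 * gauss_int I (\<lambda>c. W c * pprod P (Suc k # ms) c) =
     (\<Sum>a<k. gauss_int I (\<lambda>c. W c * pprod P (a # (k - 1 - a) # ms) c)) +
     (\<Sum>(a, l)\<leftarrow>contract k ms. of_nat a * gauss_int I (\<lambda>c. W c * pprod P l c))"
proof -
  define dF where "dF = rec_list (\<lambda>p c. 0) (\<lambda>m ms d p c. dP m p c * pprod P ms c + P m c * d p c)"
  have dF [simp]: "dF [] p c = 0" "dF (m # ms) p c = dP m p c * pprod P ms c + P m c * dF ms p c"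
    for m ms p c by (simp_all add: dF_def)
  have dF_deriv: "has_pderiv p (pprod P ms) (dF ms p)" if "p \<in> I" for p ms
  proof (induction ms)
    case Nil
    have "pprod P [] = (\<lambda>_. 1)" "dF [] p = (\<lambda>_. 0)" by auto
    then show ?case by (simp add: has_pderiv_const)
  next
    case (Cons m ms)
    have "pprod P (m # ms) = (\<lambda>c. P m c * pprod P ms c)"
      "dF (m # ms) p = (\<lambda>c. dP m p c * pprod P ms c + P m c * dF ms p c)" by auto
    then show ?case by (simp only: has_pderiv_mult[OF dP[OF that] Cons])
  qed
  have dF_along: "(\<Sum>p\<in>I. v p c * dF ms p c) = (\<Sum>(a, l)\<leftarrow>contract k ms. of_nat a * pprod P l c)" for c
  proof (induction ms)
    case (Cons m ms)
    have "(\<Sum>p\<in>I. v p c * dF (m # ms) p c) =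
        (\<Sum>p\<in>I. v p c * dP m p c) * pprod P ms c + P m c * (\<Sum>p\<in>I. v p c * dF ms p c)"
      by (simp add: sum.distrib distrib_left sum_distrib_left sum_distrib_right mult_ac)
    also have "\<dots> = (\<Sum>(a, l)\<leftarrow>contract k (m # ms). of_nat a * pprod P l c)"
      unfolding along Cons
      by (simp add: sum_list_const_mult[symmetric] o_def case_prod_unfold mult_ac)
    finally show ?case .
  qed simp
  have pp: "polyf I (pprod P l)" for l using P by (rule polyf_pprod)
  have ibp: "2 * gauss_int I (\<lambda>c. of_real (c p) * ((v p c * W c) * pprod P ms c)) =
        gauss_int I (\<lambda>c. dvW p c * pprod P ms c + (v p c * W c) * dF ms p c)"
      "polyf I (\<lambda>c. dvW p c * pprod P ms c + (v p c * W c) * dF ms p c)" if "p \<in> I" for p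
  proof -
    have "polyf I (\<lambda>c. (v p c * W c) * pprod P ms c)" by (intro polyf_intros v W pp that)
    note gauss_int_by_parts[OF I that this has_pderiv_mult[OF dvW[OF that] dF_deriv[OF that]]]
    then show "2 * gauss_int I (\<lambda>c. of_real (c p) * ((v p c * W c) * pprod P ms c)) =
        gauss_int I (\<lambda>c. dvW p c * pprod P ms c + (v p c * W c) * dF ms p c)"
      "polyf I (\<lambda>c. dvW p c * pprod P ms c + (v p c * W c) * dF ms p c)" by blast+
  qed
  have "2 * gauss_int I (\<lambda>c. W c * pprod P (Suc k # ms) c) =
      2 * gauss_int I (\<lambda>c. \<Sum>p\<in>I. of_real (c p) * ((v p c * W c) * pprod P ms c))"
    by (simp add: radial[symmetric] sum_distrib_left sum_distrib_right mult_ac)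
  also have "\<dots> = (\<Sum>p\<in>I. 2 * gauss_int I (\<lambda>c. of_real (c p) * ((v p c * W c) * pprod P ms c)))"
    by (subst gauss_int_sum[OF I])
      (auto intro!: polyf_intros polyf_coord I v W pp simp: sum_distrib_left)
  also have "\<dots> = gauss_int I (\<lambda>c. \<Sum>p\<in>I. dvW p c * pprod P ms c + (v p c * W c) * dF ms p c)"
    by (subst gauss_int_sum[OF I ibp(2)]) (simp_all add: ibp(1))
  also have "(\<lambda>c. \<Sum>p\<in>I. dvW p c * pprod P ms c + (v p c * W c) * dF ms p c) =
      (\<lambda>c. (\<Sum>p\<in>I. dvW p c) * pprod P ms c + W c * (\<Sum>p\<in>I. v p c * dF ms p c))"
    by (simp add: sum.distrib sum_distrib_left sum_distrib_right mult_ac)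
  also have "\<dots> = (\<lambda>c. (\<Sum>a<k. W c * pprod P (a # (k - 1 - a) # ms) c) +
      (\<Sum>x\<leftarrow>contract k ms. of_nat (fst x) * (W c * pprod P (snd x) c)))"
    unfolding diverg dF_along
    by (simp add: sum_distrib_left sum_distrib_right sum_list_const_mult[symmetric]
        case_prod_unfold mult_ac)
  also have "gauss_int I \<dots> = gauss_int I (\<lambda>c. \<Sum>a<k. W c * pprod P (a # (k - 1 - a) # ms) c) +
      gauss_int I (\<lambda>c. \<Sum>x\<leftarrow>contract k ms. of_nat (fst x) * (W c * pprod P (snd x) c))"
    by (intro gauss_int_add polyf_gauss_integrable I polyf_intros W pp)
  also have "gauss_int I (\<lambda>c. \<Sum>x\<leftarrow>xs. of_nat (fst x) * (W c * pprod P (snd x) c)) =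
      (\<Sum>(a, l)\<leftarrow>xs. of_nat a * gauss_int I (\<lambda>c. W c * pprod P l c))" for xs :: "(nat \<times> nat list) list"
  proof (induction xs)
    case Nil
    then show ?case by (simp add: gauss_int_def)
  next
    case (Cons x xs)
    have "gauss_int I (\<lambda>c. \<Sum>x\<leftarrow>x # xs. of_nat (fst x) * (W c * pprod P (snd x) c)) =
        gauss_int I (\<lambda>c. of_nat (fst x) * (W c * pprod P (snd x) c)) +
        gauss_int I (\<lambda>c. \<Sum>x\<leftarrow>xs. of_nat (fst x) * (W c * pprod P (snd x) c))"
      unfolding list.map sum_list.Cons
      by (intro gauss_int_add polyf_gauss_integrable I polyf_intros W pp)
    with Cons show ?case by (simp add: gauss_int_scale case_prod_unfold)
  qed
  also have "gauss_int I (\<lambda>c. \<Sum>a<k. W c * pprod P (a # (k - 1 - a) # ms) c) =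
      (\<Sum>a<k. gauss_int I (\<lambda>c. W c * pprod P (a # (k - 1 - a) # ms) c))"
    by (intro gauss_int_sum I polyf_intros W pp)
  finally show ?thesis .
qed

subsection \<open>Hermitian matrices\<close>

text \<open>The entry at \<open>(i, j)\<close> of the basis matrix whose coefficient \<^const>\<open>herm_of\<close> reads at position \<open>(u, v)\<close>.\<close>

definition herm_basis :: "nat \<times> nat \<Rightarrow> nat \<Rightarrow> nat \<Rightarrow> complex" where
  "herm_basis = (\<lambda>(u, v) i j.
     if u = v then of_bool (i = u \<and> j = u)
     else if u < v then (of_bool (i = u \<and> j = v) + of_bool (i = v \<and> j = u)) / of_real (sqrt 2)
     else \<i> * (of_bool (i = v \<and> j = u) - of_bool (i = u \<and> j = v)) / of_real (sqrt 2))"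

lemma sum_herm_basis:
  assumes "i < n" "j < n"
  shows "(\<Sum>p\<in>{..<n} \<times> {..<n}. f p * herm_basis p i j) =
     (if i = j then f (i, i) else if i < j then (f (i, j) + \<i> * f (j, i)) / of_real (sqrt 2)
      else (f (j, i) - \<i> * f (i, j)) / of_real (sqrt 2))"
proof -
  have *: "\<not> (i = a \<and> j = b) \<Longrightarrow> \<not> (i = b \<and> j = a) \<Longrightarrow> herm_basis (a, b) i j = 0" for a b
    by (simp only: herm_basis_def split) auto
  have "p \<noteq> (i, j) \<Longrightarrow> p \<noteq> (j, i) \<Longrightarrow> herm_basis p i j = 0" for p
    using * by (metis surj_pair)
  then have "(\<Sum>p\<in>{..<n} \<times> {..<n}. f p * herm_basis p i j) =
      (\<Sum>p\<in>{(i, j), (j, i)}. f p * herm_basis p i j)"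
    using assms by (intro sum.mono_neutral_right) auto
  also have "\<dots> = (if i = j then f (i, i) else if i < j then (f (i, j) + \<i> * f (j, i)) / of_real (sqrt 2)
      else (f (j, i) - \<i> * f (i, j)) / of_real (sqrt 2))"
    by (simp add: herm_basis_def) (simp add: field_simps)
  finally show ?thesis .
qed

text \<open>Completeness of the orthonormal basis.  Contracting a basis index therefore cuts a trace at two places
  and glues the ends crosswise, which is why the divergence of \<open>x\<^sup>k\<close> is a sum of products of two traces.\<close>

lemma herm_basis_complete:
  assumes "i < n" "j < n"
  shows "(\<Sum>p\<in>{..<n} \<times> {..<n}. herm_basis p i j * herm_basis p u v) = of_bool (u = j \<and> v = i)"
proof -
  have s: "complex_of_real (sqrt 2) * complex_of_real (sqrt 2) = 2"
    by (metis of_real_mult of_real_numeral real_sqrt_mult_self abs_numeral)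
  have 1: "((a + b) / of_real (sqrt 2) + \<i> * (\<i> * (a - b) / of_real (sqrt 2))) / of_real (sqrt 2) = b"
    and 2: "((a + b) / of_real (sqrt 2) - \<i> * (\<i> * (a - b) / of_real (sqrt 2))) / of_real (sqrt 2) = a"
    for a b :: complex
    by (simp_all add: add_divide_distrib[symmetric] diff_divide_distrib[symmetric] s mult.assoc[symmetric])
  consider "i = j" | "i < j" | "j < i" by linarith
  then have "(if i = j then herm_basis (i, i) u v
      else if i < j then (herm_basis (i, j) u v + \<i> * herm_basis (j, i) u v) / of_real (sqrt 2)
      else (herm_basis (j, i) u v - \<i> * herm_basis (i, j) u v) / of_real (sqrt 2)) =
    of_bool (u = j \<and> v = i)"
  proof cases
    case 2
    then show ?thesis using 1[of "of_bool (u = i \<and> v = j)" "of_bool (u = j \<and> v = i)"]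
      by (simp add: herm_basis_def)
  next
    case 3
    then show ?thesis using 2[of "of_bool (u = j \<and> v = i)" "of_bool (u = i \<and> v = j)"]
      by (simp add: herm_basis_def)
  qed (auto simp: herm_basis_def)
  then show ?thesis
    unfolding mult.commute[of "herm_basis _ i j"] sum_herm_basis[OF assms, of "\<lambda>p. herm_basis p u v"] .
qed

lemma herm_basis_contract:
  "(\<Sum>p\<in>{..<n} \<times> {..<n}. \<Sum>i<n. \<Sum>j<n. \<Sum>u<n. \<Sum>v<n. herm_basis p i j * herm_basis p u v * h i j u v) =
     (\<Sum>i<n. \<Sum>j<n. h i j j i)"
proof -
  have "(\<Sum>p\<in>{..<n} \<times> {..<n}. \<Sum>i<n. \<Sum>j<n. \<Sum>u<n. \<Sum>v<n. herm_basis p i j * herm_basis p u v * h i j u v) =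
      (\<Sum>i<n. \<Sum>j<n. \<Sum>u<n. \<Sum>v<n. \<Sum>p\<in>{..<n} \<times> {..<n}. herm_basis p i j * herm_basis p u v * h i j u v)"
    by (rule sum_rotate5)
  also have "\<dots> = (\<Sum>i<n. \<Sum>j<n. \<Sum>u<n. \<Sum>v<n. of_bool (u = j \<and> v = i) * h i j u v)"
    by (simp add: sum_distrib_right[symmetric] herm_basis_complete)
  also have "\<dots> = (\<Sum>i<n. \<Sum>j<n. \<Sum>u<n. if u = j then h i j u i else 0)"
    by (intro sum.cong refl) (auto simp: of_bool_def if_distrib[where f = "\<lambda>x. x * _"] cong: if_cong)
  also have "\<dots> = (\<Sum>i<n. \<Sum>j<n. h i j j i)" by simp
  finally show ?thesis .
qed

definition herm_entry :: "nat \<Rightarrow> (nat \<times> nat \<Rightarrow> real) \<Rightarrow> nat \<Rightarrow> nat \<Rightarrow> complex" where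
  "herm_entry n c i j = (\<Sum>p\<in>{..<n} \<times> {..<n}. of_real (c p) * herm_basis p i j)"

lemma herm_of_entry: "i < n \<Longrightarrow> j < n \<Longrightarrow> herm_of n c $$ (i, j) = herm_entry n c i j"
  by (auto simp: herm_of_def herm_entry_def sum_herm_basis complex_eq_iff)

text \<open>Powers of an array of entries.  Plain functions of two indices are easier to differentiate than matrices
  with carriers.\<close>

fun fpow :: "nat \<Rightarrow> (nat \<Rightarrow> nat \<Rightarrow> complex) \<Rightarrow> nat \<Rightarrow> nat \<Rightarrow> nat \<Rightarrow> complex" where
  "fpow n A 0 i j = of_bool (i = j)"
| "fpow n A (Suc k) i j = (\<Sum>l<n. A i l * fpow n A k l j)"

definition ftrace :: "nat \<Rightarrow> (nat \<Rightarrow> nat \<Rightarrow> complex) \<Rightarrow> nat \<Rightarrow> complex" where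
  "ftrace n A k = (\<Sum>i<n. fpow n A k i i)"

lemma fpow_add:
  "i < n \<Longrightarrow> (\<Sum>l<n. fpow n A a i l * fpow n A b l j) = fpow n A (a + b) i j"
proof (induction a arbitrary: i)
  case 0
  have "(\<Sum>l<n. fpow n A 0 i l * fpow n A b l j) = (\<Sum>l<n. if i = l then fpow n A b l j else 0)"
    by (intro sum.cong) auto
  with 0 show ?case by simp
next
  case (Suc a)
  have "(\<Sum>l<n. fpow n A (Suc a) i l * fpow n A b l j) =
      (\<Sum>r<n. A i r * (\<Sum>l<n. fpow n A a r l * fpow n A b l j))"
    by (simp add: sum_distrib_right sum_distrib_left mult.assoc) (rule sum.swap)
  with Suc show ?case by simp
qed

abbreviation (input) herm_fpow where "herm_fpow n k i j \<equiv> (\<lambda>c. fpow n (herm_entry n c) k i j)"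
abbreviation (input) herm_trace where "herm_trace n k \<equiv> (\<lambda>c. ftrace n (herm_entry n c) k)"

lemma polyf_herm_entry: "polyf ({..<n} \<times> {..<n}) (\<lambda>c. herm_entry n c i j)"
  unfolding herm_entry_def by (intro polyf_intros polyf_coord) auto

lemma polyf_herm_fpow: "polyf ({..<n} \<times> {..<n}) (herm_fpow n k i j)"
  by (induction k arbitrary: i) (auto intro!: polyf_intros polyf_herm_entry)

lemma polyf_herm_trace: "polyf ({..<n} \<times> {..<n}) (herm_trace n k)"
  unfolding ftrace_def by (intro polyf_intros polyf_herm_fpow)

lemma has_pderiv_herm_entry:
  assumes "p \<in> {..<n} \<times> {..<n}"
  shows "has_pderiv p (\<lambda>c. herm_entry n c i j) (\<lambda>c. herm_basis p i j)"
proof -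
  have "has_pderiv p (\<lambda>c. \<Sum>q\<in>{..<n} \<times> {..<n}. herm_basis q i j * of_real (c q))
      (\<lambda>c. \<Sum>q\<in>{..<n} \<times> {..<n}. herm_basis q i j * (if q = p then 1 else 0))"
    by (intro has_pderiv_sum has_pderiv_scale has_pderiv_coord)
  then show ?thesis using assms unfolding herm_entry_def
    by (simp add: mult.commute if_distrib[where f = "\<lambda>x. _ * x"] sum.delta cong: if_cong)
qed

text \<open>The Leibniz rule for the product of \<open>k\<close> equal factors, where the factor at position \<open>a\<close> is replaced by its
  derivative, the constant basis matrix.\<close>

lemma has_pderiv_herm_fpow:
  assumes p: "p \<in> {..<n} \<times> {..<n}"
  shows "i < n \<Longrightarrow> has_pderiv p (herm_fpow n k i j)
     (\<lambda>c. \<Sum>a<k. \<Sum>u<n. \<Sum>v<n. herm_fpow n a i u c * herm_basis p u v * herm_fpow n (k - 1 - a) v j c)"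
proof (induction k arbitrary: i)
  case 0
  then show ?case by (simp add: has_pderiv_const)
next
  case (Suc k)
  let ?X = "herm_entry n" and ?B = "herm_basis p"
  let ?D = "\<lambda>c l. \<Sum>a<k. \<Sum>u<n. \<Sum>v<n. herm_fpow n a l u c * ?B u v * herm_fpow n (k - 1 - a) v j c"
  have "has_pderiv p (\<lambda>c. \<Sum>l<n. ?X c i l * herm_fpow n k l j c)
      (\<lambda>c. \<Sum>l<n. ?B i l * herm_fpow n k l j c + ?X c i l * ?D c l)"
    by (intro has_pderiv_sum has_pderiv_mult has_pderiv_herm_entry p Suc.IH) auto
  moreover have "(\<Sum>l<n. ?B i l * herm_fpow n k l j c + ?X c i l * ?D c l) =
      (\<Sum>a<Suc k. \<Sum>u<n. \<Sum>v<n. herm_fpow n a i u c * ?B u v * herm_fpow n (Suc k - 1 - a) v j c)" for c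
  proof -
    have "(\<Sum>u<n. \<Sum>v<n. herm_fpow n 0 i u c * ?B u v * herm_fpow n k v j c) =
        (\<Sum>u<n. if i = u then (\<Sum>v<n. ?B u v * herm_fpow n k v j c) else 0)"
      by (intro sum.cong) auto
    also have "\<dots> = (\<Sum>l<n. ?B i l * herm_fpow n k l j c)"
      using Suc.prems by simp
    finally have 1: "(\<Sum>u<n. \<Sum>v<n. herm_fpow n 0 i u c * ?B u v * herm_fpow n k v j c) = \<dots>" .
    have "(\<Sum>l<n. ?X c i l * ?D c l) =
        (\<Sum>a<k. \<Sum>u<n. \<Sum>v<n. \<Sum>l<n. ?X c i l * (herm_fpow n a l u c * ?B u v * herm_fpow n (k - 1 - a) v j c))"
      unfolding sum_distrib_left by (rule sum_rotate4)
    also have "\<dots> = (\<Sum>a<k. \<Sum>u<n. \<Sum>v<n.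
        herm_fpow n (Suc a) i u c * ?B u v * herm_fpow n (k - 1 - a) v j c)"
      by (simp add: sum_distrib_right mult.assoc)
    finally show ?thesis
      by (simp only: sum.lessThan_Suc_shift sum.distrib 1[symmetric] diff_Suc_1 diff_zero)
        (simp add: 1)
  qed
  ultimately show ?case by simp
qed

lemma has_pderiv_herm_trace:
  assumes p: "p \<in> {..<n} \<times> {..<n}"
  shows "has_pderiv p (herm_trace n m)
     (\<lambda>c. of_nat m * (\<Sum>u<n. \<Sum>v<n. herm_basis p u v * herm_fpow n (m - 1) v u c))"
proof (rule has_pderiv_cong)
  show "has_pderiv p (herm_trace n m) (\<lambda>c. \<Sum>i<n. \<Sum>a<m. \<Sum>u<n. \<Sum>v<n.
      herm_fpow n a i u c * herm_basis p u v * herm_fpow n (m - 1 - a) v i c)"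
    unfolding ftrace_def by (intro has_pderiv_sum has_pderiv_herm_fpow p) auto
  fix c
  have "(\<Sum>i<n. \<Sum>a<m. \<Sum>u<n. \<Sum>v<n.
        herm_fpow n a i u c * herm_basis p u v * herm_fpow n (m - 1 - a) v i c) =
      (\<Sum>a<m. \<Sum>u<n. \<Sum>v<n. \<Sum>i<n.
        herm_fpow n a i u c * herm_basis p u v * herm_fpow n (m - 1 - a) v i c)"
    by (rule sum_rotate4)
  also have "\<dots> = (\<Sum>a<m. \<Sum>u<n. \<Sum>v<n. herm_basis p u v *
      (\<Sum>i<n. herm_fpow n (m - 1 - a) v i c * herm_fpow n a i u c))"
    by (simp add: sum_distrib_left mult_ac)
  also have "\<dots> = (\<Sum>a<m. \<Sum>u<n. \<Sum>v<n. herm_basis p u v * herm_fpow n (m - 1) v u c)"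
    by (intro sum.cong refl) (simp add: fpow_add)
  finally show "(\<Sum>i<n. \<Sum>a<m. \<Sum>u<n. \<Sum>v<n.
        herm_fpow n a i u c * herm_basis p u v * herm_fpow n (m - 1 - a) v i c) =
      of_nat m * (\<Sum>u<n. \<Sum>v<n. herm_basis p u v * herm_fpow n (m - 1) v u c)" by simp
qed

lemma loop_functional_herm:
  "loop_functional n (\<lambda>ms. gauss_int ({..<n} \<times> {..<n}) (pprod (herm_trace n) ms))"
  unfolding loop_functional_def
proof (intro conjI allI)
  let ?I = "{..<n} \<times> {..<n}"
  fix ms
  have "pprod (herm_trace n) (0 # ms) = (\<lambda>c. of_nat n * pprod (herm_trace n) ms c)"
    by (simp add: fun_eq_iff ftrace_def)
  then show "gauss_int ?I (pprod (herm_trace n) (0 # ms)) =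
      of_nat n * gauss_int ?I (pprod (herm_trace n) ms)" by (simp add: gauss_int_scale)
  fix k
  let ?v = "\<lambda>p c. \<Sum>i<n. \<Sum>j<n. herm_basis p i j * herm_fpow n k j i c"
  let ?dP = "\<lambda>m p c. of_nat m * (\<Sum>u<n. \<Sum>v<n. herm_basis p u v * herm_fpow n (m - 1) v u c)"
  let ?dv = "\<lambda>p c. \<Sum>i<n. \<Sum>j<n. herm_basis p i j * (\<Sum>a<k. \<Sum>u<n. \<Sum>v<n.
      herm_fpow n a j u c * herm_basis p u v * herm_fpow n (k - 1 - a) v i c)"
  have "2 * gauss_int ?I (\<lambda>c. 1 * pprod (herm_trace n) (Suc k # ms) c) =
    (\<Sum>a<k. gauss_int ?I (\<lambda>c. 1 * pprod (herm_trace n) (a # (k - 1 - a) # ms) c)) +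
    (\<Sum>(a, l)\<leftarrow>contract k ms. of_nat a * gauss_int ?I (\<lambda>c. 1 * pprod (herm_trace n) l c))"
  proof (rule gauss_int_loop[where v = ?v and dP = ?dP and dvW = ?dv])
    fix p assume p: "p \<in> ?I"
    show "polyf ?I (?v p)" by (intro polyf_intros polyf_herm_fpow)
    show "has_pderiv p (\<lambda>c. ?v p c * 1) (?dv p)"
      unfolding mult_1_right
      by (intro has_pderiv_sum has_pderiv_scale has_pderiv_herm_fpow p) auto
    show "has_pderiv p (herm_trace n m) (?dP m p)" for m
      by (rule has_pderiv_herm_trace[OF p])
  next
    fix m c
    have "(\<Sum>p\<in>?I. ?v p c * ?dP m p c) = of_nat m * (\<Sum>p\<in>?I. \<Sum>i<n. \<Sum>j<n. \<Sum>u<n. \<Sum>v<n.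
        herm_basis p i j * herm_basis p u v * (herm_fpow n k j i c * herm_fpow n (m - 1) v u c))"
      unfolding mult.left_commute[of _ "of_nat m"] sum_distrib_left[symmetric, of "of_nat m"] sum2_product
      by (simp add: mult_ac)
    also have "\<dots> = of_nat m * (\<Sum>i<n. \<Sum>j<n. herm_fpow n k j i c * herm_fpow n (m - 1) i j c)"
      unfolding herm_basis_contract ..
    also have "\<dots> = of_nat m * (\<Sum>j<n. \<Sum>i<n. herm_fpow n k j i c * herm_fpow n (m - 1) i j c)"
      by (subst sum.swap) simp
    also have "\<dots> = of_nat m * herm_trace n (k + m - 1) c"
      by (cases m) (auto simp: fpow_add ftrace_def)
    finally show "(\<Sum>p\<in>?I. ?v p c * ?dP m p c) = of_nat m * herm_trace n (k + m - 1) c" .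
  next
    fix c
    have "(\<Sum>p\<in>?I. of_real (c p) * ?v p c) =
        (\<Sum>p\<in>?I. \<Sum>i<n. \<Sum>j<n. of_real (c p) * herm_basis p i j * herm_fpow n k j i c)"
      by (simp add: sum_distrib_left mult.assoc)
    also have "\<dots> = (\<Sum>i<n. \<Sum>j<n. \<Sum>p\<in>?I. of_real (c p) * herm_basis p i j * herm_fpow n k j i c)"
      by (rule sum_rotate3)
    also have "\<dots> = (\<Sum>i<n. \<Sum>j<n. herm_entry n c i j * herm_fpow n k j i c)"
      by (simp add: herm_entry_def sum_distrib_right)
    finally show "(\<Sum>p\<in>?I. of_real (c p) * ?v p c) = herm_trace n (Suc k) c"
      by (simp add: ftrace_def)
    have "(\<Sum>p\<in>?I. ?dv p c) = (\<Sum>p\<in>?I. \<Sum>i<n. \<Sum>j<n. \<Sum>u<n. \<Sum>v<n. herm_basis p i j * herm_basis p u v *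
        (\<Sum>a<k. herm_fpow n a j u c * herm_fpow n (k - 1 - a) v i c))"
    proof (intro sum.cong refl)
      fix p i j
      have "herm_basis p i j * (\<Sum>a<k. \<Sum>u<n. \<Sum>v<n.
          herm_fpow n a j u c * herm_basis p u v * herm_fpow n (k - 1 - a) v i c) =
        (\<Sum>a<k. \<Sum>u<n. \<Sum>v<n. herm_basis p i j * herm_basis p u v *
          (herm_fpow n a j u c * herm_fpow n (k - 1 - a) v i c))"
        by (simp add: sum_distrib_left mult_ac)
      also have "\<dots> = (\<Sum>u<n. \<Sum>v<n. \<Sum>a<k. herm_basis p i j * herm_basis p u v *
          (herm_fpow n a j u c * herm_fpow n (k - 1 - a) v i c))"
        by (rule sum_rotate3)
      finally show "herm_basis p i j * (\<Sum>a<k. \<Sum>u<n. \<Sum>v<n.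
          herm_fpow n a j u c * herm_basis p u v * herm_fpow n (k - 1 - a) v i c) =
        (\<Sum>u<n. \<Sum>v<n. herm_basis p i j * herm_basis p u v *
          (\<Sum>a<k. herm_fpow n a j u c * herm_fpow n (k - 1 - a) v i c))"
        by (simp add: sum_distrib_left)
    qed
    also have "\<dots> = (\<Sum>i<n. \<Sum>j<n. \<Sum>a<k. herm_fpow n a j j c * herm_fpow n (k - 1 - a) i i c)"
      unfolding herm_basis_contract ..
    also have "\<dots> = (\<Sum>a<k. \<Sum>i<n. \<Sum>j<n. herm_fpow n a j j c * herm_fpow n (k - 1 - a) i i c)"
      by (rule sum_rotate3[symmetric])
    also have "\<dots> = 1 * (\<Sum>a<k. herm_trace n a c * herm_trace n (k - 1 - a) c)"
      by (simp add: ftrace_def sum_distrib_left sum_distrib_right)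
    finally show "(\<Sum>p\<in>?I. ?dv p c) = 1 * (\<Sum>a<k. herm_trace n a c * herm_trace n (k - 1 - a) c)" .
  qed (auto intro: polyf_intros polyf_herm_trace)
  then show "2 * gauss_int ?I (pprod (herm_trace n) (Suc k # ms)) =
    (\<Sum>a<k. gauss_int ?I (pprod (herm_trace n) (a # (k - 1 - a) # ms))) +
    (\<Sum>(a, l)\<leftarrow>contract k ms. of_nat a * gauss_int ?I (pprod (herm_trace n) l))"
    by (simp only: mult_1_left)
qed

subsection \<open>The Vandermonde weight\<close>

definition less_pairs :: "nat \<Rightarrow> (nat \<times> nat) set" where
  "less_pairs n = {(i, j). i < j \<and> j < n}"

lemma finite_less_pairs [simp]: "finite (less_pairs n)"
  by (rule finite_subset[of _ "{..<n} \<times> {..<n}"]) (auto simp: less_pairs_def)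

definition vandermonde :: "nat \<Rightarrow> (nat \<Rightarrow> 'a) \<Rightarrow> 'a :: comm_ring_1" where
  "vandermonde n x = (\<Prod>(i, j)\<in>less_pairs n. x j - x i)"

lemma sum_less_pairs:
  fixes S :: "nat \<Rightarrow> nat \<Rightarrow> 'a :: comm_ring_1"
  assumes "\<And>i j. S i j = S j i"
  shows "(\<Sum>i<n. \<Sum>j<n. S i j) = (\<Sum>i<n. S i i) + 2 * (\<Sum>(i, j)\<in>less_pairs n. S i j)"
proof -
  have "(\<Sum>i<n. \<Sum>j<n. S i j) = (\<Sum>(i, j)\<in>{..<n} \<times> {..<n}. S i j)" by (rule sum.cartesian_product)
  also have "{..<n} \<times> {..<n} = (\<lambda>i. (i, i)) ` {..<n} \<union> (less_pairs n \<union> prod.swap ` less_pairs n)"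
    by (force simp: less_pairs_def image_iff)
  also have "(\<Sum>(i, j)\<in>\<dots>. S i j) = (\<Sum>(i, j)\<in>(\<lambda>i. (i, i)) ` {..<n}. S i j) +
      ((\<Sum>(i, j)\<in>less_pairs n. S i j) + (\<Sum>(i, j)\<in>prod.swap ` less_pairs n. S i j))"
    by (subst sum.union_disjoint, simp, simp, force simp: less_pairs_def,
        subst sum.union_disjoint, simp, simp, force simp: less_pairs_def) simp
  also have "(\<Sum>(i, j)\<in>(\<lambda>i. (i, i)) ` {..<n}. S i j) = (\<Sum>i<n. S i i)"
    by (subst sum.reindex) (auto simp: inj_on_def)
  also have "(\<Sum>(i, j)\<in>prod.swap ` less_pairs n. S i j) = (\<Sum>(i, j)\<in>less_pairs n. S i j)"
    by (subst sum.reindex) (auto simp: assms case_prod_unfold intro!: sum.cong)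
  finally show ?thesis by simp
qed

lemma has_pderiv_prod:
  assumes "finite A" "\<And>x. x \<in> A \<Longrightarrow> has_pderiv p (f x) (f' x)"
  shows "has_pderiv p (\<lambda>c. \<Prod>x\<in>A. f x c) (\<lambda>c. \<Sum>x\<in>A. f' x c * (\<Prod>y\<in>A - {x}. f y c))"
  using assms
proof (induction A rule: finite_induct)
  case empty
  then show ?case by (simp add: has_pderiv_const)
next
  case (insert a A)
  have "has_pderiv p (\<lambda>c. f a c * (\<Prod>x\<in>A. f x c))
     (\<lambda>c. f' a c * (\<Prod>x\<in>A. f x c) + f a c * (\<Sum>x\<in>A. f' x c * (\<Prod>y\<in>A - {x}. f y c)))"
    using insert by (intro has_pderiv_mult) auto
  moreover have "f a c * (\<Sum>x\<in>A. f' x c * (\<Prod>y\<in>A - {x}. f y c)) =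
      (\<Sum>x\<in>A. f' x c * (\<Prod>y\<in>insert a A - {x}. f y c))" for c
    unfolding sum_distrib_left
  proof (intro sum.cong refl)
    fix x assume "x \<in> A"
    then have "insert a A - {x} = insert a (A - {x})" using insert by auto
    then show "f a c * (f' x c * (\<Prod>y\<in>A - {x}. f y c)) = f' x c * (\<Prod>y\<in>insert a A - {x}. f y c)"
      using insert by simp
  qed
  moreover have "insert a A - {a} = A" using insert by auto
  ultimately show ?case using insert by simp
qed

definition power_sum :: "nat \<Rightarrow> nat \<Rightarrow> (nat \<Rightarrow> 'a) \<Rightarrow> 'a :: comm_ring_1" where
  "power_sum n m x = (\<Sum>i<n. x i ^ m)"

abbreviation (input) cpx :: "(nat \<Rightarrow> real) \<Rightarrow> nat \<Rightarrow> complex" where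
  "cpx c \<equiv> (\<lambda>i. of_real (c i))"

lemma polyf_vandermonde: "polyf {..<n} (\<lambda>c. vandermonde n (cpx c))"
  unfolding vandermonde_def case_prod_unfold
  by (intro polyf_intros polyf_coord) (auto simp: less_pairs_def)

lemma polyf_power_sum: "polyf {..<n} (\<lambda>c. power_sum n m (cpx c))"
  unfolding power_sum_def by (intro polyf_intros polyf_coord) auto

text \<open>Along the field \<open>\<lambda>\<^sub>i\<^sup>k\<close> the logarithmic derivative of the Vandermonde product is the sum over \<open>i < j\<close> of the
  difference quotients of \<open>\<lambda>\<^sup>k\<close> at \<open>\<lambda>\<^sub>i\<close> and \<open>\<lambda>\<^sub>j\<close>.  These are polynomials.  Taken twice, for the square, and
  together with the diagonal terms \<open>k \<lambda>\<^sub>i\<^sup>k\<^sup>-\<^sup>1\<close> from the divergence of the field, they add up to the same products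
  of two power sums as for matrices.\<close>

lemma loop_functional_vandermonde:
  "loop_functional n (\<lambda>ms. gauss_int {..<n}
     (\<lambda>c. (vandermonde n (cpx c))\<^sup>2 * pprod (\<lambda>m c. power_sum n m (cpx c)) ms c))"
  unfolding loop_functional_def
proof (intro conjI allI)
  let ?I = "{..<n}" and ?V = "\<lambda>c. vandermonde n (cpx c)" and ?P = "\<lambda>m c. power_sum n m (cpx c)"
  fix ms
  show "gauss_int ?I (\<lambda>c. (?V c)\<^sup>2 * pprod ?P (0 # ms) c) =
      of_nat n * gauss_int ?I (\<lambda>c. (?V c)\<^sup>2 * pprod ?P ms c)"
    by (simp add: gauss_int_scale[symmetric] power_sum_def mult_ac)
  fix k
  let ?dV = "\<lambda>q c. \<Sum>x\<in>less_pairs n. ((if snd x = q then 1 else 0) - (if fst x = q then 1 else 0)) *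
      (\<Prod>y\<in>less_pairs n - {x}. cpx c (snd y) - cpx c (fst y))"
  let ?S = "\<lambda>c i j. \<Sum>a<k. cpx c i ^ a * cpx c j ^ (k - 1 - a)"
  let ?v = "\<lambda>q c. cpx c q ^ k"
  let ?dvW = "\<lambda>q c. (of_nat k * cpx c q ^ (k - 1) * 1) * (?V c)\<^sup>2 +
      ?v q c * (of_nat 2 * ?V c ^ (2 - 1) * ?dV q c)"
  show "2 * gauss_int ?I (\<lambda>c. (?V c)\<^sup>2 * pprod ?P (Suc k # ms) c) =
    (\<Sum>a<k. gauss_int ?I (\<lambda>c. (?V c)\<^sup>2 * pprod ?P (a # (k - 1 - a) # ms) c)) +
    (\<Sum>(a, l)\<leftarrow>contract k ms. of_nat a * gauss_int ?I (\<lambda>c. (?V c)\<^sup>2 * pprod ?P l c))"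
  proof (rule gauss_int_loop[where v = ?v and dvW = ?dvW
        and dP = "\<lambda>m q c. of_nat m * cpx c q ^ (m - 1)"])
    fix q assume q: "q \<in> ?I"
    show "polyf ?I (?v q)" using q by (intro polyf_intros polyf_coord) auto
    have dV: "has_pderiv q ?V (?dV q)"
      unfolding vandermonde_def case_prod_unfold
      using has_pderiv_add[OF has_pderiv_coord has_pderiv_scale[OF has_pderiv_coord, of q "-1"]]
      by (intro has_pderiv_prod) auto
    have dq: "has_pderiv q (\<lambda>c. cpx c q) (\<lambda>c. 1)"
      using has_pderiv_coord[of q q] by simp
    show "has_pderiv q (\<lambda>c. ?v q c * (?V c)\<^sup>2) (?dvW q)"
      by (intro has_pderiv_mult has_pderiv_power dV dq)
    fix m
    have "has_pderiv q (?P m) (\<lambda>c. \<Sum>i<n. of_nat m * cpx c i ^ (m - 1) * (if i = q then 1 else 0))"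
      unfolding power_sum_def by (intro has_pderiv_sum has_pderiv_power has_pderiv_coord)
    then show "has_pderiv q (?P m) (\<lambda>c. of_nat m * cpx c q ^ (m - 1))"
      using q by (simp add: if_distrib[where f = "\<lambda>x. _ * x"] sum.delta cong: if_cong)
  next
    fix m c
    show "(\<Sum>q\<in>?I. ?v q c * (of_nat m * cpx c q ^ (m - 1))) = of_nat m * ?P (k + m - 1) c"
      by (cases m) (auto simp: power_sum_def sum_distrib_left power_add mult_ac)
  next
    fix c
    show "(\<Sum>q\<in>?I. of_real (c q) * ?v q c) = ?P (Suc k) c" by (simp add: power_sum_def)
    have Sswap: "?S c i j = ?S c j i" for i j
      by (subst sum.nat_diff_reindex[symmetric]) (auto intro!: sum.cong simp: mult.commute)
    have Sdiff: "cpx c j ^ k - cpx c i ^ k = (cpx c j - cpx c i) * ?S c j i" for i j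
      by (subst power_diff_sumr2) (auto intro!: sum.cong simp: mult.commute)
    have "(\<Sum>q\<in>?I. ?v q c * ?dV q c) =
        (\<Sum>x\<in>less_pairs n. (\<Sum>q<n. (if snd x = q then ?v q c else 0) - (if fst x = q then ?v q c else 0)) *
          (\<Prod>y\<in>less_pairs n - {x}. cpx c (snd y) - cpx c (fst y)))"
      unfolding sum_distrib_left sum_distrib_right
      by (subst sum.swap) (auto intro!: sum.cong)
    also have "\<dots> = (\<Sum>x\<in>less_pairs n. ?V c * ?S c (fst x) (snd x))"
    proof (intro sum.cong refl)
      fix x assume x: "x \<in> less_pairs n"
      then have "(\<Sum>q<n. (if snd x = q then ?v q c else 0) - (if fst x = q then ?v q c else 0)) =
          cpx c (snd x) ^ k - cpx c (fst x) ^ k"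
        by (auto simp: less_pairs_def sum_subtractf)
      also have "\<dots> = (cpx c (snd x) - cpx c (fst x)) * ?S c (fst x) (snd x)"
        unfolding Sdiff Sswap[of "snd x" "fst x"] ..
      finally show "(\<Sum>q<n. (if snd x = q then ?v q c else 0) - (if fst x = q then ?v q c else 0)) *
          (\<Prod>y\<in>less_pairs n - {x}. cpx c (snd y) - cpx c (fst y)) = ?V c * ?S c (fst x) (snd x)"
        using prod.remove[OF _ x, of "\<lambda>y. cpx c (snd y) - cpx c (fst y)"]
        by (simp add: vandermonde_def case_prod_unfold mult_ac)
    qed
    finally have dVsum: "(\<Sum>q\<in>?I. ?v q c * ?dV q c) = ?V c * (\<Sum>(i, j)\<in>less_pairs n. ?S c i j)"
      by (simp add: sum_distrib_left case_prod_unfold)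
    have diag: "?S c i i = of_nat k * cpx c i ^ (k - 1)" for i
      by (simp add: power_add[symmetric])
    have "(\<Sum>q\<in>?I. ?dvW q c) = (?V c)\<^sup>2 * (\<Sum>q<n. of_nat k * cpx c q ^ (k - 1)) +
        2 * ?V c * (\<Sum>q\<in>?I. ?v q c * ?dV q c)"
      by (simp only: sum.distrib sum_distrib_left) (simp add: mult_ac)
    also have "\<dots> = (?V c)\<^sup>2 * ((\<Sum>i<n. ?S c i i) + 2 * (\<Sum>(i, j)\<in>less_pairs n. ?S c i j))"
      unfolding dVsum diag by (simp add: power2_eq_square algebra_simps)
    also have "\<dots> = (?V c)\<^sup>2 * (\<Sum>i<n. \<Sum>j<n. ?S c i j)"
      by (subst sum_less_pairs[of "?S c", OF Sswap]) simp
    also have "(\<Sum>i<n. \<Sum>j<n. ?S c i j) = (\<Sum>a<k. \<Sum>i<n. \<Sum>j<n. cpx c i ^ a * cpx c j ^ (k - 1 - a))"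
      by (rule sum_rotate3[symmetric])
    also have "\<dots> = (\<Sum>a<k. ?P a c * ?P (k - 1 - a) c)"
      by (simp add: power_sum_def sum_distrib_left sum_distrib_right)
        (subst sum.swap, simp)
    finally show "(\<Sum>q\<in>?I. ?dvW q c) = (?V c)\<^sup>2 * (\<Sum>a<k. ?P a c * ?P (k - 1 - a) c)" .
  qed (auto intro!: polyf_intros polyf_vandermonde polyf_power_sum)
qed

section \<open>Spectra of Hermitian matrices\<close>

abbreviation (input) entry :: "'a mat \<Rightarrow> nat \<Rightarrow> nat \<Rightarrow> 'a" where
  "entry A \<equiv> (\<lambda>i j. A $$ (i, j))"

lemma fpow_mat:
  assumes "A \<in> carrier_mat n n" "i < n" "j < n"
  shows "fpow n (entry A) k i j = (A ^\<^sub>m k) $$ (i, j)"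
  using assms(2,3)
proof (induction k arbitrary: i j)
  case 0
  with assms(1) show ?case by auto
next
  case (Suc k)
  have one: "fpow n (entry A) 1 l j = A $$ (l, j)" for l
  proof -
    have "fpow n (entry A) 1 l j = (\<Sum>r<n. if r = j then A $$ (l, r) else 0)"
      unfolding One_nat_def fpow.simps by (intro sum.cong) auto
    with Suc.prems show ?thesis by simp
  qed
  have "fpow n (entry A) (Suc k) i j = (\<Sum>l<n. fpow n (entry A) k i l * fpow n (entry A) 1 l j)"
    using fpow_add[OF Suc.prems(1), of "entry A" k 1 j] by simp
  also have "\<dots> = (\<Sum>l<n. (A ^\<^sub>m k) $$ (i, l) * A $$ (l, j))"
    using Suc unfolding one by (intro sum.cong refl) auto
  also have "\<dots> = (A ^\<^sub>m Suc k) $$ (i, j)"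
    using Suc.prems assms(1) pow_carrier_mat[OF assms(1), of k]
    by (simp add: scalar_prod_def atLeast0LessThan)
  finally show ?case .
qed

lemma mat_trace_comm:
  fixes A B :: "'a :: comm_ring_1 mat"
  assumes "A \<in> carrier_mat n n" "B \<in> carrier_mat n n"
  shows "mat_trace (A * B) = mat_trace (B * A)"
proof -
  have "mat_trace (A * B) = (\<Sum>i<n. \<Sum>j<n. A $$ (i, j) * B $$ (j, i))"
    using assms by (simp add: mat_trace_def scalar_prod_def atLeast0LessThan)
  also have "\<dots> = (\<Sum>j<n. \<Sum>i<n. A $$ (i, j) * B $$ (j, i))" by (rule sum.swap)
  also have "\<dots> = mat_trace (B * A)"
    using assms by (simp add: mat_trace_def scalar_prod_def atLeast0LessThan mult.commute)
  finally show ?thesis .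
qed

lemma upper_triangular_pow_diag:
  fixes B :: "'a :: comm_ring_1 mat"
  assumes B: "B \<in> carrier_mat n n" and ut: "upper_triangular B"
  shows "i < n \<Longrightarrow> j < n \<Longrightarrow> j \<le> i \<Longrightarrow> (B ^\<^sub>m k) $$ (i, j) = (if i = j then (B $$ (i, i)) ^ k else 0)"
proof (induction k arbitrary: i j)
  case 0
  with B show ?case by auto
next
  case (Suc k)
  have B0: "B $$ (l, j) = 0" if "j < l" "l < n" for l
    using ut B that by (auto simp: upper_triangular_def)
  have "(B ^\<^sub>m Suc k) $$ (i, j) = (\<Sum>l<n. (B ^\<^sub>m k) $$ (i, l) * B $$ (l, j))"
    using Suc.prems B pow_carrier_mat[OF B, of k]
    by (simp add: scalar_prod_def atLeast0LessThan)
  also have "\<dots> = (\<Sum>l<n. if l = i then (if i = j then (B $$ (i, i)) ^ Suc k else 0) else 0)"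
  proof (intro sum.cong refl)
    fix l assume l: "l \<in> {..<n}"
    consider "l < i" | "l = i" | "l > i" by linarith
    then show "(B ^\<^sub>m k) $$ (i, l) * B $$ (l, j) =
        (if l = i then (if i = j then (B $$ (i, i)) ^ Suc k else 0) else 0)"
      using Suc l B0[of l] by cases (auto simp: mult.commute)
  qed
  finally show ?case using Suc.prems by simp
qed

text \<open>The numbers \<open>z\<^sub>i\<close> are the diagonal entries of a Schur triangularization, so they are the eigenvalues with
  multiplicity.\<close>

lemma spectrum_triangular:
  fixes A :: "complex mat"
  assumes A: "A \<in> carrier_mat n n"
  obtains z where "\<And>k. ftrace n (entry A) k = power_sum n k z" "det A = (\<Prod>i<n. z i)"
    "{t. eigenvalue A t} = z ` {..<n}"
proof -
  obtain as where as: "char_poly A = (\<Prod>a\<leftarrow>as. [:- a, 1:])"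
    using char_poly_factorized[OF A] by blast
  obtain B where B: "B \<in> carrier_mat n n" "upper_triangular B" and sim: "similar_mat A B"
    using schur_decomposition_exists[OF A as] by blast
  obtain P Q where PQ: "similar_mat_wit A B P Q" using sim by (auto simp: similar_mat_def)
  note D = similar_mat_witD2[OF A PQ]
  have Bk: "B ^\<^sub>m k \<in> carrier_mat n n" for k using B(1) by (rule pow_carrier_mat)
  have "ftrace n (entry A) k = power_sum n k (\<lambda>i. B $$ (i, i))" for k
  proof -
    have "ftrace n (entry A) k = mat_trace (A ^\<^sub>m k)"
      using A pow_carrier_mat[OF A, of k]
      by (auto simp: ftrace_def mat_trace_def fpow_mat[OF A] intro!: sum.cong)
    also have "A ^\<^sub>m k = (P * B ^\<^sub>m k) * Q" using similar_mat_wit_pow_id[OF PQ] .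
    also have "mat_trace \<dots> = mat_trace (Q * (P * B ^\<^sub>m k))"
      using D Bk by (intro mat_trace_comm[of _ n] mult_carrier_mat)
    also have "Q * (P * B ^\<^sub>m k) = (Q * P) * B ^\<^sub>m k"
      using D Bk by (intro assoc_mult_mat[symmetric])
    also have "\<dots> = B ^\<^sub>m k" by (simp only: D(2) left_mult_one_mat[OF Bk])
    also have "mat_trace (B ^\<^sub>m k) = power_sum n k (\<lambda>i. B $$ (i, i))"
      using Bk upper_triangular_pow_diag[OF B]
      by (auto simp: mat_trace_def power_sum_def carrier_matD[OF Bk] carrier_matD[OF B(1)]
          intro!: sum.cong)
    finally show ?thesis .
  qed
  moreover have "det A = (\<Prod>i<n. B $$ (i, i))"
    using det_similar[OF sim] det_upper_triangular[OF B(2,1)] B(1)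
    by (simp add: prod_list_diag_prod atLeast0LessThan)
  moreover have "{t. eigenvalue A t} = (\<lambda>i. B $$ (i, i)) ` {..<n}"
  proof -
    have "char_poly A = (\<Prod>a\<leftarrow>diag_mat B. [:- a, 1:])"
      using char_poly_similar[OF sim] char_poly_upper_triangular[OF B] by simp
    then have "eigenvalue A t \<longleftrightarrow> t \<in> set (diag_mat B)" for t
      unfolding eigenvalue_root_char_poly[OF A] by (simp add: poly_prod_list prod_list_zero_iff o_def) force
    then show ?thesis using B(1) by (auto simp: diag_mat_def)
  qed
  ultimately show ?thesis by (rule that)
qed

lemma Herm_quadratic_form_real:
  assumes "A \<in> Herm n"
  shows "Im (\<Sum>i<n. \<Sum>j<n. cnj (v i) * A $$ (i, j) * v j) = 0"
proof -
  have h: "\<And>i j. i < n \<Longrightarrow> j < n \<Longrightarrow> cnj (A $$ (i, j)) = A $$ (j, i)"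
    using assms unfolding mem_Herm_iff by metis
  have "cnj (\<Sum>i<n. \<Sum>j<n. cnj (v i) * A $$ (i, j) * v j) =
      (\<Sum>i<n. \<Sum>j<n. cnj (v j) * A $$ (j, i) * v i)"
    unfolding cnj_sum complex_cnj_mult complex_cnj_cnj
    by (intro sum.cong refl) (simp only: h lessThan_iff mult_ac)
  also have "\<dots> = (\<Sum>i<n. \<Sum>j<n. cnj (v i) * A $$ (i, j) * v j)" by (rule sum.swap)
  finally have "cnj (\<Sum>i<n. \<Sum>j<n. cnj (v i) * A $$ (i, j) * v j) =
      (\<Sum>i<n. \<Sum>j<n. cnj (v i) * A $$ (i, j) * v j)" .
  moreover have "cnj s = s \<Longrightarrow> Im s = 0" for s by (simp add: complex_eq_iff)
  ultimately show ?thesis by blast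
qed

lemma eigenvalue_quadratic_form:
  fixes A :: "complex mat"
  assumes A: "A \<in> carrier_mat n n" and "eigenvalue A t"
  obtains v where "(\<Sum>i<n. (cmod (v i))\<^sup>2) > 0"
    "(\<Sum>i<n. \<Sum>j<n. cnj (v i) * A $$ (i, j) * v j) = t * of_real (\<Sum>i<n. (cmod (v i))\<^sup>2)"
proof -
  obtain w where w: "w \<in> carrier_vec n" "w \<noteq> 0\<^sub>v n" "A *\<^sub>v w = t \<cdot>\<^sub>v w"
    using assms by (auto simp: eigenvalue_def eigenvector_def)
  let ?v = "\<lambda>i. w $ i"
  obtain i where "i < n" "w $ i \<noteq> 0"
    using w by (metis carrier_vecD eq_vecI index_zero_vec(1,2))
  then have "(\<Sum>i<n. (cmod (?v i))\<^sup>2) > 0"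
    by (intro sum_pos2[of _ i]) auto
  moreover have "(\<Sum>i<n. \<Sum>j<n. cnj (?v i) * A $$ (i, j) * ?v j) =
      t * of_real (\<Sum>i<n. (cmod (?v i))\<^sup>2)"
  proof -
    have "(\<Sum>j<n. A $$ (i, j) * ?v j) = t * ?v i" if "i < n" for i
    proof -
      have "(A *\<^sub>v w) $ i = (\<Sum>j<n. A $$ (i, j) * ?v j)"
        using A w(1) that by (simp add: scalar_prod_def atLeast0LessThan)
      then show ?thesis using w that by simp
    qed
    then have "(\<Sum>i<n. \<Sum>j<n. cnj (?v i) * A $$ (i, j) * ?v j) = (\<Sum>i<n. cnj (?v i) * (t * ?v i))"
      by (simp add: mult.assoc sum_distrib_left[symmetric])
    then show ?thesis
      by (simp add: sum_distrib_left complex_norm_square mult_ac del: of_real_power)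
  qed
  ultimately show ?thesis by (rule that)
qed

lemma Herm_eigenvalue_real:
  assumes "A \<in> Herm n" "eigenvalue A t"
  shows "t \<in> \<real>"
proof -
  have A: "A \<in> carrier_mat n n" using assms(1) by (simp add: Herm_def)
  obtain v where v: "(\<Sum>i<n. (cmod (v i))\<^sup>2) > 0"
    "(\<Sum>i<n. \<Sum>j<n. cnj (v i) * A $$ (i, j) * v j) = t * of_real (\<Sum>i<n. (cmod (v i))\<^sup>2)"
    using eigenvalue_quadratic_form[OF A assms(2)] .
  then have "Im (t * of_real (\<Sum>i<n. (cmod (v i))\<^sup>2)) = 0"
    using Herm_quadratic_form_real[OF assms(1), of v] by simp
  with v(1) show ?thesis by (simp add: complex_is_Real_iff)
qed

definition is_spectrum :: "nat \<Rightarrow> complex mat \<Rightarrow> (nat \<Rightarrow> real) \<Rightarrow> bool" where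
  "is_spectrum n A lam \<longleftrightarrow>
     (\<forall>k. ftrace n (entry A) k = power_sum n k (cpx lam)) \<and>
     det A = of_real (\<Prod>i<n. lam i) \<and>
     {t. eigenvalue A (of_real t)} = lam ` {..<n}"

text \<open>The eigenvalues with multiplicity, in an unspecified order: only their set and symmetric functions of
  them matter.\<close>

definition eigs :: "nat \<Rightarrow> complex mat \<Rightarrow> nat \<Rightarrow> real" where
  "eigs n A = (SOME lam. is_spectrum n A lam)"

lemma is_spectrum_eigs:
  assumes "A \<in> Herm n"
  shows "is_spectrum n A (eigs n A)"
proof -
  have A: "A \<in> carrier_mat n n" using assms by (simp add: Herm_def)
  obtain z where z: "\<And>k. ftrace n (entry A) k = power_sum n k z" "det A = (\<Prod>i<n. z i)"
    "{t. eigenvalue A t} = z ` {..<n}"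
    using spectrum_triangular[OF A] by blast
  have "z i = of_real (Re (z i))" if "i < n" for i
    using z(3) that Herm_eigenvalue_real[OF assms, of "z i"] by (auto simp: complex_is_Real_iff complex_eq_iff)
  then have "power_sum n k z = power_sum n k (cpx (\<lambda>i. Re (z i)))"
    "(\<Prod>i<n. z i) = of_real (\<Prod>i<n. Re (z i))"
    "{t. eigenvalue A (of_real t)} = (\<lambda>i. Re (z i)) ` {..<n}" for k
  proof -
    assume *: "\<And>i. i < n \<Longrightarrow> z i = of_real (Re (z i))"
    show "power_sum n k z = power_sum n k (cpx (\<lambda>i. Re (z i)))"
      unfolding power_sum_def using * by (intro sum.cong refl) auto
    show "(\<Prod>i<n. z i) = of_real (\<Prod>i<n. Re (z i))"
      unfolding of_real_prod using * by (intro prod.cong refl) auto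
    have "eigenvalue A (of_real t) \<longleftrightarrow> of_real t \<in> z ` {..<n}" for t using z(3) by auto
    also have "\<dots> t \<longleftrightarrow> t \<in> (\<lambda>i. Re (z i)) ` {..<n}" for t
      using * by (metis (no_types, lifting) Re_complex_of_real image_iff lessThan_iff)
    finally show "{t. eigenvalue A (of_real t)} = (\<lambda>i. Re (z i)) ` {..<n}" by auto
  qed
  with z have "is_spectrum n A (\<lambda>i. Re (z i))" by (simp add: is_spectrum_def)
  then show ?thesis unfolding eigs_def by (rule someI[of "is_spectrum n A"])
qed

section \<open>Symmetric polynomials and power sums\<close>

definition power_sum_poly :: "nat \<Rightarrow> ((nat \<Rightarrow> complex) \<Rightarrow> complex) \<Rightarrow> bool" where
  "power_sum_poly n f \<longleftrightarrow>
     (\<exists>L. \<forall>x. f x = (\<Sum>(a, ms)\<leftarrow>L. a * pprod (power_sum n) ms x))"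

lemma pprod_append: "pprod P (xs @ ys) c = pprod P xs c * pprod P ys c"
  by (simp add: pprod_def)

lemma power_sum_poly_const: "power_sum_poly n (\<lambda>x. a)"
  unfolding power_sum_poly_def by (rule exI[of _ "[(a, [])]"]) simp

lemma power_sum_poly_power_sum: "power_sum_poly n (power_sum n m)"
  unfolding power_sum_poly_def by (rule exI[of _ "[(1, [m])]"]) simp

lemma power_sum_poly_add:
  assumes "power_sum_poly n f" "power_sum_poly n g"
  shows "power_sum_poly n (\<lambda>x. f x + g x)"
proof -
  obtain L K where "\<forall>x. f x = (\<Sum>(a, ms)\<leftarrow>L. a * pprod (power_sum n) ms x)"
    "\<forall>x. g x = (\<Sum>(a, ms)\<leftarrow>K. a * pprod (power_sum n) ms x)"
    using assms unfolding power_sum_poly_def by blast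
  then show ?thesis unfolding power_sum_poly_def by (intro exI[of _ "L @ K"]) simp
qed

lemma power_sum_poly_mult:
  assumes "power_sum_poly n f" "power_sum_poly n g"
  shows "power_sum_poly n (\<lambda>x. f x * g x)"
proof -
  obtain L K where LK: "\<forall>x. f x = (\<Sum>(a, ms)\<leftarrow>L. a * pprod (power_sum n) ms x)"
    "\<forall>x. g x = (\<Sum>(a, ms)\<leftarrow>K. a * pprod (power_sum n) ms x)"
    using assms unfolding power_sum_poly_def by blast
  have 1: "(\<Sum>(b, ks)\<leftarrow>map (\<lambda>(b, ks). (a * b, ms @ ks)) K. b * pprod (power_sum n) ks x) =
      a * pprod (power_sum n) ms x * (\<Sum>(b, ks)\<leftarrow>K. b * pprod (power_sum n) ks x)" for a ms x
    by (induction K) (auto simp: pprod_append algebra_simps)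
  have "(\<Sum>(b, ks)\<leftarrow>concat (map (\<lambda>(a, ms). map (\<lambda>(b, ks). (a * b, ms @ ks)) K) L). b * pprod (power_sum n) ks x) =
      (\<Sum>(a, ms)\<leftarrow>L. a * pprod (power_sum n) ms x) * (\<Sum>(b, ks)\<leftarrow>K. b * pprod (power_sum n) ks x)" for x
    by (induction L) (auto simp: 1 distrib_right simp del: map_map)
  with LK show ?thesis unfolding power_sum_poly_def by metis
qed

lemma power_sum_poly_sum:
  "(\<And>i. i \<in> A \<Longrightarrow> power_sum_poly n (f i)) \<Longrightarrow> power_sum_poly n (\<lambda>x. \<Sum>i\<in>A. f i x)"
  by (induction A rule: infinite_finite_induct) (auto intro: power_sum_poly_const power_sum_poly_add)

definition elem_sym :: "nat \<Rightarrow> nat \<Rightarrow> (nat \<Rightarrow> 'a) \<Rightarrow> 'a :: idom" where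
  "elem_sym n k y = coeff (\<Prod>i<n. [:1, y i:]) k"

lemma elem_sym_top: "elem_sym n n y = (\<Prod>i<n. y i)"
proof -
  have "degree (\<Prod>i<n. [:1, y i:]) \<le> n \<and> coeff (\<Prod>i<n. [:1, y i:]) n = (\<Prod>i<n. y i)"
  proof (induction n)
    case (Suc n)
    have "degree ((\<Prod>i<n. [:1, y i:]) * [:1, y n:]) \<le> degree (\<Prod>i<n. [:1, y i:]) + degree [:1, y n:]"
      by (rule degree_mult_le)
    also have "\<dots> \<le> Suc n" using Suc by simp
    finally have d: "degree ((\<Prod>i<n. [:1, y i:]) * [:1, y n:]) \<le> Suc n" .
    have "coeff (\<Prod>i<n. [:1, y i:]) (Suc n) = 0" using Suc by (intro coeff_eq_0) simp
    with Suc d show ?case by (simp add: mult.commute)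
  qed simp
  then show ?thesis by (simp add: elem_sym_def)
qed

text \<open>Compare coefficients in \<open>E' = \<Sum> y\<^sub>i E / (1 + y\<^sub>i X)\<close> for \<open>E = \<Prod> (1 + y\<^sub>i X)\<close>; the quotient \<open>E / (1 + y\<^sub>i X)\<close> is
  the product over the other indices.\<close>

lemma newton_identity:
  fixes y :: "nat \<Rightarrow> 'a :: idom"
  shows "of_nat (Suc k) * elem_sym n (Suc k) y =
     (\<Sum>j\<le>k. (-1) ^ j * elem_sym n (k - j) y * power_sum n (Suc j) y)"
proof -
  let ?E = "\<Prod>i<n. [:1, y i:]" and ?A = "\<lambda>l. \<Prod>i\<in>{..<n} - {l}. [:1, y i:]"
  have A: "coeff (?A l) k = (\<Sum>j\<le>k. (- y l) ^ j * coeff ?E (k - j))" if "l < n" for l k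
  proof -
    have E: "?E = ?A l + pCons 0 (smult (y l) (?A l))"
      using prod.remove[of "{..<n}" l "\<lambda>i. [:1, y i:]"] that by simp
    show ?thesis
    proof (induction k)
      case 0
      have "coeff ?E 0 = coeff (?A l) 0" by (subst E) simp
      then show ?case by simp
    next
      case (Suc k)
      have "coeff ?E (Suc k) = coeff (?A l) (Suc k) + y l * coeff (?A l) k" by (subst E) simp
      then have "coeff (?A l) (Suc k) = coeff ?E (Suc k) + (- y l) * (\<Sum>j\<le>k. (- y l) ^ j * coeff ?E (k - j))"
        unfolding Suc[symmetric] by (simp add: algebra_simps)
      then show ?case
        by (simp only: sum.atMost_Suc_shift sum_distrib_left) (simp add: mult.assoc)
    qed
  qed
  have "of_nat (Suc k) * elem_sym n (Suc k) y = coeff (pderiv ?E) k"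
    by (simp add: elem_sym_def coeff_pderiv)
  also have "pderiv ?E = (\<Sum>l<n. ?A l * pderiv [:1, y l:])" by (rule pderiv_prod)
  also have "\<dots> = (\<Sum>l<n. smult (y l) (?A l))"
    by (intro sum.cong refl) (simp add: pderiv_pCons)
  also have "coeff \<dots> k = (\<Sum>l<n. y l * (\<Sum>j\<le>k. (- y l) ^ j * coeff ?E (k - j)))"
    by (simp add: coeff_sum A)
  also have "\<dots> = (\<Sum>j\<le>k. \<Sum>l<n. (-1) ^ j * coeff ?E (k - j) * y l ^ Suc j)"
    unfolding sum_distrib_left
    by (subst sum.swap) (auto intro!: sum.cong simp: power_minus[of "y _"] mult_ac)
  finally show ?thesis by (simp add: elem_sym_def power_sum_def sum_distrib_left)
qed

text \<open>Newton's identities are applied to the numbers \<open>Q(x\<^sub>i)\<close>, whose power sums are linear combinations of those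
  of the \<open>x\<^sub>i\<close>.\<close>

lemma power_sum_poly_prod: "power_sum_poly n (\<lambda>x. \<Prod>i<n. poly Q (x i))"
proof -
  have p: "power_sum_poly n (\<lambda>x. power_sum n m (\<lambda>i. poly Q (x i)))" for m
  proof -
    have "power_sum n m (\<lambda>i. poly Q (x i)) =
        (\<Sum>d\<le>degree (Q ^ m). coeff (Q ^ m) d * power_sum n d x)" for x :: "nat \<Rightarrow> complex"
    proof -
      have "poly Q (x i) ^ m = (\<Sum>d\<le>degree (Q ^ m). coeff (Q ^ m) d * x i ^ d)" for i
        unfolding poly_power[symmetric] by (rule poly_altdef)
      then show ?thesis
        unfolding power_sum_def sum_distrib_left by (simp only:) (rule sum.swap)
    qed
    then show ?thesis
      by (simp only:) (intro power_sum_poly_sum power_sum_poly_mult power_sum_poly_const power_sum_poly_power_sum)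
  qed
  have e: "power_sum_poly n (\<lambda>x. elem_sym n k (\<lambda>i. poly Q (x i)))" for k
  proof (induction k rule: less_induct)
    case (less k)
    show ?case
    proof (cases k)
      case 0
      have "elem_sym n 0 y = 1" for y :: "nat \<Rightarrow> complex"
        by (simp add: elem_sym_def poly_0_coeff_0[symmetric] poly_prod)
      then show ?thesis by (simp add: 0 power_sum_poly_const)
    next
      case (Suc l)
      have "elem_sym n k y = inverse (of_nat (Suc l)) *
          (\<Sum>j\<le>l. (-1) ^ j * elem_sym n (l - j) y * power_sum n (Suc j) y)" for y :: "nat \<Rightarrow> complex"
        unfolding newton_identity[symmetric] Suc mult.assoc[symmetric]
        by (subst left_inverse) (simp_all only: of_nat_neq_0 not_False_eq_True mult_1_left)
      then show ?thesis
        by (simp only:) (intro power_sum_poly_sum power_sum_poly_mult power_sum_poly_const p less; simp add: Suc)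
    qed
  qed
  show ?thesis using e[of n] by (simp add: elem_sym_top)
qed

section \<open>Integration of spectral functions\<close>

definition spec_prod :: "nat \<Rightarrow> complex poly \<Rightarrow> complex mat \<Rightarrow> complex" where
  "spec_prod n Q A = (\<Prod>i<n. poly Q (of_real (eigs n A i)))"

lemma herm_of_Herm: "herm_of n c \<in> Herm n"
  by (auto simp: mem_Herm_iff herm_of_def complex_eq_iff)

lemma fpow_cong:
  "(\<And>i j. i < n \<Longrightarrow> j < n \<Longrightarrow> A i j = B i j) \<Longrightarrow> i < n \<Longrightarrow> j < n \<Longrightarrow> fpow n A k i j = fpow n B k i j"
  by (induction k arbitrary: i) auto

lemma ftrace_herm_of: "ftrace n (entry (herm_of n c)) k = herm_trace n k c"
  unfolding ftrace_def by (intro sum.cong refl fpow_cong) (auto simp: herm_of_entry)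

lemma spec_prod_traces:
  obtains L where
    "\<And>A. A \<in> Herm n \<Longrightarrow> spec_prod n Q A = (\<Sum>(a, ms)\<leftarrow>L. a * pprod (\<lambda>k A. ftrace n (entry A) k) ms A)"
    "\<And>x. (\<Prod>i<n. poly Q (x i)) = (\<Sum>(a, ms)\<leftarrow>L. a * pprod (power_sum n) ms x)"
proof -
  obtain L where L: "\<And>x. (\<Prod>i<n. poly Q (x i)) = (\<Sum>(a, ms)\<leftarrow>L. a * pprod (power_sum n) ms x)"
    using power_sum_poly_prod[of n Q] unfolding power_sum_poly_def by blast
  have "spec_prod n Q A = (\<Sum>(a, ms)\<leftarrow>L. a * pprod (\<lambda>k A. ftrace n (entry A) k) ms A)" if "A \<in> Herm n" for A
    using is_spectrum_eigs[OF that] unfolding spec_prod_def L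
    by (simp add: is_spectrum_def pprod_def)
  from that[OF this L] show ?thesis .
qed

lemma gauss_int_sum_list:
  assumes I: "finite I" and f: "\<And>ms. polyf I (f ms)"
  shows "gauss_int I (\<lambda>c. \<Sum>(a, ms)\<leftarrow>L. a * f ms c) = (\<Sum>(a, ms)\<leftarrow>L. a * gauss_int I (f ms))"
proof (induction L)
  case Nil
  then show ?case by (simp add: gauss_int_def)
next
  case (Cons x L)
  have "gauss_int I (\<lambda>c. \<Sum>(a, ms)\<leftarrow>x # L. a * f ms c) =
      gauss_int I (\<lambda>c. fst x * f (snd x) c) + gauss_int I (\<lambda>c. \<Sum>(a, ms)\<leftarrow>L. a * f ms c)"
    unfolding list.map sum_list.Cons case_prod_unfold
    by (intro gauss_int_add polyf_gauss_integrable I polyf_intros f)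
  with Cons show ?case by (simp add: gauss_int_scale case_prod_unfold)
qed

definition vander_int :: "nat \<Rightarrow> complex poly \<Rightarrow> complex" where
  "vander_int n Q =
     gauss_int {..<n} (\<lambda>x. (vandermonde n (cpx x))\<^sup>2 * (\<Prod>i<n. poly Q (of_real (x i))))"

lemma polyf_spec_prod: "polyf ({..<n} \<times> {..<n}) (\<lambda>c. spec_prod n Q (herm_of n c))"
proof -
  obtain L where L: "\<And>A. A \<in> Herm n \<Longrightarrow>
      spec_prod n Q A = (\<Sum>(a, ms)\<leftarrow>L. a * pprod (\<lambda>k A. ftrace n (entry A) k) ms A)"
    by (rule spec_prod_traces[of n Q]) blast
  have "spec_prod n Q (herm_of n c) = (\<Sum>x\<leftarrow>L. fst x * pprod (herm_trace n) (snd x) c)" for c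
    unfolding L[OF herm_of_Herm] pprod_def ftrace_herm_of case_prod_unfold ..
  then show ?thesis by (simp only:) (intro polyf_intros polyf_pprod polyf_herm_trace)
qed

text \<open>The polynomial case of Weyl's integration formula, with the unknown constant eliminated by comparison
  with \<open>Q = 1\<close>.\<close>

theorem integral_spec_prod:
  "gauss_int ({..<n} \<times> {..<n}) (\<lambda>c. spec_prod n Q (herm_of n c)) * vander_int n 1 =
     vander_int n Q * gauss_int ({..<n} \<times> {..<n}) (\<lambda>c. 1)"
proof -
  let ?I = "{..<n} \<times> {..<n}"
  let ?Lm = "\<lambda>ms. gauss_int ?I (pprod (herm_trace n) ms)"
  let ?Lv = "\<lambda>ms. gauss_int {..<n}
     (\<lambda>c. (vandermonde n (cpx c))\<^sup>2 * pprod (\<lambda>m c. power_sum n m (cpx c)) ms c)"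
  obtain L where L: "\<And>A. A \<in> Herm n \<Longrightarrow>
      spec_prod n Q A = (\<Sum>(a, ms)\<leftarrow>L. a * pprod (\<lambda>k A. ftrace n (entry A) k) ms A)"
    "\<And>x. (\<Prod>i<n. poly Q (x i)) = (\<Sum>(a, ms)\<leftarrow>L. a * pprod (power_sum n) ms x)"
    by (rule spec_prod_traces[of n Q]) blast
  have m: "spec_prod n Q (herm_of n c) = (\<Sum>(a, ms)\<leftarrow>L. a * pprod (herm_trace n) ms c)" for c
    unfolding L(1)[OF herm_of_Herm] pprod_def ftrace_herm_of ..
  have v: "(vandermonde n (cpx c))\<^sup>2 * (\<Prod>i<n. poly Q (of_real (c i))) =
      (\<Sum>(a, ms)\<leftarrow>L. a * ((vandermonde n (cpx c))\<^sup>2 * pprod (\<lambda>m c. power_sum n m (cpx c)) ms c))" for c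
    unfolding L(2) pprod_def sum_list_const_mult[symmetric] case_prod_unfold
    by (simp add: mult_ac)
  have 1: "gauss_int ?I (\<lambda>c. spec_prod n Q (herm_of n c)) = (\<Sum>(a, ms)\<leftarrow>L. a * ?Lm ms)"
    unfolding m by (rule gauss_int_sum_list) (auto intro: polyf_pprod polyf_herm_trace)
  have 2: "vander_int n Q = (\<Sum>(a, ms)\<leftarrow>L. a * ?Lv ms)"
    unfolding vander_int_def v
    by (rule gauss_int_sum_list)
      (auto intro!: polyf_intros polyf_pprod polyf_power_sum polyf_vandermonde)
  have 3: "vander_int n 1 = ?Lv []" by (simp add: vander_int_def)
  have 4: "gauss_int ?I (\<lambda>c. 1) = ?Lm []"
    by (rule arg_cong[of _ _ "gauss_int ?I"]) auto
  have "a * ?Lm ms * ?Lv [] = a * ?Lv ms * ?Lm []" for a ms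
    unfolding mult.assoc
    by (rule arg_cong[where f = "(*) a"],
        rule loop_functional_unique[OF loop_functional_herm[of n] loop_functional_vandermonde[of n]])
  then show ?thesis
    unfolding 1 2 3 4 sum_list_mult_const[symmetric] case_prod_unfold
    by (intro arg_cong[where f = sum_list] map_cong refl)
qed

section \<open>Determinantal form of the Vandermonde integrals\<close>

text \<open>Replacing the powers by polynomials \<open>q\<^sub>j\<close> of degree at most \<open>j\<close> multiplies the matrix by a triangular one.\<close>

lemma det_poly_triangular_change:
  fixes q :: "nat \<Rightarrow> 'a :: idom poly"
  assumes "\<And>j. j < n \<Longrightarrow> degree (q j) \<le> j"
  shows "det (mat n n (\<lambda>(i, j). poly (q j) (x i))) =
    det (mat n n (\<lambda>(i, j). x i ^ j)) * (\<Prod>j<n. coeff (q j) j)"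
proof -
  let ?P = "mat n n (\<lambda>(i, j). x i ^ j)" and ?C = "mat n n (\<lambda>(k, j). coeff (q j) k)"
  have "mat n n (\<lambda>(i, j). poly (q j) (x i)) = ?P * ?C"
  proof (rule eq_matI)
    fix i j assume "i < dim_row (?P * ?C)" "j < dim_col (?P * ?C)"
    then have ij: "i < n" "j < n" by auto
    have "poly (q j) (x i) = (\<Sum>k\<le>degree (q j). coeff (q j) k * x i ^ k)" by (rule poly_altdef)
    also have "\<dots> = (\<Sum>k<n. coeff (q j) k * x i ^ k)"
      using assms[OF ij(2)] ij by (intro sum.mono_neutral_left) (auto simp: coeff_eq_0)
    finally show "mat n n (\<lambda>(i, j). poly (q j) (x i)) $$ (i, j) = (?P * ?C) $$ (i, j)"
      using ij by (simp add: scalar_prod_def atLeast0LessThan mult.commute)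
  qed auto
  then have "det (mat n n (\<lambda>(i, j). poly (q j) (x i))) = det ?P * det ?C"
    by (simp add: det_mult[of _ n])
  moreover have "det ?C = (\<Prod>j<n. coeff (q j) j)"
  proof -
    have "upper_triangular ?C"
    proof (rule upper_triangularI)
      fix i j assume "j < i" "i < dim_row ?C"
      then show "?C $$ (i, j) = 0" using assms[of j] by (simp add: coeff_eq_0)
    qed
    then have "det ?C = prod_list (diag_mat ?C)" by (rule det_upper_triangular) auto
    then show ?thesis by (simp add: prod_list_diag_prod atLeast0LessThan)
  qed
  ultimately show ?thesis by simp
qed

text \<open>In the Newton basis \<open>\<Prod>l<j. (X - x\<^sub>l)\<close>, whose members are monic, the matrix is lower triangular and its
  determinant can be read off.\<close>

lemma det_powers_vandermonde:
  fixes x :: "nat \<Rightarrow> 'a :: idom"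
  shows "det (mat n n (\<lambda>(i, j). x i ^ j)) = vandermonde n x"
proof -
  let ?N = "\<lambda>j. \<Prod>l<j. [:- x l, 1:]"
  have deg: "degree (?N j) = j" for j by (subst degree_prod_eq_sum_degree) auto
  have lead: "coeff (?N j) j = 1" for j
    using lead_coeff_prod[of "\<lambda>l. [:- x l, 1:]" "{..<j}"] deg[of j] by simp
  let ?M = "mat n n (\<lambda>(i, j). poly (?N j) (x i))"
  have "det ?M = prod_list (diag_mat ?M)"
  proof (rule det_lower_triangular)
    fix i j assume "i < j" "j < n"
    then show "?M $$ (i, j) = 0" by (auto simp: poly_prod intro!: prod_zero bexI[of _ i])
  qed auto
  also have "\<dots> = (\<Prod>i<n. \<Prod>l<i. x i - x l)"
    by (simp add: prod_list_diag_prod atLeast0LessThan poly_prod)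
  also have "\<dots> = vandermonde n x"
  proof -
    have "(\<Prod>i<n. \<Prod>l<i. x i - x l) = (\<Prod>(i, l)\<in>Sigma {..<n} (\<lambda>i. {..<i}). x i - x l)"
      by (rule prod.Sigma) auto
    also have "\<dots> = vandermonde n x"
      unfolding vandermonde_def
      by (rule prod.reindex_bij_witness[of _ prod.swap prod.swap]) (auto simp: less_pairs_def)
    finally show ?thesis .
  qed
  finally show ?thesis
    using det_poly_triangular_change[of n ?N x] by (simp add: deg lead)
qed

definition gauss1 :: "(complex \<Rightarrow> complex) \<Rightarrow> complex" where
  "gauss1 f = (\<integral>x. f (of_real x) * of_real (exp (- x\<^sup>2)) \<partial>lborel)"

lemma integrable_poly_gauss:
  "integrable lborel (\<lambda>x. poly p (complex_of_real x) * of_real (exp (- x\<^sup>2)))"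
proof -
  have "integrable lborel (\<lambda>x. complex_of_real x ^ k * of_real (exp (- x\<^sup>2)))" for k
    using integrable_of_real[OF integrable_gauss_moment[of k], where 'a = complex] by simp
  then show ?thesis unfolding poly_altdef sum_distrib_right mult.assoc
    by (intro Bochner_Integration.integrable_sum integrable_mult_right)
qed

text \<open>Expand one Vandermonde determinant over \<open>\<sigma>\<close>, the other over \<open>\<tau>\<close>, and integrate factor by factor.  For
  fixed \<open>\<sigma>\<close> the sum over \<open>\<tau>\<close> is the determinant of the Gram matrix with its rows permuted by \<open>\<sigma>\<close>.\<close>

lemma andreief:
  assumes deg: "\<And>j. j < n \<Longrightarrow> degree (q j) \<le> j"
  shows "(\<Prod>j<n. coeff (q j) j)\<^sup>2 * vander_int n Q =
     fact n * det (mat n n (\<lambda>(i, j). gauss1 (poly (q i * q j * Q))))"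
proof -
  let ?P = "{p. p permutes {0..<n}}" and ?K = "\<Prod>j<n. coeff (q j) j"
  let ?G = "mat n n (\<lambda>(i, j). gauss1 (poly (q i * q j * Q)))"
  have finP: "finite ?P" by (rule finite_permutations) simp
  have perm: "\<sigma> i < n" if "\<sigma> \<in> ?P" "i < n" for \<sigma> i
    using permutes_in_image[of \<sigma> "{0..<n}" i] that by auto
  have V: "?K * vandermonde n y = (\<Sum>\<sigma>\<in>?P. signof \<sigma> * (\<Prod>i<n. poly (q (\<sigma> i)) (y i)))" for y
  proof -
    have "?K * vandermonde n y = det (mat n n (\<lambda>(i, j). poly (q j) (y i)))"
      using det_poly_triangular_change[of n q y] deg by (simp add: det_powers_vandermonde mult.commute)
    also have "\<dots> = (\<Sum>\<sigma>\<in>?P. signof \<sigma> * (\<Prod>i = 0..<n. mat n n (\<lambda>(i, j). poly (q j) (y i)) $$ (i, \<sigma> i)))"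
      by (rule det_def') simp
    also have "\<dots> = (\<Sum>\<sigma>\<in>?P. signof \<sigma> * (\<Prod>i<n. poly (q (\<sigma> i)) (y i)))"
      using perm by (intro sum.cong refl arg_cong2[where f = "(*)"] prod.cong) auto
    finally show ?thesis .
  qed
  have expand: "?K\<^sup>2 * ((vandermonde n y)\<^sup>2 * (\<Prod>i<n. poly Q (y i))) =
      (\<Sum>\<sigma>\<in>?P. \<Sum>\<tau>\<in>?P. signof \<sigma> * signof \<tau> * (\<Prod>i<n. poly (q (\<sigma> i) * q (\<tau> i) * Q) (y i)))" for y
  proof -
    have "?K\<^sup>2 * ((vandermonde n y)\<^sup>2 * (\<Prod>i<n. poly Q (y i))) =
        (?K * vandermonde n y) * (?K * vandermonde n y) * (\<Prod>i<n. poly Q (y i))"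
      by (simp add: power2_eq_square mult_ac)
    also have "\<dots> = (\<Sum>\<sigma>\<in>?P. \<Sum>\<tau>\<in>?P. signof \<sigma> * signof \<tau> * (\<Prod>i<n. poly (q (\<sigma> i) * q (\<tau> i) * Q) (y i)))"
      unfolding V
      by (subst sum_product, subst sum_distrib_right, subst sum_distrib_right)
        (intro sum.cong refl, simp add: prod.distrib mult_ac)
    finally show ?thesis .
  qed
  have pf: "polyf {..<n} (\<lambda>x. signof \<sigma> * signof \<tau> * (\<Prod>i<n. poly (q (\<sigma> i) * q (\<tau> i) * Q) (of_real (x i))))" for \<sigma> \<tau>
    unfolding poly_altdef by (intro polyf_intros polyf_coord) auto
  have "?K\<^sup>2 * vander_int n Q = gauss_int {..<n} (\<lambda>x. \<Sum>\<sigma>\<in>?P. \<Sum>\<tau>\<in>?P. signof \<sigma> * signof \<tau> *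
      (\<Prod>i<n. poly (q (\<sigma> i) * q (\<tau> i) * Q) (of_real (x i))))"
    unfolding vander_int_def gauss_int_scale[symmetric] expand ..
  also have "\<dots> = (\<Sum>\<sigma>\<in>?P. \<Sum>\<tau>\<in>?P. gauss_int {..<n} (\<lambda>x. signof \<sigma> * signof \<tau> *
      (\<Prod>i<n. poly (q (\<sigma> i) * q (\<tau> i) * Q) (of_real (x i)))))"
    by (subst gauss_int_sum[OF finite_lessThan], intro polyf_sum pf,
        intro sum.cong refl gauss_int_sum finite_lessThan pf)
  also have "\<dots> = (\<Sum>\<sigma>\<in>?P. \<Sum>\<tau>\<in>?P. signof \<sigma> * (signof \<tau> * (\<Prod>i<n. gauss1 (poly (q (\<sigma> i) * q (\<tau> i) * Q)))))"
  proof (intro sum.cong refl)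
    fix \<sigma> \<tau>
    show "gauss_int {..<n} (\<lambda>x. signof \<sigma> * signof \<tau> * (\<Prod>i<n. poly (q (\<sigma> i) * q (\<tau> i) * Q) (of_real (x i)))) =
        signof \<sigma> * (signof \<tau> * (\<Prod>i<n. gauss1 (poly (q (\<sigma> i) * q (\<tau> i) * Q))))"
      unfolding gauss_int_scale gauss1_def mult.assoc[of "signof \<sigma>"]
      by (subst gauss_prod(2)[of "{..<n}" "\<lambda>i x. poly (q (\<sigma> i) * q (\<tau> i) * Q) (of_real x)"])
        (auto intro!: integrable_poly_gauss simp del: poly_mult)
  qed
  also have "\<dots> = (\<Sum>\<sigma>\<in>?P. det ?G)"
  proof (intro sum.cong refl)
    fix \<sigma> assume s: "\<sigma> \<in> ?P"
    have "(\<Sum>\<tau>\<in>?P. signof \<tau> * (\<Prod>i<n. gauss1 (poly (q (\<sigma> i) * q (\<tau> i) * Q)))) =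
        (\<Sum>\<tau>\<in>?P. signof \<tau> * (\<Prod>i = 0..<n. mat n n (\<lambda>(i, j). ?G $$ (\<sigma> i, j)) $$ (i, \<tau> i)))"
      using perm s by (intro sum.cong refl arg_cong2[where f = "(*)"] prod.cong) auto
    also have "\<dots> = det (mat n n (\<lambda>(i, j). ?G $$ (\<sigma> i, j)))"
      by (rule det_def'[symmetric]) simp
    also have "\<dots> = signof \<sigma> * det ?G"
      using s by (intro det_permute_rows) auto
    finally have "(\<Sum>\<tau>\<in>?P. signof \<tau> * (\<Prod>i<n. gauss1 (poly (q (\<sigma> i) * q (\<tau> i) * Q)))) = signof \<sigma> * det ?G" .
    moreover have "signof \<sigma> * (signof \<sigma> * det ?G) = det ?G"
      by (auto simp: sign_def)
    ultimately show "(\<Sum>\<tau>\<in>?P. signof \<sigma> * (signof \<tau> * (\<Prod>i<n. gauss1 (poly (q (\<sigma> i) * q (\<tau> i) * Q))))) = det ?G"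
      by (simp add: sum_distrib_left[symmetric] del: poly_mult)
  qed
  also have "\<dots> = fact n * det ?G"
    using card_permutations[of "{0..<n}" n] by simp
  finally show ?thesis .
qed

text \<open>Each eigenvalue \<open>e \<ge> 0\<close> satisfies \<open>e \<le> exp (e - 1)\<close>, and the exponents add up to the trace minus \<open>n\<close>.\<close>

lemma psd_det_le:
  assumes G: "G \<in> Herm n"
    and psd: "\<And>v. Re (\<Sum>i<n. \<Sum>j<n. cnj (v i) * G $$ (i, j) * v j) \<ge> 0"
  obtains d where "det G = of_real d" "0 \<le> d" "d \<le> exp (\<Sum>i<n. (Re (G $$ (i, i)) - 1))"
proof -
  let ?e = "eigs n G"
  have G': "G \<in> carrier_mat n n" using G by (simp add: Herm_def)
  have s: "is_spectrum n G ?e" using G by (rule is_spectrum_eigs)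
  have nonneg: "?e i \<ge> 0" if "i < n" for i
  proof -
    have "eigenvalue G (of_real (?e i))" using s that by (auto simp: is_spectrum_def)
    then obtain v where v: "(\<Sum>i<n. (cmod (v i))\<^sup>2) > 0"
      "(\<Sum>i<n. \<Sum>j<n. cnj (v i) * G $$ (i, j) * v j) = of_real (?e i) * of_real (\<Sum>i<n. (cmod (v i))\<^sup>2)"
      using eigenvalue_quadratic_form[OF G'] by blast
    have "0 \<le> ?e i * (\<Sum>i<n. (cmod (v i))\<^sup>2)"
      using psd[of v] unfolding v(2) of_real_mult[symmetric] Re_complex_of_real .
    with v(1) show ?thesis by (simp add: zero_le_mult_iff)
  qed
  have "ftrace n (entry G) 1 = power_sum n 1 (cpx ?e)" using s unfolding is_spectrum_def by blast
  moreover have "ftrace n (entry G) 1 = (\<Sum>i<n. G $$ (i, i))"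
    unfolding ftrace_def using G' by (intro sum.cong refl) (simp add: fpow_mat[OF G'] del: fpow.simps)
  ultimately have "(\<Sum>i<n. G $$ (i, i)) = of_real (\<Sum>i<n. ?e i)" by (simp add: power_sum_def)
  then have tr: "(\<Sum>i<n. Re (G $$ (i, i))) = (\<Sum>i<n. ?e i)"
    by (metis Re_complex_of_real Re_sum)
  have "(\<Prod>i<n. ?e i) \<le> (\<Prod>i<n. exp (?e i - 1))"
    using nonneg exp_ge_add_one_self[of "?e _ - 1"] by (intro prod_mono) auto
  also have "\<dots> = exp (\<Sum>i<n. (Re (G $$ (i, i)) - 1))"
    by (simp add: exp_sum[symmetric] sum_subtractf tr)
  finally show ?thesis
    using that[of "\<Prod>i<n. ?e i"] s nonneg by (auto simp: is_spectrum_def intro: prod_nonneg)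
qed

abbreviation cpoly :: "real poly \<Rightarrow> complex poly" where
  "cpoly \<equiv> map_poly of_real"

lemma poly_cpoly: "poly (cpoly p) (of_real x) = of_real (poly p x)"
  by (induction p) (auto simp: map_poly_pCons)

definition gint :: "real poly \<Rightarrow> real" where
  "gint p = (\<integral>x. poly p x * exp (- x\<^sup>2) \<partial>lborel)"

lemma integrable_gint: "integrable lborel (\<lambda>x::real. poly p x * exp (- x\<^sup>2))"
  unfolding poly_altdef sum_distrib_right mult.assoc
  by (intro Bochner_Integration.integrable_sum integrable_mult_right integrable_gauss_moment)

lemma gint_add: "gint (p + q) = gint p + gint q"
  unfolding gint_def poly_add distrib_right by (intro Bochner_Integration.integral_add integrable_gint)

lemma gint_diff: "gint (p - q) = gint p - gint q"
  unfolding gint_def poly_diff left_diff_distrib by (intro Bochner_Integration.integral_diff integrable_gint)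

lemma gint_smult: "gint (smult a p) = a * gint p"
  unfolding gint_def poly_smult mult.assoc by simp

lemma gint_0 [simp]: "gint 0 = 0" by (simp add: gint_def)

lemma gint_sum: "gint (\<Sum>i\<in>A. f i) = (\<Sum>i\<in>A. gint (f i))"
  by (induction A rule: infinite_finite_induct) (auto simp: gint_add)

lemma gint_mono: "(\<And>x. poly p x \<le> poly q x) \<Longrightarrow> gint p \<le> gint q"
  unfolding gint_def by (intro integral_mono integrable_gint mult_right_mono) auto

lemma gint_nonneg: "(\<And>x. poly p x \<ge> 0) \<Longrightarrow> gint p \<ge> 0"
  using gint_mono[of 0 p] by simp

lemma gint_monom: "gint (monom 1 k) = gauss_moment k"
  by (simp add: gint_def gauss_moment_def poly_monom)

lemma gauss1_cpoly:
  "gauss1 (poly (cpoly p * cpoly q * cpoly r)) = of_real (gint (p * q * r))"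
  unfolding gauss1_def gint_def integral_complex_of_real[symmetric]
  by (simp add: poly_cpoly)

text \<open>In an orthonormal basis the Gram matrix of \<open>w\<close> is the identity, and that of \<open>w h\<close> is positive semidefinite;
  the first gives the constant \<open>Z\<close>, the second the inequality.\<close>

theorem vander_int_bound:
  fixes p :: "nat \<Rightarrow> real poly"
  assumes deg: "\<And>j. j < n \<Longrightarrow> degree (p j) \<le> j"
    and lead: "\<And>j. j < n \<Longrightarrow> coeff (p j) j > 0"
    and orth: "\<And>i j. i < n \<Longrightarrow> j < n \<Longrightarrow> gint (p i * p j * w) = of_bool (i = j)"
    and w: "\<And>x. poly w x \<ge> 0" and h: "\<And>x. poly h x \<ge> 0"
  defines "Z \<equiv> fact n / (\<Prod>j<n. coeff (p j) j)\<^sup>2"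
  shows "Z > 0" "vander_int n (cpoly w) = of_real Z"
    "\<exists>v. vander_int n (cpoly (w * h)) = of_real v \<and> 0 \<le> v \<and>
       v \<le> Z * exp (\<Sum>j<n. gint (p j * p j * (w * h)) - 1)"
proof -
  let ?k = "\<Prod>j<n. coeff (p j) j"
  have kpos: "?k > 0" using lead by (intro prod_pos) auto
  then show "Z > 0" unfolding Z_def by (intro divide_pos_pos zero_less_power fact_gt_zero)
  have V: "of_real (?k\<^sup>2) * vander_int n (cpoly r) =
      fact n * det (mat n n (\<lambda>(i, j). complex_of_real (gint (p i * p j * r))))" for r
  proof -
    have "degree (cpoly (p j)) \<le> j" if "j < n" for j
      using degree_map_poly_le[of of_real "p j"] deg[OF that] by (rule order_trans)
    then show ?thesis
      using andreief[of n "\<lambda>j. cpoly (p j)" "cpoly r"]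
      by (simp add: gauss1_cpoly coeff_map_poly)
  qed
  have V': "vander_int n (cpoly r) =
      of_real Z * det (mat n n (\<lambda>(i, j). complex_of_real (gint (p i * p j * r))))" for r
  proof -
    have "vander_int n (cpoly r) = of_real (?k\<^sup>2) * vander_int n (cpoly r) / of_real (?k\<^sup>2)"
      using less_imp_neq[OF zero_less_power[OF kpos, of 2]]
      by (intro nonzero_mult_div_cancel_left[symmetric]) (simp only: of_real_eq_0_iff not_sym)
    then show ?thesis unfolding V Z_def by simp
  qed
  have "mat n n (\<lambda>(i, j). complex_of_real (gint (p i * p j * w))) = 1\<^sub>m n"
    by (rule eq_matI) (auto simp: orth)
  then show "vander_int n (cpoly w) = of_real Z" unfolding V' by simp
  let ?G = "mat n n (\<lambda>(i, j). complex_of_real (gint (p i * p j * (w * h))))"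
  have herm: "?G \<in> Herm n" by (auto simp: mem_Herm_iff mult.commute[of "p _" "p _"])
  have psd: "Re (\<Sum>i<n. \<Sum>j<n. cnj (v i) * ?G $$ (i, j) * v j) \<ge> 0" for v
  proof -
    have sq: "(\<Sum>i<n. \<Sum>j<n. a i * a j * gint (p i * p j * (w * h))) \<ge> 0" for a :: "nat \<Rightarrow> real"
    proof -
      let ?s = "\<Sum>i<n. smult (a i) (p i)"
      have "(\<Sum>i<n. \<Sum>j<n. a i * a j * gint (p i * p j * (w * h))) = gint (?s * ?s * (w * h))"
        by (subst sum_product, subst sum_distrib_right, subst sum_distrib_right)
          (simp add: gint_sum gint_smult mult.commute[of "a _" "a _"])
      also have "\<dots> \<ge> 0" using w h by (intro gint_nonneg) auto
      finally show ?thesis .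
    qed
    have "Re (\<Sum>i<n. \<Sum>j<n. cnj (v i) * ?G $$ (i, j) * v j) =
        (\<Sum>i<n. \<Sum>j<n. Re (v i) * Re (v j) * gint (p i * p j * (w * h))) +
        (\<Sum>i<n. \<Sum>j<n. Im (v i) * Im (v j) * gint (p i * p j * (w * h)))"
      unfolding Re_sum sum.distrib[symmetric]
      by (intro sum.cong refl) (simp add: algebra_simps)
    with sq[of "\<lambda>i. Re (v i)"] sq[of "\<lambda>i. Im (v i)"] show ?thesis by simp
  qed
  obtain d where d: "det ?G = of_real d" "0 \<le> d" "d \<le> exp (\<Sum>i<n. (Re (?G $$ (i, i)) - 1))"
    using psd_det_le[OF herm psd] by blast
  have "d \<le> exp (\<Sum>j<n. gint (p j * p j * (w * h)) - 1)" using d(3) by simp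
  with d \<open>Z > 0\<close> show "\<exists>v. vander_int n (cpoly (w * h)) = of_real v \<and> 0 \<le> v \<and>
       v \<le> Z * exp (\<Sum>j<n. gint (p j * p j * (w * h)) - 1)"
    by (intro exI[of _ "Z * d"]) (auto simp: V'[of "w * h"])
qed

section \<open>Generalized Hermite polynomials\<close>

text \<open>The off-diagonal entries of the Jacobi matrix of the weight \<open>x\<^sup>2\<^sup>m exp (- x\<^sup>2)\<close>.\<close>

definition jac :: "nat \<Rightarrow> nat \<Rightarrow> real" where
  "jac m j = sqrt (real j / 2 + (if odd j then real m else 0))"

lemma jac_0 [simp]: "jac m 0 = 0" by (simp add: jac_def)

lemma jac_nonneg [simp]: "jac m j \<ge> 0" by (simp add: jac_def)

lemma jac_pos: "j > 0 \<Longrightarrow> jac m j > 0" by (simp add: jac_def add_pos_nonneg)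

lemma jac_sq: "2 * (jac m j)\<^sup>2 = real j + (if odd j then 2 * real m else 0)"
  by (simp add: jac_def field_simps)

abbreviation (input) Xp :: "real poly" where "Xp \<equiv> [:0, 1:]"

text \<open>The orthonormal polynomials of \<open>x\<^sup>2\<^sup>m exp (- x\<^sup>2)\<close>, defined by their three-term recurrence; orthonormality
  is proved below.\<close>

fun herm_poly :: "nat \<Rightarrow> nat \<Rightarrow> real poly" where
  "herm_poly m 0 = [:1 / sqrt (gauss_moment (2 * m)):]"
| "herm_poly m (Suc 0) = smult (1 / jac m 1) (Xp * herm_poly m 0)"
| "herm_poly m (Suc (Suc j)) = smult (1 / jac m (Suc (Suc j)))
     (Xp * herm_poly m (Suc j) - smult (jac m (Suc j)) (herm_poly m j))"

lemma herm_poly_rec: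
  "Xp * herm_poly m j = smult (jac m (Suc j)) (herm_poly m (Suc j)) +
     smult (jac m j) (herm_poly m (j - 1))"
proof (cases j)
  case 0
  then show ?thesis using jac_pos[of 1 m] by simp
next
  case (Suc i)
  then show ?thesis using jac_pos[of "Suc (Suc i)" m] by simp
qed

lemma herm_poly_coeff:
  "degree (herm_poly m j) \<le> j \<and>
   coeff (herm_poly m j) j = 1 / (sqrt (gauss_moment (2 * m)) * (\<Prod>i<j. jac m (Suc i))) \<and>
   (\<forall>k. odd (j + k) \<longrightarrow> coeff (herm_poly m j) k = 0)"
proof (induction j rule: less_induct)
  case (less j)
  consider "j = 0" | i where "j = Suc i" by (cases j) auto
  then show ?case
  proof cases
    case 1
    then show ?thesis by (auto simp: coeff_pCons split: nat.splits)
  next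
    case 2
    let ?q = "Xp * herm_poly m i - smult (jac m i) (herm_poly m (i - 1))"
    have eq: "herm_poly m j = smult (1 / jac m j) ?q"
      using herm_poly_rec[of m i] jac_pos[of j m] 2 by simp
    have IH: "degree (herm_poly m i) \<le> i" "degree (herm_poly m (i - 1)) \<le> i - 1"
      "coeff (herm_poly m i) i = 1 / (sqrt (gauss_moment (2 * m)) * (\<Prod>i<i. jac m (Suc i)))"
      "\<And>k. odd (i + k) \<Longrightarrow> coeff (herm_poly m i) k = 0"
      "\<And>k. odd (i - 1 + k) \<Longrightarrow> coeff (herm_poly m (i - 1)) k = 0"
      using less[of i] less[of "i - 1"] 2 by auto
    have "degree ?q \<le> Suc i" using IH(1,2) by (intro degree_diff_le) (auto simp: degree_pCons_eq_if)
    then have 1: "degree (herm_poly m j) \<le> j"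
      using degree_smult_le[of "1 / jac m j" ?q] by (simp only: eq 2[symmetric])
    have "coeff (herm_poly m (i - 1)) (Suc i) = 0" using IH(2) by (intro coeff_eq_0) auto
    then have lead: "coeff (herm_poly m j) j = 1 / (sqrt (gauss_moment (2 * m)) * (\<Prod>i<j. jac m (Suc i)))"
    proof -
      assume z: "coeff (herm_poly m (i - 1)) (Suc i) = 0"
      have "coeff (herm_poly m j) j = 1 / jac m j * coeff ?q j" by (subst eq) simp
      also have "coeff ?q j = coeff (herm_poly m i) i" using z 2 by simp
      finally show ?thesis using IH(3) 2 by (simp add: mult_ac)
    qed
    have "coeff ?q k = 0" if "odd (j + k)" for k
    proof -
      have "coeff (smult (jac m i) (herm_poly m (i - 1))) k = 0"
        using IH(5)[of k] that 2 by (cases i) auto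
      moreover have "coeff (Xp * herm_poly m i) k = 0"
        using IH(4)[of "k - 1"] that 2 by (cases k) auto
      ultimately show ?thesis by simp
    qed
    then have "\<forall>k. odd (j + k) \<longrightarrow> coeff (herm_poly m j) k = 0" unfolding eq by simp
    with 1 lead show ?thesis by blast
  qed
qed

text \<open>The Dunkl operator \<open>p' + m (p(x) - p(-x)) / x\<close>.  It plays the role that the derivative has for the Hermite
  polynomials (\<open>m = 0\<close>).\<close>

definition dunkl :: "nat \<Rightarrow> real poly \<Rightarrow> real poly" where
  "dunkl m p = pderiv p + smult (real m) (poly_shift 1 (p - pcompose p [:0, -1:]))"

lemma coeff_dunkl: "coeff (dunkl m p) k = 2 * (jac m (Suc k))\<^sup>2 * coeff p (Suc k)"
proof -
  have "coeff (pcompose p [:0, -1:]) i = (-1) ^ i * coeff p i" for i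
  proof (induction p arbitrary: i)
    case (pCons a p)
    then show ?case by (cases i) (auto simp: pcompose_pCons)
  qed simp
  then show ?thesis
    unfolding jac_sq by (auto simp: dunkl_def coeff_pderiv coeff_poly_shift algebra_simps)
qed

lemma dunkl_add: "dunkl m (p + q) = dunkl m p + dunkl m q"
  by (intro poly_eqI) (simp add: coeff_dunkl distrib_left)

lemma dunkl_diff: "dunkl m (p - q) = dunkl m p - dunkl m q"
  by (intro poly_eqI) (simp add: coeff_dunkl right_diff_distrib)

lemma dunkl_smult: "dunkl m (smult a p) = smult a (dunkl m p)"
  by (intro poly_eqI) (simp add: coeff_dunkl)

lemma dunkl_monom: "dunkl m (monom 1 k) = smult (2 * (jac m k)\<^sup>2) (monom 1 (k - 1))"
  by (intro poly_eqI) (cases k; auto simp: coeff_dunkl)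

text \<open>The commutator of the Dunkl operator with multiplication by \<open>X\<close> is \<open>1 + 2 m R\<close> with the reflection
  \<open>R p = p(-x)\<close>.  It acts on \<open>herm_poly m i\<close>, which has the parity of \<open>i\<close>, as a scalar, and that scalar is the
  increment of \<open>2 a\<^sub>i\<^sup>2\<close>.\<close>

lemma dunkl_herm_poly:
  "dunkl m (herm_poly m j) = smult (2 * jac m j) (herm_poly m (j - 1))"
proof (induction j rule: less_induct)
  case (less j)
  show ?case
  proof (cases j)
    case 0
    then show ?thesis by (intro poly_eqI) (simp add: coeff_dunkl coeff_pCons)
  next
    case (Suc i)
    let ?P = "herm_poly m"
    have comm: "dunkl m (Xp * ?P i) = Xp * dunkl m (?P i) +
        smult (2 * (jac m (Suc i))\<^sup>2 - 2 * (jac m i)\<^sup>2) (?P i)"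
    proof (rule poly_eqI)
      fix k
      show "coeff (dunkl m (Xp * ?P i)) k = coeff (Xp * dunkl m (?P i) +
        smult (2 * (jac m (Suc i))\<^sup>2 - 2 * (jac m i)\<^sup>2) (?P i)) k"
      proof (cases "odd (i + k)")
        case True
        then have "coeff (?P i) k = 0" using herm_poly_coeff[of m i] by blast
        then show ?thesis by (cases k) (auto simp: coeff_dunkl)
      next
        case False
        then have "2 * (jac m (Suc k))\<^sup>2 = 2 * (jac m k)\<^sup>2 + (2 * (jac m (Suc i))\<^sup>2 - 2 * (jac m i)\<^sup>2)"
          unfolding jac_sq by auto
        then have "2 * (jac m (Suc k))\<^sup>2 * coeff (?P i) k =
            2 * (jac m k)\<^sup>2 * coeff (?P i) k + (2 * (jac m (Suc i))\<^sup>2 - 2 * (jac m i)\<^sup>2) * coeff (?P i) k"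
          by (simp only: distrib_right)
        then show ?thesis by (cases k) (auto simp: coeff_dunkl)
      qed
    qed
    have IH: "dunkl m (?P i) = smult (2 * jac m i) (?P (i - 1))"
      "dunkl m (?P (i - 1)) = smult (2 * jac m (i - 1)) (?P (i - 1 - 1))"
      using less[of i] less[of "i - 1"] Suc by auto
    have "smult (jac m j) (dunkl m (?P j)) =
        dunkl m (smult (jac m j) (?P j))" by (simp add: dunkl_smult)
    also have "smult (jac m j) (?P j) = Xp * ?P i - smult (jac m i) (?P (i - 1))"
      using herm_poly_rec[of m i] Suc by simp
    also have "dunkl m \<dots> = Xp * smult (2 * jac m i) (?P (i - 1)) +
        smult (2 * (jac m (Suc i))\<^sup>2 - 2 * (jac m i)\<^sup>2) (?P i) -
        smult (jac m i) (smult (2 * jac m (i - 1)) (?P (i - 1 - 1)))"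
      unfolding dunkl_diff comm dunkl_smult IH ..
    also have "\<dots> = smult (jac m j) (smult (2 * jac m j) (?P i))"
    proof (cases i)
      case 0
      then show ?thesis using Suc by (simp add: power2_eq_square)
    next
      case (Suc l)
      have "Xp * smult (2 * jac m i) (?P (i - 1)) =
          smult (2 * jac m i) (Xp * ?P l)" using Suc by simp
      also have "\<dots> = smult (2 * jac m i) (smult (jac m i) (?P i) +
          smult (jac m (i - 1)) (?P (i - 1 - 1)))"
        unfolding herm_poly_rec[of m l] using Suc by simp
      finally have e: "Xp * smult (2 * jac m i) (?P (i - 1)) = \<dots>" .
      show ?thesis unfolding e \<open>j = Suc i\<close>
        by (intro poly_eqI) (simp add: power2_eq_square algebra_simps)
    qed
    finally show ?thesis using jac_pos[of j m] Suc
      by (metis diff_Suc_1 less_irrefl smult_cancel zero_less_Suc)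
  qed
qed

definition wint :: "nat \<Rightarrow> real poly \<Rightarrow> real" where
  "wint m p = gint (p * monom 1 (2 * m))"

lemma wint_add: "wint m (p + q) = wint m p + wint m q"
  by (simp add: wint_def distrib_right gint_add)

lemma wint_diff: "wint m (p - q) = wint m p - wint m q"
  by (simp add: wint_def left_diff_distrib gint_diff)

lemma wint_smult: "wint m (smult a p) = a * wint m p"
  by (simp add: wint_def gint_smult)

lemma wint_sum: "wint m (\<Sum>i\<in>A. f i) = (\<Sum>i\<in>A. wint m (f i))"
  by (simp add: wint_def sum_distrib_right gint_sum)

lemma wint_nonneg: "(\<And>x. poly p x \<ge> 0) \<Longrightarrow> wint m p \<ge> 0"
  unfolding wint_def by (intro gint_nonneg) (simp add: poly_monom)

lemma wint_monom: "wint m (monom 1 k) = gauss_moment (k + 2 * m)"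
  by (simp add: wint_def mult_monom gint_monom)

lemma poly_monom_induct:
  fixes f :: "'a :: comm_semiring_1 poly"
  assumes "\<And>k. Q (monom 1 k)" "\<And>f g. Q f \<Longrightarrow> Q g \<Longrightarrow> Q (f + g)" "\<And>a f. Q f \<Longrightarrow> Q (smult a f)"
  shows "Q f"
proof -
  have 0: "Q 0" using assms(3)[OF assms(1)[of 0], of 0] by simp
  have "Q (\<Sum>i\<in>A. monom (coeff f i) i)" if "finite A" for A
    using that
  proof (induction A rule: finite_induct)
    case (insert i A)
    have "Q (smult (coeff f i) (monom 1 i))" by (rule assms(3)[OF assms(1)])
    then show ?case using insert by (simp add: assms(2) smult_monom)
  qed (simp add: 0)
  from this[of "{..degree f}"] show ?thesis by (simp add: poly_as_sum_of_monoms)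
qed

text \<open>On monomials both sides reduce to the recursion of the Gaussian moments.  If the exponents have different
  parity, exactly one of the two Dunkl factors contributes the summand \<open>2 m\<close>; otherwise the moments vanish.\<close>

lemma dunkl_adjoint:
  "wint m ((2 * Xp * f - dunkl m f) * g) = wint m (f * dunkl m g)"
proof -
  have mon: "wint m ((2 * Xp * monom 1 a - dunkl m (monom 1 a)) * monom 1 b) =
      wint m (monom 1 a * dunkl m (monom 1 b))" for a b
  proof -
    have X: "2 * Xp * monom 1 a = smult 2 (monom 1 (Suc a))"
      by (simp add: monom_Suc numeral_poly)
    have mm: "monom (1::real) i * monom 1 j = monom 1 (i + j)" for i j by (simp add: mult_monom)
    have L: "wint m ((2 * Xp * monom 1 a - dunkl m (monom 1 a)) * monom 1 b) =
        2 * gauss_moment (Suc (a + b + 2 * m)) - 2 * (jac m a)\<^sup>2 * gauss_moment (a - 1 + b + 2 * m)"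
      unfolding X dunkl_monom left_diff_distrib mult_smult_left mm wint_diff wint_smult wint_monom
      by simp
    have R: "wint m (monom 1 a * dunkl m (monom 1 b)) =
        2 * (jac m b)\<^sup>2 * gauss_moment (a + (b - 1) + 2 * m)"
      unfolding dunkl_monom mult_smult_right mm wint_smult wint_monom by simp
    let ?g = "gauss_moment (a + b + 2 * m - 1)"
    have 1: "2 * (jac m a)\<^sup>2 * gauss_moment (a - 1 + b + 2 * m) = 2 * (jac m a)\<^sup>2 * ?g"
      by (cases a) auto
    have 2: "2 * (jac m b)\<^sup>2 * gauss_moment (a + (b - 1) + 2 * m) = 2 * (jac m b)\<^sup>2 * ?g"
      by (cases b) auto
    have 3: "2 * gauss_moment (Suc (a + b + 2 * m)) = real (a + b + 2 * m) * ?g"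
      by (rule gauss_moment_rec)
    have "real (a + b + 2 * m) * ?g = 2 * (jac m a)\<^sup>2 * ?g + 2 * (jac m b)\<^sup>2 * ?g"
    proof (cases "odd (a + b)")
      case True
      then show ?thesis unfolding jac_sq distrib_right[symmetric]
        by (intro arg_cong2[where f = "(*)"]) auto
    next
      case False
      show ?thesis
      proof (cases "a + b + 2 * m = 0")
        case False
        with \<open>\<not> odd (a + b)\<close> have "odd (a + b + 2 * m - 1)" by simp
        then show ?thesis by (simp add: gauss_moment_odd)
      qed simp
    qed
    then show ?thesis unfolding L R 1 2 3 by simp
  qed
  have "\<forall>g. wint m ((2 * Xp * f - dunkl m f) * g) = wint m (f * dunkl m g)"
  proof (induction f rule: poly_monom_induct)
    case (1 a)
    show ?case
    proof
      fix g
      show "wint m ((2 * Xp * monom 1 a - dunkl m (monom 1 a)) * g) = wint m (monom 1 a * dunkl m g)"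
        by (induction g rule: poly_monom_induct)
          (simp_all only: mon distrib_left wint_add dunkl_add dunkl_smult mult_smult_right wint_smult)
    qed
  next
    case (2 f f')
    have "2 * Xp * (f + f') - dunkl m (f + f') = (2 * Xp * f - dunkl m f) + (2 * Xp * f' - dunkl m f')"
      by (simp only: dunkl_add distrib_left add_diff_add)
    with 2 show ?case by (simp only: distrib_right wint_add simp_thms)
  next
    case (3 a f)
    have "2 * Xp * smult a f - dunkl m (smult a f) =
        smult a (2 * Xp * f - dunkl m f)"
      by (simp only: dunkl_smult smult_diff_right mult_smult_right)
    with 3 show ?case by (simp only: mult_smult_left wint_smult simp_thms)
  qed
  then show ?thesis by blast
qed

text \<open>The recurrence says that \<open>2 X p\<^sub>j - T p\<^sub>j\<close> is a multiple of \<open>p\<^sub>j\<^sub>+\<^sub>1\<close>, where \<open>T\<close> is the Dunkl operator.  Moving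
  \<open>T\<close> to the other factor reduces scalar products of \<open>p\<^sub>j\<^sub>+\<^sub>1\<close> to those of \<open>p\<^sub>j\<close>.\<close>

lemma herm_poly_raise:
  "2 * jac m (Suc j) * wint m (herm_poly m (Suc j) * g) = wint m (herm_poly m j * dunkl m g)"
proof -
  have "2 * Xp * herm_poly m j - dunkl m (herm_poly m j) =
      smult 2 (Xp * herm_poly m j) - dunkl m (herm_poly m j)"
    by (simp add: numeral_poly)
  also have "\<dots> = smult (2 * jac m (Suc j)) (herm_poly m (Suc j))"
    unfolding herm_poly_rec dunkl_herm_poly by (simp add: smult_add_right)
  finally show ?thesis
    using dunkl_adjoint[of m "herm_poly m j" g] by (simp only: mult_smult_left wint_smult)
qed

lemma herm_poly_orthonormal: "wint m (herm_poly m i * herm_poly m j) = of_bool (i = j)"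
proof (induction i arbitrary: j)
  have raise0: "wint m (herm_poly m (Suc i) * herm_poly m 0) = 0" for i
    using herm_poly_raise[of m i "herm_poly m 0"] jac_pos[of "Suc i" m]
    unfolding dunkl_herm_poly by (simp add: wint_def)
  {
    case 0
    show ?case
    proof (cases j)
      case 0
      have "herm_poly m 0 * herm_poly m 0 =
          smult ((1 / sqrt (gauss_moment (2 * m)))\<^sup>2) (monom 1 0)"
        by (simp add: power2_eq_square monom_0)
      then have "wint m (herm_poly m 0 * herm_poly m 0) =
          (1 / sqrt (gauss_moment (2 * m)))\<^sup>2 * gauss_moment (2 * m)"
        by (simp only: wint_smult wint_monom add_0)
      then show ?thesis using gauss_moment_even_pos[of m] 0
        by (simp add: power_divide)
    next
      case (Suc i)
      then show ?thesis using raise0[of i]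
        by (simp only: mult.commute[of "herm_poly m 0"]) simp
    qed
  next
    case (Suc i)
    show ?case
    proof (cases j)
      case 0
      then show ?thesis using raise0[of i] by simp
    next
      case (Suc l)
      have "2 * jac m (Suc i) * wint m (herm_poly m (Suc i) * herm_poly m j) =
          2 * jac m (Suc l) * of_bool (i = l)"
        unfolding herm_poly_raise dunkl_herm_poly Suc
        by (simp add: wint_smult Suc.IH)
      then show ?thesis using jac_pos[of "Suc i" m] Suc by (auto split: if_splits)
    qed
  }
qed

subsection \<open>Moments of the squared orthonormal polynomials\<close>

text \<open>The entry at \<open>(j, i)\<close> of the \<open>k\<close>-th power of the Jacobi matrix.\<close>

definition jmom :: "nat \<Rightarrow> nat \<Rightarrow> nat \<Rightarrow> nat \<Rightarrow> real" where
  "jmom m k j i = wint m (monom 1 k * herm_poly m j * herm_poly m i)"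

lemma jmom_0: "jmom m 0 j i = of_bool (j = i)"
  by (simp add: jmom_def monom_0 herm_poly_orthonormal flip: one_pCons)

lemma jmom_Suc:
  "jmom m (Suc k) j i = jac m (Suc j) * jmom m k (Suc j) i + jac m j * jmom m k (j - 1) i"
proof -
  have "monom 1 (Suc k) * herm_poly m j * herm_poly m i =
      monom 1 k * (Xp * herm_poly m j) * herm_poly m i"
    by (simp add: monom_Suc)
  then show ?thesis
    unfolding jmom_def herm_poly_rec
    by (simp add: distrib_left distrib_right wint_add wint_smult)
qed

lemma jmom_commute: "jmom m k j i = jmom m k i j"
  by (simp add: jmom_def mult_ac)

lemma jmom_nonneg: "jmom m k j i \<ge> 0"
  by (induction k arbitrary: j) (auto simp: jmom_0 jmom_Suc)

lemma jmom_eq_0: "i > j + k \<Longrightarrow> jmom m k j i = 0"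
  by (induction k arbitrary: j) (auto simp: jmom_0 jmom_Suc)

lemma jmom_parity: "odd (k + j + i) \<Longrightarrow> jmom m k j i = 0"
proof (induction k arbitrary: j)
  case (Suc k)
  have "jmom m k (Suc j) i = 0" by (rule Suc.IH) (use Suc.prems in simp)
  moreover have "jac m j * jmom m k (j - 1) i = 0"
    using Suc.IH[of "j - 1"] Suc.prems by (cases j) auto
  ultimately show ?case by (simp add: jmom_Suc)
qed (auto simp: jmom_0)

text \<open>The entries of the Jacobi matrix are nonnegative, so bounds for its row sums bound the row sums of its
  powers.  In \<open>k\<close> steps from \<open>j\<close> only the rows below \<open>j + k\<close> are used.\<close>

lemma jmom_row_le:
  assumes "\<And>l. l < L \<Longrightarrow> jac m l + jac m (Suc l) \<le> r" and "r \<ge> 0"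
  shows "j + k \<le> L \<Longrightarrow> (\<Sum>i\<le>N. jmom m k j i) \<le> r ^ k"
proof (induction k arbitrary: j)
  case 0
  have "(\<Sum>i\<le>N. jmom m 0 j i) = (\<Sum>i\<le>N. if i = j then 1 else 0)"
    by (intro sum.cong) (auto simp: jmom_0)
  then show ?case by simp
next
  case (Suc k)
  have "(\<Sum>i\<le>N. jmom m (Suc k) j i) =
      jac m (Suc j) * (\<Sum>i\<le>N. jmom m k (Suc j) i) + jac m j * (\<Sum>i\<le>N. jmom m k (j - 1) i)"
    by (simp add: jmom_Suc sum.distrib sum_distrib_left)
  also have "\<dots> \<le> jac m (Suc j) * r ^ k + jac m j * r ^ k"
    using Suc by (intro add_mono mult_left_mono Suc.IH) auto
  also have "\<dots> = (jac m j + jac m (Suc j)) * r ^ k" by (simp add: algebra_simps)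
  also have "\<dots> \<le> r * r ^ k"
    using assms Suc.prems by (intro mult_right_mono) auto
  finally show ?case by simp
qed

lemma jmom_row_ge:
  assumes "\<And>l. l \<ge> L \<Longrightarrow> jac m l + jac m (Suc l) \<ge> r" and "r \<ge> 0"
  shows "j \<ge> L + k \<Longrightarrow> N \<ge> j + k \<Longrightarrow> (\<Sum>i\<le>N. jmom m k j i) \<ge> r ^ k"
proof (induction k arbitrary: j)
  case 0
  have "(\<Sum>i\<le>N. jmom m 0 j i) = (\<Sum>i\<le>N. if i = j then 1 else 0)"
    by (intro sum.cong) (auto simp: jmom_0)
  with 0 show ?case by simp
next
  case (Suc k)
  have "r * r ^ k \<le> (jac m j + jac m (Suc j)) * r ^ k"
    using assms Suc.prems by (intro mult_right_mono) auto
  also have "\<dots> = jac m (Suc j) * r ^ k + jac m j * r ^ k" by (simp add: algebra_simps)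
  also have "\<dots> \<le> jac m (Suc j) * (\<Sum>i\<le>N. jmom m k (Suc j) i) + jac m j * (\<Sum>i\<le>N. jmom m k (j - 1) i)"
    using Suc.prems by (intro add_mono mult_left_mono Suc.IH) auto
  also have "\<dots> = (\<Sum>i\<le>N. jmom m (Suc k) j i)"
    by (simp add: jmom_Suc sum.distrib sum_distrib_left)
  finally show ?case by simp
qed

text \<open>Cauchy-Schwarz for \<open>x\<^sup>k p\<^sub>j\<close> and the sum of the \<open>p\<^sub>i\<close> with \<open>\<bar>i - j\<bar> \<le> k\<close>.  Their scalar product is the full row
  sum of the \<open>k\<close>-th power, since a path of \<open>k\<close> steps stays in this window; the loss \<open>2 k + 1\<close> does not
  depend on \<open>j\<close>.\<close>

lemma jmom_diag_ge:
  assumes "\<And>l. l \<ge> L \<Longrightarrow> jac m l + jac m (Suc l) \<ge> r" and "r \<ge> 0" and j: "j \<ge> L + k"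
  shows "r ^ (2 * k) / real (2 * k + 1) \<le> jmom m (2 * k) j j"
proof -
  let ?W = "{j - k..j + k}" and ?s = "\<Sum>i\<in>{j - k..j + k}. herm_poly m i"
  let ?q = "monom 1 k * herm_poly m j" and ?S = "\<Sum>i\<in>{j - k..j + k}. jmom m k j i"
  define t where "t = ?S / real (2 * k + 1)"
  have sqr: "(q - smult t s) * (q - smult t s) =
      q * q - smult (2 * t) (q * s) + smult (t * t) (s * s)" for q s
    by (rule poly_eq_poly_eq_iff[THEN iffD1], rule ext) (simp add: algebra_simps)
  have "r ^ k \<le> (\<Sum>i\<le>j + k. jmom m k j i)"
    by (rule jmom_row_ge[OF assms(1,2) j]) auto
  also have "\<dots> = ?S"
  proof (rule sum.mono_neutral_right)
    show "\<forall>i\<in>{..j + k} - ?W. jmom m k j i = 0"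
      by (auto intro: jmom_eq_0 simp: jmom_commute[of m k j])
  qed auto
  finally have S: "r ^ k \<le> ?S" .
  have qq: "wint m (?q * ?q) = jmom m (2 * k) j j"
  proof -
    have mm: "monom (1::real) (2 * k) = monom 1 k * monom 1 k" by (simp add: mult_monom mult_2)
    show ?thesis unfolding jmom_def mm by (simp only: mult_ac)
  qed
  have qs: "wint m (?q * ?s) = ?S" by (simp add: sum_distrib_left wint_sum jmom_def)
  have "wint m (?s * ?s) = (\<Sum>i\<in>?W. \<Sum>l\<in>?W. of_bool (i = l))"
    by (simp add: sum_product wint_sum herm_poly_orthonormal)
  also have "\<dots> = (\<Sum>i\<in>?W. 1)" by (intro sum.cong refl) (simp add: of_bool_def)
  also have "\<dots> = real (2 * k + 1)" using j by simp
  finally have ss: "wint m (?s * ?s) = real (2 * k + 1)" .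
  have "0 \<le> wint m ((?q - smult t ?s) * (?q - smult t ?s))"
    by (intro wint_nonneg) simp
  also have "(?q - smult t ?s) * (?q - smult t ?s) =
      ?q * ?q - smult (2 * t) (?q * ?s) + smult (t * t) (?s * ?s)"
    by (rule sqr)
  also have "wint m \<dots> = jmom m (2 * k) j j - 2 * t * ?S + t * t * real (2 * k + 1)"
    unfolding wint_add wint_diff wint_smult qq qs ss ..
  also have "\<dots> = jmom m (2 * k) j j - ?S\<^sup>2 / real (2 * k + 1)"
  proof -
    have alg: "x - 2 * (s / N) * s + (s / N) * (s / N) * N = x - s\<^sup>2 / N" if "N > 0" for x s N :: real
      using that by (simp add: field_simps power2_eq_square)
    show ?thesis unfolding t_def by (rule alg) simp
  qed
  finally have "?S\<^sup>2 / real (2 * k + 1) \<le> jmom m (2 * k) j j" by simp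
  moreover have "r ^ (2 * k) \<le> ?S\<^sup>2"
    using power_mono[OF S, of 2] \<open>r \<ge> 0\<close> by (simp add: power_mult[symmetric] mult.commute)
  then have "r ^ (2 * k) / real (2 * k + 1) \<le> ?S\<^sup>2 / real (2 * k + 1)" by (simp add: divide_right_mono)
  ultimately show ?thesis by linarith
qed

text \<open>The sum of the entries of index \<open>j\<close> and \<open>j + 1\<close> of the Jacobi matrix lies between \<open>edge j m\<close> and
  \<open>edge (j + 1) m\<close>, whatever the parity of \<open>j\<close>.\<close>

definition edge :: "real \<Rightarrow> real \<Rightarrow> real" where
  "edge s m = sqrt (s / 2) + sqrt (s / 2 + m)"

lemma jac_add_le:
  assumes "real (Suc l) \<le> s"
  shows "jac m l + jac m (Suc l) \<le> edge s (real m)"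
proof (cases "even l")
  case True
  with assms show ?thesis unfolding jac_def edge_def by (intro add_mono) auto
next
  case False
  with assms have "jac m (Suc l) + jac m l \<le> edge s (real m)"
    unfolding jac_def edge_def by (intro add_mono) auto
  then show ?thesis by simp
qed

lemma jac_add_ge:
  assumes "s \<le> real l"
  shows "edge s (real m) \<le> jac m l + jac m (Suc l)"
proof (cases "even l")
  case True
  with assms show ?thesis unfolding jac_def edge_def by (intro add_mono) auto
next
  case False
  with assms have "edge s (real m) \<le> jac m (Suc l) + jac m l"
    unfolding jac_def edge_def by (intro add_mono) auto
  then show ?thesis by simp
qed

text \<open>The integral of \<open>h\<close> with respect to the probability measure \<open>\<nu>\<^sub>j\<close> with density \<open>p\<^sub>j\<^sup>2 x\<^sup>2\<^sup>m exp (- x\<^sup>2)\<close>.\<close>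

definition nu :: "nat \<Rightarrow> nat \<Rightarrow> real poly \<Rightarrow> real" where
  "nu m j h = gint (herm_poly m j * herm_poly m j * (monom 1 (2 * m) * h))"

lemma nu_wint: "nu m j h = wint m (herm_poly m j * herm_poly m j * h)"
  by (simp add: nu_def wint_def mult_ac)

lemma nu_add: "nu m j (p + q) = nu m j p + nu m j q"
  by (simp add: nu_wint distrib_left wint_add)

lemma nu_diff: "nu m j (p - q) = nu m j p - nu m j q"
  by (simp add: nu_wint right_diff_distrib wint_diff)

lemma nu_smult: "nu m j (smult a p) = a * nu m j p"
  by (simp add: nu_wint wint_smult)

lemma nu_sum: "nu m j (\<Sum>i\<in>A. f i) = (\<Sum>i\<in>A. nu m j (f i))"
  by (simp add: nu_wint sum_distrib_left wint_sum)

lemma nu_nonneg: "(\<And>x. poly p x \<ge> 0) \<Longrightarrow> nu m j p \<ge> 0"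
  unfolding nu_wint by (intro wint_nonneg) (simp add: flip: mult.assoc)

lemma nu_monom: "nu m j (monom 1 k) = jmom m k j j"
  by (simp add: nu_wint jmom_def mult_ac)

lemma nu_1: "nu m j 1 = 1"
  using nu_monom[of m j 0] by (simp add: jmom_0 monom_0 flip: one_pCons)

lemma nu_monom_odd: "odd k \<Longrightarrow> nu m j (monom 1 k) = 0"
  by (simp add: nu_monom jmom_parity)

lemma nu_monom_le:
  assumes "j < n"
  shows "nu m j (monom 1 k) \<le> edge (real (n + k)) (real m) ^ k"
proof -
  have "jmom m k j j \<le> (\<Sum>i\<le>j. jmom m k j i)"
    by (intro member_le_sum) (auto simp: jmom_nonneg)
  also have "\<dots> \<le> edge (real (n + k)) (real m) ^ k"
    using assms by (intro jmom_row_le[of "n + k"] jac_add_le) (auto simp: edge_def)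
  finally show ?thesis by (simp add: nu_monom)
qed

lemma nu_monom_ge:
  assumes "L + k \<le> j"
  shows "edge (real L) (real m) ^ (2 * k) / real (2 * k + 1) \<le> nu m j (monom 1 (2 * k))"
  unfolding nu_monom using assms
  by (intro jmom_diag_ge[of L] jac_add_ge) (auto simp: edge_def)

subsection \<open>Normalizing constants\<close>

definition zconst :: "nat \<Rightarrow> nat \<Rightarrow> real" where
  "zconst n m = fact n / (\<Prod>j<n. coeff (herm_poly m j) j)\<^sup>2"

text \<open>The squared norm of the monic orthogonal polynomial of degree \<open>j\<close>.\<close>

definition hnorm :: "nat \<Rightarrow> nat \<Rightarrow> real" where
  "hnorm m j = gauss_moment (2 * m) * (\<Prod>i<j. (jac m (Suc i))\<^sup>2)"

lemma hnorm_pos: "hnorm m j > 0"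
  unfolding hnorm_def
  by (intro mult_pos_pos gauss_moment_even_pos prod_pos ballI zero_less_power jac_pos) simp

lemma herm_poly_lead: "(coeff (herm_poly m j) j)\<^sup>2 = 1 / hnorm m j"
proof -
  have "(sqrt (gauss_moment (2 * m)))\<^sup>2 = gauss_moment (2 * m)"
    using gauss_moment_even_pos[of m] by simp
  then show ?thesis
    using herm_poly_coeff[of m j] by (simp add: hnorm_def power_divide power_mult_distrib prod_power_distrib)
qed

lemma zconst_hnorm: "zconst n m = fact n * (\<Prod>j<n. hnorm m j)"
  by (simp add: zconst_def prod_power_distrib herm_poly_lead prod_dividef)

text \<open>Apart from the Gaussian moment, passing from \<open>m\<close> to \<open>m + 1\<close> changes only the factors of odd index, whose
  quotients telescope.\<close>

lemma hnorm_Suc: "hnorm (Suc m) j = (real m + 1 / 2 + real ((j + 1) div 2)) * hnorm m j"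
proof (induction j)
  case 0
  show ?case using gauss_moment_Suc_Suc[of "2 * m"] by (simp add: hnorm_def field_simps)
next
  case (Suc j)
  have step: "hnorm m (Suc j) = hnorm m j * (jac m (Suc j))\<^sup>2" for m
    by (simp add: hnorm_def)
  have j2: "(jac m i)\<^sup>2 = real i / 2 + (if odd i then real m else 0)" for m i
    using jac_sq[of m i] by auto
  show ?case
  proof (cases "even j")
    case True
    then obtain t where "j = 2 * t" by (elim evenE)
    then show ?thesis unfolding step Suc j2 by (simp add: field_simps)
  next
    case False
    then obtain t where "j = 2 * t + 1" by (elim oddE)
    then show ?thesis unfolding step Suc j2 by (simp add: field_simps)
  qed
qed

text \<open>Log-convexity gives the opposite estimate with constant \<open>1\<close>; here the second quotient in \<open>m\<close> of each factor
  is at most \<open>((j + 2) / (j + 1))\<^sup>2\<close>, and these bounds telescope.\<close>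

lemma zconst_ratio: "zconst n m * zconst n (m + 2) \<le> (real n + 1)\<^sup>2 * (zconst n (m + 1))\<^sup>2"
proof -
  have tele: "(\<Prod>j<n. (real j + 2) / (real j + 1)) = real n + 1"
    by (induction n) (auto simp: field_simps)
  have ind: "hnorm m j * hnorm (m + 2) j \<le> ((real j + 2) / (real j + 1))\<^sup>2 * (hnorm (m + 1) j)\<^sup>2" for j
  proof -
    let ?s = "real m + 1 / 2 + real ((j + 1) div 2)"
    have "2 * ((j + 1) div 2) \<ge> j" by linarith
    then have "real j \<le> 2 * real ((j + 1) div 2)" by linarith
    then have s: "?s \<ge> (real j + 1) / 2" by simp
    then have spos: "?s > 0" by (smt (verit) divide_pos_pos of_nat_0_le_iff)
    have a: "(real j + 1) * (?s + 1) \<le> (real j + 3) * ?s" using s by (simp add: algebra_simps)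
    have "(?s + 1) * (real j + 1)\<^sup>2 = ((real j + 1) * (?s + 1)) * (real j + 1)"
      by (simp add: power2_eq_square)
    also have "\<dots> \<le> ((real j + 3) * ?s) * (real j + 1)"
      using a by (rule mult_right_mono) simp
    also have "\<dots> = ((real j + 3) * (real j + 1)) * ?s" by (simp only: mult_ac)
    also have "\<dots> \<le> (real j + 2)\<^sup>2 * ?s"
      using spos by (intro mult_right_mono) (auto simp: power2_eq_square algebra_simps)
    finally have "?s + 1 \<le> ((real j + 2) / (real j + 1))\<^sup>2 * ?s"
      by (simp add: power_divide pos_le_divide_eq)
    then have "?s * (?s + 1) * (hnorm m j)\<^sup>2 \<le> (((real j + 2) / (real j + 1))\<^sup>2 * ?s) * ?s * (hnorm m j)\<^sup>2"
      using spos by (intro mult_right_mono) (auto simp: mult.commute)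
    moreover have h1: "hnorm (m + 1) j = ?s * hnorm m j" using hnorm_Suc[of m j] by simp
    moreover have "hnorm (m + 2) j = (?s + 1) * hnorm (m + 1) j"
      using hnorm_Suc[of "Suc m" j] by (simp add: add_ac)
    ultimately show ?thesis by (simp only: power2_eq_square mult_ac)
  qed
  have "(\<Prod>j<n. hnorm m j * hnorm (m + 2) j) \<le>
      (\<Prod>j<n. ((real j + 2) / (real j + 1))\<^sup>2 * (hnorm (m + 1) j)\<^sup>2)"
    using ind hnorm_pos by (intro prod_mono) (auto intro: less_imp_le)
  also have "\<dots> = (real n + 1)\<^sup>2 * (\<Prod>j<n. hnorm (m + 1) j)\<^sup>2"
    by (simp add: prod.distrib prod_power_distrib[symmetric] tele)
  finally show ?thesis
    unfolding zconst_hnorm by (simp add: prod.distrib power_mult_distrib power2_eq_square[of "fact n :: real"] algebra_simps)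
qed

text \<open>The expectation bound for an integer exponent: dividing the last line by the second bounds the
  expectation of \<open>\<Prod> h(\<lambda>\<^sub>i)\<close>.\<close>

theorem vander_int_herm:
  shows "zconst n m > 0" "vander_int n (cpoly (monom 1 (2 * m))) = of_real (zconst n m)"
    "(\<And>x. poly h x \<ge> 0) \<Longrightarrow> \<exists>v. vander_int n (cpoly (monom 1 (2 * m) * h)) = of_real v \<and> 0 \<le> v \<and>
       v \<le> zconst n m * exp (\<Sum>j<n. nu m j h - 1)"
proof -
  have d: "degree (herm_poly m j) \<le> j" for j using herm_poly_coeff[of m j] by blast
  have l: "coeff (herm_poly m j) j > 0" for j
  proof -
    have "(\<Prod>i<j. jac m (Suc i)) > 0" by (intro prod_pos) (auto intro: jac_pos)
    then show ?thesis using herm_poly_coeff[of m j] gauss_moment_even_pos[of m] by simp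
  qed
  have o: "gint (herm_poly m i * herm_poly m j * monom 1 (2 * m)) = of_bool (i = j)" for i j
    using herm_poly_orthonormal[of m i j] by (simp add: wint_def)
  have w: "poly (monom 1 (2 * m)) x \<ge> (0::real)" for x by (simp add: poly_monom)
  note * = vander_int_bound[where n = n and p = "herm_poly m" and w = "monom 1 (2 * m)", OF d l o w, folded zconst_def]
  show "zconst n m > 0" "vander_int n (cpoly (monom 1 (2 * m))) = of_real (zconst n m)"
    using *(1,2)[of 1] by simp_all
  show "\<exists>v. vander_int n (cpoly (monom 1 (2 * m) * h)) = of_real v \<and> 0 \<le> v \<and>
       v \<le> zconst n m * exp (\<Sum>j<n. nu m j h - 1)" if "\<And>x. poly h x \<ge> 0"
    using *(3)[OF that] by (simp add: nu_def)
qed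

section \<open>Expectations of spectral products\<close>

definition spec_real :: "nat \<Rightarrow> real poly \<Rightarrow> complex mat \<Rightarrow> real" where
  "spec_real n h A = (\<Prod>i<n. poly h (eigs n A i))"

lemma spec_prod_cpoly: "spec_prod n (cpoly h) A = of_real (spec_real n h A)"
  by (simp add: spec_prod_def spec_real_def poly_cpoly)

lemma spec_real_mult: "spec_real n (p * q) A = spec_real n p A * spec_real n q A"
  by (simp add: spec_real_def prod.distrib)

lemma spec_real_nonneg: "(\<And>x. poly h x \<ge> 0) \<Longrightarrow> spec_real n h A \<ge> 0"
  by (simp add: spec_real_def prod_nonneg)

lemma spec_real_monom: "spec_real n (monom 1 (2 * k)) A = ((\<Prod>i<n. eigs n A i)\<^sup>2) ^ k"
  by (simp add: spec_real_def poly_monom prod_power_distrib power_mult[symmetric] flip: power_mult)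

lemma cmod_det_Herm: "A \<in> Herm n \<Longrightarrow> cmod (det A) = \<bar>\<Prod>i<n. eigs n A i\<bar>"
  using is_spectrum_eigs[of A n] by (simp add: is_spectrum_def del: of_real_prod)

subsection \<open>Measurability\<close>

lemma space_herm_borel: "space (herm_borel n) = Herm n"
  by (simp add: herm_borel_def)

lemma measurable_herm_entry:
  assumes "i < n" "j < n"
  shows "(\<lambda>A. A $$ (i, j)) \<in> borel_measurable (herm_borel n)"
proof -
  let ?P = "\<Pi>\<^sub>M p\<in>{..<n} \<times> {..<n}. (borel :: complex measure)"
  have "(\<lambda>A. \<lambda>p\<in>{..<n} \<times> {..<n}. A $$ p) \<in> herm_borel n \<rightarrow>\<^sub>M ?P"
    unfolding herm_borel_def by (rule measurable_vimage_algebra1) (auto simp: space_PiM)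
  moreover have "(\<lambda>f. f (i, j)) \<in> ?P \<rightarrow>\<^sub>M borel"
    using assms by (intro measurable_component_singleton) auto
  ultimately have "(\<lambda>A. (\<lambda>p\<in>{..<n} \<times> {..<n}. A $$ p) (i, j)) \<in> herm_borel n \<rightarrow>\<^sub>M borel"
    by (rule measurable_compose)
  with assms show ?thesis by simp
qed

lemma measurable_herm_fpow:
  "i < n \<Longrightarrow> j < n \<Longrightarrow> (\<lambda>A. fpow n (entry A) k i j) \<in> borel_measurable (herm_borel n)"
  by (induction k arbitrary: i)
    (auto intro!: borel_measurable_sum borel_measurable_times measurable_herm_entry)

text \<open>The eigenvalues were chosen arbitrarily, but a symmetric polynomial in them is a polynomial in the entries.\<close>

lemma measurable_spec_prod: "spec_prod n Q \<in> borel_measurable (herm_borel n)"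
proof -
  obtain L where L: "\<And>A. A \<in> Herm n \<Longrightarrow>
      spec_prod n Q A = (\<Sum>(a, ms)\<leftarrow>L. a * pprod (\<lambda>k A. ftrace n (entry A) k) ms A)"
    by (rule spec_prod_traces[of n Q]) blast
  have t: "(\<lambda>A. ftrace n (entry A) k) \<in> borel_measurable (herm_borel n)" for k
    unfolding ftrace_def by (intro borel_measurable_sum measurable_herm_fpow) auto
  have p: "pprod (\<lambda>k A. ftrace n (entry A) k) ms \<in> borel_measurable (herm_borel n)" for ms
  proof (induction ms)
    case (Cons m ms)
    have "pprod (\<lambda>k A. ftrace n (entry A) k) (m # ms) =
        (\<lambda>A. ftrace n (entry A) m * pprod (\<lambda>k A. ftrace n (entry A) k) ms A)" by auto
    then show ?case by (simp only:) (intro borel_measurable_times t Cons)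
  qed (simp add: pprod_def[abs_def])
  have "(\<lambda>A. \<Sum>(a, ms)\<leftarrow>L. a * pprod (\<lambda>k A. ftrace n (entry A) k) ms A) \<in> borel_measurable (herm_borel n)"
    by (induction L) (auto intro!: borel_measurable_add borel_measurable_times p)
  then show ?thesis
    by (rule measurable_cong[THEN iffD1, rotated]) (simp add: space_herm_borel L)
qed

lemma measurable_spec_real [measurable]: "spec_real n h \<in> borel_measurable (herm_borel n)"
proof -
  have "(\<lambda>A. Re (spec_prod n (cpoly h) A)) \<in> borel_measurable (herm_borel n)"
    using measurable_spec_prod[of n "cpoly h"] by measurable
  then show ?thesis by (simp add: spec_prod_cpoly)
qed

lemma herm_weight_spec:
  assumes "A \<in> Herm n" "\<mu> > 0"
  shows "herm_weight \<mu> A = spec_real n (monom 1 2) A powr \<mu> * exp (- Re (mat_trace (A * A)))"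
proof -
  have "\<bar>d\<bar> powr (2 * \<mu>) = (d\<^sup>2) powr \<mu>" for d :: real
  proof (cases "d = 0")
    case False
    then have "d\<^sup>2 = \<bar>d\<bar> powr 2" by simp
    then show ?thesis by (simp only: powr_powr)
  qed simp
  then show ?thesis
    using spec_real_monom[of n 1 A] by (simp add: herm_weight_def cmod_det_Herm[OF assms(1)])
qed

lemma measurable_herm_weight:
  assumes "\<mu> > 0"
  shows "herm_weight \<mu> \<in> borel_measurable (herm_borel n)"
proof -
  have "(\<lambda>A. \<Sum>i<n. \<Sum>j<n. A $$ (i, j) * A $$ (j, i)) \<in> borel_measurable (herm_borel n)"
    by (intro borel_measurable_sum borel_measurable_times measurable_herm_entry) auto
  then have [measurable]: "(\<lambda>A. mat_trace (A * A)) \<in> borel_measurable (herm_borel n)"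
    by (rule measurable_cong[THEN iffD1, rotated])
      (auto simp: space_herm_borel Herm_def mat_trace_def scalar_prod_def atLeast0LessThan)
  have "(\<lambda>A. spec_real n (monom 1 2) A powr \<mu> * exp (- Re (mat_trace (A * A)))) \<in>
      borel_measurable (herm_borel n)" by measurable
  then show ?thesis
    by (rule measurable_cong[THEN iffD1, rotated]) (simp add: space_herm_borel herm_weight_spec assms)
qed

subsection \<open>Integrals against the Lebesgue measure on Hermitian matrices\<close>

abbreviation (input) coords :: "nat \<Rightarrow> (nat \<times> nat \<Rightarrow> real) measure" where
  "coords n \<equiv> \<Pi>\<^sub>M p\<in>{..<n} \<times> {..<n}. lborel"

definition gwt :: "nat \<Rightarrow> (nat \<times> nat \<Rightarrow> real) \<Rightarrow> real" where
  "gwt n c = exp (- (\<Sum>p\<in>{..<n} \<times> {..<n}. (c p)\<^sup>2))"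

lemma gwt_pos: "gwt n c > 0" by (simp add: gwt_def)

lemma trace_herm_of: "exp (- Re (mat_trace (herm_of n c * herm_of n c))) = gwt n c"
  unfolding gwt_def herm_of_isometry Re_complex_of_real by (simp add: power2_eq_square)

text \<open>The constant in the polynomial Weyl formula.\<close>

definition vander_ratio :: "nat \<Rightarrow> real" where
  "vander_ratio n = (\<Prod>p\<in>{..<n} \<times> {..<n}. gauss_moment 0) / zconst n 0"

lemma vander_ratio_pos: "vander_ratio n > 0"
  unfolding vander_ratio_def using vander_int_herm(1)[of n 0] gauss_moment_even_pos[of 0]
  by (intro divide_pos_pos prod_pos) auto

lemma spec_real_integral:
  assumes "vander_int n (cpoly h) = of_real v"
  shows "integrable (coords n) (\<lambda>c. spec_real n h (herm_of n c) * gwt n c)"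
    and "(\<integral>c. spec_real n h (herm_of n c) * gwt n c \<partial>coords n) = vander_ratio n * v"
proof -
  let ?I = "{..<n} \<times> {..<n}"
  let ?f = "\<lambda>c. spec_real n h (herm_of n c) * gwt n c"
  have eq: "spec_prod n (cpoly h) (herm_of n c) * of_real (exp (- (\<Sum>i\<in>?I. (c i)\<^sup>2))) = of_real (?f c)" for c
    by (simp add: spec_prod_cpoly gwt_def)
  have "gauss_integrable ?I (\<lambda>c. spec_prod n (cpoly h) (herm_of n c))"
    by (intro polyf_gauss_integrable polyf_spec_prod) simp
  then have i: "integrable (coords n) (\<lambda>c. complex_of_real (?f c))"
    unfolding gauss_integrable_def eq .
  then show "integrable (coords n) ?f" using integrable_Re[OF i] by simp
  have "gauss_int ?I (\<lambda>c. spec_prod n (cpoly h) (herm_of n c)) = of_real (integral\<^sup>L (coords n) ?f)"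
    unfolding gauss_int_def eq by (rule integral_complex_of_real)
  moreover have "gauss_int ?I (\<lambda>c. 1) = of_real (\<Prod>p\<in>?I. gauss_moment 0)"
    using gauss_int_monomial(2)[of ?I 1 "\<lambda>_. 0"] by simp
  moreover have "vander_int n 1 = of_real (zconst n 0)"
    using vander_int_herm(2)[of n 0] by (simp add: monom_0 flip: one_pCons)
  ultimately have "complex_of_real (integral\<^sup>L (coords n) ?f * zconst n 0) = of_real (v * (\<Prod>p\<in>?I. gauss_moment 0))"
    using integral_spec_prod[of n "cpoly h"] assms by (simp only: of_real_mult)
  then have "integral\<^sup>L (coords n) ?f * zconst n 0 = v * (\<Prod>p\<in>?I. gauss_moment 0)"
    by (simp only: of_real_eq_iff)
  then show "(\<integral>c. ?f c \<partial>coords n) = vander_ratio n * v"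
    using vander_int_herm(1)[of n 0] by (simp add: vander_ratio_def field_simps)
qed

lemma spec_real_monom_integral:
  "integrable (coords n) (\<lambda>c. spec_real n (monom 1 (2 * k)) (herm_of n c) * gwt n c)"
  "(\<integral>c. spec_real n (monom 1 (2 * k)) (herm_of n c) * gwt n c \<partial>coords n) = vander_ratio n * zconst n k"
  using spec_real_integral[OF vander_int_herm(2)] by auto

lemma powr_frac_le:
  fixes Y :: real assumes "Y \<ge> 0" "0 \<le> t" "t \<le> 1"
  shows "Y powr t \<le> 1 + Y"
proof (cases "Y \<ge> 1")
  case True
  then have "Y powr t \<le> Y powr 1" using assms by (intro powr_mono) auto
  with True show ?thesis by simp
next
  case False
  with assms have "Y powr t \<le> 1" by (intro powr_le1) auto
  with assms show ?thesis by simp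
qed

text \<open>A polynomial lower bound for a fractional power: for \<open>Y \<le> T\<close> already \<open>Y / T\<close> is one, and for \<open>Y > T\<close> the
  left-hand side is negative.\<close>

lemma powr_frac_ge:
  fixes Y :: real assumes "Y \<ge> 0" "0 \<le> t" "t \<le> 1" "T \<ge> 1"
  shows "Y / T - Y\<^sup>2 / T\<^sup>2 \<le> Y powr t"
proof (cases "Y \<le> T \<and> Y > 0")
  case True
  then have Y: "Y > 0" "Y \<le> T" by auto
  have "Y / T \<le> Y powr t"
  proof (cases "Y \<ge> 1")
    case True
    then have "1 \<le> Y powr t" using assms by (simp add: ge_one_powr_ge_zero)
    moreover have "Y / T \<le> 1" using Y by simp
    ultimately show ?thesis by linarith
  next
    case False
    have "Y / T \<le> Y" using Y assms by (simp add: divide_le_eq)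
    also have "Y = Y powr 1" using Y by simp
    also have "\<dots> \<le> Y powr t" using Y False assms by (intro powr_mono') auto
    finally show ?thesis .
  qed
  moreover have "Y\<^sup>2 / T\<^sup>2 \<ge> 0" by simp
  ultimately show ?thesis by linarith
next
  case False
  show ?thesis
  proof (cases "Y = 0")
    case False
    with \<open>\<not> (Y \<le> T \<and> Y > 0)\<close> assms have "Y > T" by auto
    then have "1 \<le> Y / T" using assms by simp
    then have "Y / T * 1 \<le> Y / T * (Y / T)" using assms by (intro mult_left_mono) auto
    then have "Y / T \<le> Y\<^sup>2 / T\<^sup>2" by (simp add: power2_eq_square)
    then show ?thesis by (smt (verit) powr_ge_zero)
  qed simp
qed

text \<open>Write \<open>\<mu> = m + t\<close> with \<open>0 \<le> t \<le> 1\<close> and \<open>det(x)\<^sup>2 = k Y\<close>, where \<open>k\<close> is the mean of \<open>det(x)\<^sup>2\<close> for the exponent \<open>m\<close>,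
  so that \<open>Y\<close> has mean \<open>1\<close> for this exponent.  In the numerator \<open>Y\<^sup>t \<le> 1 + Y\<close> produces the laws with
  exponents \<open>m\<close> and \<open>m + 1\<close>.  In the normalizing constant \<open>Y\<^sup>t \<ge> Y / T - Y\<^sup>2 / T\<^sup>2\<close> loses only a factor \<open>2 T\<close>,
  because the second moment of \<open>Y\<close> is at most \<open>(n + 1)\<^sup>2 = T / 2\<close> by \<open>zconst_ratio\<close>.\<close>

theorem herm_measure_spec_real_le:
  fixes \<mu> :: real
  assumes \<mu>: "\<mu> > 0" and h: "\<And>x. poly h x \<ge> 0"
  defines "m \<equiv> nat \<lfloor>\<mu>\<rfloor>"
  shows "(\<integral>\<^sup>+A. ennreal (spec_real n h A) \<partial>herm_measure n \<mu>) \<le>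
    ennreal (4 * (real n + 1)\<^sup>2 * (exp (\<Sum>j<n. nu m j h - 1) + exp (\<Sum>j<n. nu (m + 1) j h - 1)))"
proof -
  let ?K = "vander_ratio n" and ?Z = "zconst n"
  define t where "t = \<mu> - real m"
  define k where "k = ?Z (m + 1) / ?Z m"
  define T where "T = 2 * (real n + 1)\<^sup>2"
  define D where "D = (\<lambda>c. spec_real n h (herm_of n c))"
  define Y where "Y = (\<lambda>c. spec_real n (monom 1 2) (herm_of n c))"
  have t: "0 \<le> t" "t \<le> 1" using \<mu> by (auto simp: t_def m_def) linarith+
  have Zpos: "?Z i > 0" for i by (rule vander_int_herm(1))
  have k: "k > 0" by (simp add: k_def Zpos)
  have T: "T \<ge> 1" unfolding T_def by (simp add: power2_eq_square algebra_simps)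
  have Y: "Y c \<ge> 0" for c unfolding Y_def by (intro spec_real_nonneg) (simp add: poly_monom)
  have D: "D c \<ge> 0" for c unfolding D_def by (intro spec_real_nonneg h)
  have Ypow: "Y c ^ i = spec_real n (monom 1 (2 * i)) (herm_of n c)" for c i
    using spec_real_monom[of n 1 "herm_of n c"] spec_real_monom[of n i "herm_of n c"] by (simp add: Y_def)
  have weight: "herm_weight \<mu> (herm_of n c) = k powr t * (Y c ^ m * (Y c / k) powr t) * gwt n c" for c
  proof -
    have "Y c powr \<mu> = k powr t * (Y c ^ m * (Y c / k) powr t)"
    proof (cases "Y c = 0")
      case False
      then have Yp: "Y c > 0" using Y[of c] by simp
      have "Y c powr \<mu> = Y c powr (real m + t)" by (simp add: t_def)
      also have "\<dots> = Y c ^ m * Y c powr t" using Yp by (simp add: powr_add powr_realpow)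
      also have "Y c powr t = k powr t * (Y c / k) powr t"
        using Yp k by (simp add: powr_mult[symmetric])
      finally show ?thesis by simp
    qed simp
    then show ?thesis
      using herm_weight_spec[OF herm_of_Herm \<mu>, of n c] by (simp add: trace_herm_of Y_def)
  qed
  obtain v0 where v0: "vander_int n (cpoly (monom 1 (2 * m) * h)) = of_real v0" "0 \<le> v0"
    "v0 \<le> ?Z m * exp (\<Sum>j<n. nu m j h - 1)" using vander_int_herm(3)[OF h] by blast
  obtain v1 where v1: "vander_int n (cpoly (monom 1 (2 * (m + 1)) * h)) = of_real v1" "0 \<le> v1"
    "v1 \<le> ?Z (m + 1) * exp (\<Sum>j<n. nu (m + 1) j h - 1)" using vander_int_herm(3)[OF h] by blast
  have i0: "integrable (coords n) (\<lambda>c. Y c ^ m * D c * gwt n c)"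
    "(\<integral>c. Y c ^ m * D c * gwt n c \<partial>coords n) = ?K * v0"
    using spec_real_integral[OF v0(1)] by (simp_all add: spec_real_mult Ypow D_def)
  have i1: "integrable (coords n) (\<lambda>c. Y c ^ (m + 1) * D c * gwt n c)"
    "(\<integral>c. Y c ^ (m + 1) * D c * gwt n c \<partial>coords n) = ?K * v1"
    using spec_real_integral[OF v1(1)] by (simp_all only: spec_real_mult Ypow D_def)
  have j: "integrable (coords n) (\<lambda>c. Y c ^ i * gwt n c)"
    "(\<integral>c. Y c ^ i * gwt n c \<partial>coords n) = ?K * ?Z i" for i
    using spec_real_monom_integral[where k = i and n = n] by (simp_all add: Ypow)
  have hj: "has_bochner_integral (coords n) (\<lambda>c. Y c ^ i * gwt n c) (?K * ?Z i)" for i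
    using j[of i] by (simp only: has_bochner_integral_iff simp_thms)
  have hi: "has_bochner_integral (coords n) (\<lambda>c. Y c ^ m * D c * gwt n c) (?K * v0)"
    "has_bochner_integral (coords n) (\<lambda>c. Y c ^ (m + 1) * D c * gwt n c) (?K * v1)"
    using i0 i1 by (simp_all only: has_bochner_integral_iff simp_thms)
  have hm: "herm_weight \<mu> \<in> borel_measurable (herm_borel n)" by (rule measurable_herm_weight[OF \<mu>])
  have const: "herm_const n \<mu> = (\<integral>c. herm_weight \<mu> (herm_of n c) \<partial>coords n)"
    unfolding herm_const_def herm_lebesgue_def by (rule integral_distr[OF herm_of_measurable hm])
  let ?lo = "\<lambda>c. k powr t * (1 / (k * T)) * (Y c ^ (m + 1) * gwt n c) -
      k powr t * (1 / (k * T)\<^sup>2) * (Y c ^ (m + 2) * gwt n c)"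
  let ?up = "\<lambda>c. k powr t * (Y c ^ m * gwt n c) + k powr t * (1 / k) * (Y c ^ (m + 1) * gwt n c)"
  have lo: "?lo c \<le> herm_weight \<mu> (herm_of n c)" for c
  proof -
    have "Y c / k / T - (Y c / k)\<^sup>2 / T\<^sup>2 \<le> (Y c / k) powr t"
      using Y[of c] k t T by (intro powr_frac_ge) auto
    then have "k powr t * (Y c ^ m * (Y c / k / T - (Y c / k)\<^sup>2 / T\<^sup>2)) * gwt n c \<le>
        k powr t * (Y c ^ m * (Y c / k) powr t) * gwt n c"
      using Y[of c] gwt_pos[of n c] by (intro mult_right_mono mult_left_mono) auto
    moreover have "k powr t * (Y c ^ m * (Y c / k / T - (Y c / k)\<^sup>2 / T\<^sup>2)) * gwt n c = ?lo c"
      using k T by (simp add: power_add power2_eq_square algebra_simps)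
    ultimately show ?thesis unfolding weight by simp
  qed
  have up: "herm_weight \<mu> (herm_of n c) \<le> ?up c" for c
  proof -
    have "(Y c / k) powr t \<le> 1 + Y c / k" using Y[of c] k t by (intro powr_frac_le) auto
    then have "k powr t * (Y c ^ m * (Y c / k) powr t) * gwt n c \<le>
        k powr t * (Y c ^ m * (1 + Y c / k)) * gwt n c"
      using Y[of c] gwt_pos[of n c] by (intro mult_right_mono mult_left_mono) auto
    also have "\<dots> = ?up c" using k by (simp add: algebra_simps)
    finally show ?thesis unfolding weight .
  qed
  have wnn: "herm_weight \<mu> A \<ge> 0" for A by (simp add: herm_weight_def)
  have int_w: "integrable (coords n) (\<lambda>c. herm_weight \<mu> (herm_of n c))"
  proof (rule Bochner_Integration.integrable_bound)
    show "integrable (coords n) ?up" by (intro Bochner_Integration.integrable_add integrable_mult_right j)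
    show "(\<lambda>c. herm_weight \<mu> (herm_of n c)) \<in> borel_measurable (coords n)"
      using measurable_compose[OF herm_of_measurable hm] .
    show "AE c in coords n. norm (herm_weight \<mu> (herm_of n c)) \<le> norm (?up c)"
      using up wnn by (intro AE_I2) (smt (verit) real_norm_def)
  qed
  have "?K * ?Z m * k powr t / (2 * T) \<le> (\<integral>c. ?lo c \<partial>coords n)"
  proof -
    have "(\<integral>c. ?lo c \<partial>coords n) = k powr t * (1 / (k * T)) * (?K * ?Z (m + 1)) -
        k powr t * (1 / (k * T)\<^sup>2) * (?K * ?Z (m + 2))"
      by (intro has_bochner_integral_integral_eq has_bochner_integral_diff has_bochner_integral_mult_right hj)
    also have "\<dots> = ?K * ?Z m * k powr t * (1 / T - (?Z m * ?Z (m + 2) / (?Z (m + 1))\<^sup>2) / T\<^sup>2)"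
      using Zpos[of m] Zpos[of "m + 1"] by (simp add: k_def power2_eq_square field_simps)
    finally have e: "(\<integral>c. ?lo c \<partial>coords n) = \<dots>" .
    have "?Z m * ?Z (m + 2) / (?Z (m + 1))\<^sup>2 \<le> T / 2"
      using zconst_ratio[of n m] Zpos[of "m + 1"] by (simp add: T_def pos_divide_le_eq)
    then have "(?Z m * ?Z (m + 2) / (?Z (m + 1))\<^sup>2) / T\<^sup>2 \<le> (T / 2) / T\<^sup>2"
      by (rule divide_right_mono) simp
    also have "(T / 2) / T\<^sup>2 = 1 / (2 * T)" using T by (simp add: power2_eq_square)
    finally have "1 / (2 * T) \<le> 1 / T - (?Z m * ?Z (m + 2) / (?Z (m + 1))\<^sup>2) / T\<^sup>2" by simp
    then have "?K * ?Z m * k powr t * (1 / (2 * T)) \<le>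
        ?K * ?Z m * k powr t * (1 / T - (?Z m * ?Z (m + 2) / (?Z (m + 1))\<^sup>2) / T\<^sup>2)"
      using vander_ratio_pos[of n] Zpos[of m] k by (intro mult_left_mono) auto
    then show ?thesis unfolding e by simp
  qed
  also have "\<dots> \<le> herm_const n \<mu>"
    unfolding const by (intro integral_mono int_w lo Bochner_Integration.integrable_diff integrable_mult_right j)
  finally have C: "?K * ?Z m * k powr t / (2 * T) \<le> herm_const n \<mu>" .
  have C0: "0 < ?K * ?Z m * k powr t / (2 * T)"
    using vander_ratio_pos[of n] Zpos[of m] k T by (intro divide_pos_pos mult_pos_pos) auto
  with C have Cpos: "herm_const n \<mu> > 0" by linarith
  let ?F = "\<lambda>c. (k powr t * (Y c ^ m * D c * gwt n c) +
      k powr t * (1 / k) * (Y c ^ (m + 1) * D c * gwt n c)) / herm_const n \<mu>"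
  have F0: "0 \<le> ?F c" for c using Y[of c] D[of c] k Cpos gwt_pos[of n c] by simp
  have Fint: "integrable (coords n) ?F"
    by (intro integrable_divide Bochner_Integration.integrable_add integrable_mult_right i0 i1)
  have spec_meas: "(\<lambda>A. ennreal (spec_real n h A)) \<in> borel_measurable (herm_borel n)" by measurable
  have "(\<integral>\<^sup>+A. ennreal (spec_real n h A) \<partial>herm_measure n \<mu>) =
      (\<integral>\<^sup>+A. ennreal (herm_weight \<mu> A / herm_const n \<mu>) * ennreal (spec_real n h A) \<partial>herm_lebesgue n)"
    unfolding herm_measure_def
    by (rule nn_integral_density) (use hm in \<open>simp_all add: herm_lebesgue_def\<close>)
  also have "\<dots> = (\<integral>\<^sup>+c. ennreal (herm_weight \<mu> (herm_of n c) / herm_const n \<mu>) * ennreal (D c) \<partial>coords n)"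
    unfolding herm_lebesgue_def D_def
    by (rule nn_integral_distr[OF herm_of_measurable]) (use hm in simp)
  also have "\<dots> \<le> (\<integral>\<^sup>+c. ennreal (?F c) \<partial>coords n)"
  proof (intro nn_integral_mono)
    fix c
    have "herm_weight \<mu> (herm_of n c) / herm_const n \<mu> * D c \<le> ?up c / herm_const n \<mu> * D c"
      using up[of c] Cpos D[of c] by (intro mult_right_mono divide_right_mono) auto
    also have "\<dots> = ?F c" by (simp add: algebra_simps add_divide_distrib)
    finally show "ennreal (herm_weight \<mu> (herm_of n c) / herm_const n \<mu>) * ennreal (D c) \<le> ennreal (?F c)"
      using wnn[of "herm_of n c"] Cpos D[of c] by (simp add: ennreal_mult[symmetric] ennreal_leI)
  qed
  also have "\<dots> = ennreal (\<integral>c. ?F c \<partial>coords n)"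
    using Fint F0 by (intro nn_integral_eq_integral) auto
  also have "(\<integral>c. ?F c \<partial>coords n) = (k powr t * (?K * v0) + k powr t * (1 / k) * (?K * v1)) / herm_const n \<mu>"
    by (intro has_bochner_integral_integral_eq has_bochner_integral_divide has_bochner_integral_add
        has_bochner_integral_mult_right hi)
  also have "\<dots> \<le> (k powr t * (?K * (?Z m * exp (\<Sum>j<n. nu m j h - 1))) +
      k powr t * (1 / k) * (?K * (?Z (m + 1) * exp (\<Sum>j<n. nu (m + 1) j h - 1)))) / herm_const n \<mu>"
    using v0(3) v1(3) vander_ratio_pos[of n] k Cpos
    by (intro divide_right_mono add_mono mult_left_mono) auto
  also have "\<dots> = ?K * ?Z m * k powr t * (exp (\<Sum>j<n. nu m j h - 1) + exp (\<Sum>j<n. nu (m + 1) j h - 1)) / herm_const n \<mu>"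
  proof -
    have "1 / k * ?Z (m + 1) = ?Z m" using Zpos[of m] Zpos[of "m + 1"] by (simp add: k_def)
    then have e: "k powr t * (1 / k) * (?K * (?Z (m + 1) * e)) = k powr t * ?K * ?Z m * e" for e
      by (metis mult.assoc mult.left_commute)
    show ?thesis unfolding e by (simp add: distrib_left mult_ac)
  qed
  also have "\<dots> \<le> ?K * ?Z m * k powr t * (exp (\<Sum>j<n. nu m j h - 1) + exp (\<Sum>j<n. nu (m + 1) j h - 1)) /
      (?K * ?Z m * k powr t / (2 * T))"
    using C C0 vander_ratio_pos[of n] Zpos[of m] k
    by (intro divide_left_mono mult_pos_pos) (auto intro!: mult_nonneg_nonneg add_nonneg_nonneg)
  also have "\<dots> = 2 * T * (exp (\<Sum>j<n. nu m j h - 1) + exp (\<Sum>j<n. nu (m + 1) j h - 1))"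
    using vander_ratio_pos[of n] Zpos[of m] k by simp
  also have "\<dots> = 4 * (real n + 1)\<^sup>2 * (exp (\<Sum>j<n. nu m j h - 1) + exp (\<Sum>j<n. nu (m + 1) j h - 1))"
    by (simp add: T_def)
  finally show ?thesis by (simp add: ennreal_leI)
qed

section \<open>Test polynomials\<close>

definition up_poly :: "real \<Rightarrow> nat \<Rightarrow> real poly" where
  "up_poly s k = 1 + smult s (monom 1 (2 * k))"

lemma poly_up_poly: "poly (up_poly s k) x = 1 + s * x ^ (2 * k)"
  by (simp add: up_poly_def poly_monom)

lemma sum_nu_up_poly_le:
  assumes "s \<ge> 0" and e: "edge (real (n + 2 * k)) (real m) \<le> e" and s: "s * (real n * e ^ (2 * k)) \<le> 1"
  shows "(\<Sum>j<n. nu m j (up_poly s k) - 1) \<le> 1"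
proof -
  have e0: "0 \<le> edge (real (n + 2 * k)) (real m)" by (simp add: edge_def)
  have "nu m j (monom 1 (2 * k)) \<le> e ^ (2 * k)" if "j < n" for j
    using nu_monom_le[OF that, of m "2 * k"] power_mono[OF e e0, of "2 * k"] by linarith
  then have "(\<Sum>j<n. nu m j (up_poly s k) - 1) \<le> (\<Sum>j<n. s * e ^ (2 * k))"
    using assms(1) by (intro sum_mono) (simp add: up_poly_def nu_add nu_1 nu_smult mult_left_mono)
  also have "\<dots> = s * (real n * e ^ (2 * k))" by simp
  finally show ?thesis using s by linarith
qed

text \<open>The last summand is a bump that is large near \<open>\<sigma> x = 2 t\<close> and small where \<open>\<sigma> x \<le> t\<close>, because the factor
  \<open>\<sigma> x + 2 t\<close> suppresses the opposite side.  The constant \<open>3 / 8\<close> is the value of \<open>z (z + 2 t) / (8 t\<^sup>2)\<close> at \<open>z = t\<close>,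
  and the power of degree \<open>2 q\<close> dominates the bump where \<open>\<bar>x\<bar> \<ge> 2 t\<close>.  In use \<open>2 t\<close> lies to the right of the
  spectral edge, and \<open>t\<close> to the left of it.\<close>

definition low_poly :: "real \<Rightarrow> real \<Rightarrow> nat \<Rightarrow> nat \<Rightarrow> real poly" where
  "low_poly \<sigma> t k q = 1 + smult ((3 / 8) ^ (2 * k)) 1 +
     smult (1 / (2 * t) ^ (2 * q)) (monom 1 (2 * q)) -
     smult (1 / (8 * t\<^sup>2) ^ (2 * k)) ((Xp * [:2 * t, \<sigma>:]) ^ (2 * k))"

lemma poly_low_poly:
  "poly (low_poly \<sigma> t k q) x = 1 + (3 / 8) ^ (2 * k) + (x / (2 * t)) ^ (2 * q) -
     (x * (\<sigma> * x + 2 * t) / (8 * t\<^sup>2)) ^ (2 * k)"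
  by (simp add: low_poly_def poly_monom power_divide add.commute[of "2 * t"] mult.commute[of \<sigma>])

lemma low_poly_outer:
  fixes x t \<sigma> :: real
  assumes t: "t > 0" and \<sigma>: "\<bar>\<sigma>\<bar> = 1" and q: "2 * k \<le> q" and x: "2 * t \<le> \<bar>x\<bar>"
  shows "(x * (\<sigma> * x + 2 * t) / (8 * t\<^sup>2)) ^ (2 * k) \<le> (x / (2 * t)) ^ (2 * q)"
proof -
  have one: "1 \<le> \<bar>x / (2 * t)\<bar>" using x t by (simp add: abs_divide)
  have "\<bar>\<sigma> * x + 2 * t\<bar> \<le> 2 * \<bar>x\<bar>"
    using abs_triangle_ineq[of "\<sigma> * x" "2 * t"] \<sigma> x t by (simp add: abs_mult)
  then have "\<bar>x\<bar> * \<bar>\<sigma> * x + 2 * t\<bar> \<le> \<bar>x\<bar> * (2 * \<bar>x\<bar>)" by (intro mult_left_mono) auto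
  then have "\<bar>x * (\<sigma> * x + 2 * t) / (8 * t\<^sup>2)\<bar> \<le> \<bar>x\<bar> * (2 * \<bar>x\<bar>) / (8 * t\<^sup>2)"
    unfolding abs_divide abs_mult using t by (intro divide_mono) auto
  also have "\<dots> = \<bar>x / (2 * t)\<bar>\<^sup>2" using t by (simp add: power2_eq_square abs_divide abs_mult)
  finally have "\<bar>x * (\<sigma> * x + 2 * t) / (8 * t\<^sup>2)\<bar> ^ (2 * k) \<le> (\<bar>x / (2 * t)\<bar>\<^sup>2) ^ (2 * k)"
    by (rule power_mono) simp
  also have "\<dots> = \<bar>x / (2 * t)\<bar> ^ (4 * k)" by (simp add: power_mult[symmetric])
  also have "\<dots> \<le> \<bar>x / (2 * t)\<bar> ^ (2 * q)" using one q by (intro power_increasing) auto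
  finally show ?thesis by (simp only: power_even_abs even_mult_iff even_numeral simp_thms)
qed

lemma low_poly_nonneg:
  assumes t: "t > 0" and \<sigma>: "\<bar>\<sigma>\<bar> = 1" and q: "2 * k \<le> q"
  shows "poly (low_poly \<sigma> t k q) x \<ge> 0"
proof (cases "2 * t \<le> \<bar>x\<bar>")
  case True
  then show ?thesis using low_poly_outer[OF t \<sigma> q True] unfolding poly_low_poly
    by (smt (verit) zero_le_power divide_nonneg_nonneg)
next
  case False
  then have "\<bar>\<sigma> * x + 2 * t\<bar> \<le> 4 * t"
    using abs_triangle_ineq[of "\<sigma> * x" "2 * t"] \<sigma> t by (simp add: abs_mult)
  then have "\<bar>x\<bar> * \<bar>\<sigma> * x + 2 * t\<bar> \<le> (2 * t) * (4 * t)"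
    using False t by (intro mult_mono) auto
  then have "\<bar>x * (\<sigma> * x + 2 * t) / (8 * t\<^sup>2)\<bar> \<le> 1"
    using t by (simp add: abs_divide abs_mult power2_eq_square)
  then have "\<bar>x * (\<sigma> * x + 2 * t) / (8 * t\<^sup>2)\<bar> ^ (2 * k) \<le> 1" by (intro power_le_one) auto
  then have "(x * (\<sigma> * x + 2 * t) / (8 * t\<^sup>2)) ^ (2 * k) \<le> 1"
    by (simp only: power_even_abs even_mult_iff even_numeral simp_thms)
  moreover have "(x / (2 * t)) ^ (2 * q) \<ge> 0" by (rule zero_le_even_power) simp
  moreover have "(3 / 8 :: real) ^ (2 * k) \<ge> 0" by simp
  ultimately show ?thesis unfolding poly_low_poly by linarith
qed

text \<open>With \<open>z = \<sigma> x\<close> in \<open>[- 2 t, t]\<close>, the quantity \<open>\<bar>z (z + 2 t)\<bar>\<close> is at most \<open>3 t\<^sup>2\<close> for \<open>z \<ge> 0\<close> and at most \<open>t\<^sup>2\<close> for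
  \<open>z < 0\<close>, so the constant \<open>(3 / 8)\<^sup>2\<^sup>k\<close> covers the bump.\<close>

lemma low_poly_ge_1:
  assumes t: "t > 0" and \<sigma>: "\<bar>\<sigma>\<bar> = 1" and q: "2 * k \<le> q" and x: "\<sigma> * x \<le> t"
  shows "poly (low_poly \<sigma> t k q) x \<ge> 1"
proof (cases "2 * t \<le> \<bar>x\<bar>")
  case True
  then show ?thesis using low_poly_outer[OF t \<sigma> q True] unfolding poly_low_poly
    by (smt (verit) zero_le_power divide_nonneg_nonneg)
next
  case False
  let ?z = "\<sigma> * x"
  have az: "\<bar>?z\<bar> = \<bar>x\<bar>" using \<sigma> by (simp add: abs_mult)
  have "\<bar>x * (?z + 2 * t)\<bar> = \<bar>?z * (?z + 2 * t)\<bar>" using az by (simp add: abs_mult)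
  also have "\<dots> \<le> 3 * t\<^sup>2"
  proof (cases "?z \<ge> 0")
    case True
    then have "?z * (?z + 2 * t) \<le> t * (t + 2 * t)" using x t by (intro mult_mono) auto
    with True t show ?thesis by (simp add: power2_eq_square)
  next
    case False
    have "?z + 2 * t \<ge> 0" using \<open>\<not> 2 * t \<le> \<bar>x\<bar>\<close> az by linarith
    then have "?z * (?z + 2 * t) \<le> 0" by (rule mult_nonpos_nonneg[rotated]) (use False in linarith)
    then have "\<bar>?z * (?z + 2 * t)\<bar> = - ?z * (?z + 2 * t)" by simp
    also have "\<dots> = t\<^sup>2 - (?z + t)\<^sup>2" by (simp add: power2_eq_square algebra_simps)
    also have "\<dots> \<le> 3 * t\<^sup>2" by (smt (verit) zero_le_power2)
    finally show ?thesis .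
  qed
  finally have "\<bar>x * (?z + 2 * t) / (8 * t\<^sup>2)\<bar> \<le> 3 / 8"
    using t by (simp add: abs_divide divide_le_eq)
  then have "\<bar>x * (?z + 2 * t) / (8 * t\<^sup>2)\<bar> ^ (2 * k) \<le> (3 / 8) ^ (2 * k)" by (intro power_mono) auto
  then have "(x * (?z + 2 * t) / (8 * t\<^sup>2)) ^ (2 * k) \<le> (3 / 8) ^ (2 * k)"
    by (simp only: power_even_abs even_mult_iff even_numeral simp_thms)
  moreover have "(x / (2 * t)) ^ (2 * q) \<ge> 0" by (rule zero_le_even_power) simp
  ultimately show ?thesis unfolding poly_low_poly by linarith
qed

text \<open>In the binomial expansion the odd moments vanish, and the even ones are at least the powers of \<open>r\<close> divided by
  \<open>4 k + 1\<close>.  Averaging over the signs of \<open>r\<close> restricts the expansion of \<open>(T + \<sigma> r)\<^sup>2\<^sup>k\<close> to the even exponents.\<close>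

lemma nu_bump_ge:
  assumes T: "T > 0" and \<sigma>: "\<bar>\<sigma>\<bar> = (1::real)" and r: "0 \<le> r" "r \<le> edge (real L) (real m)"
    and j: "L + 2 * k \<le> j"
  shows "(r * (r + T)) ^ (2 * k) / (2 * real (4 * k + 1)) \<le> nu m j ((Xp * [:T, \<sigma>:]) ^ (2 * k))"
proof -
  let ?c = "\<lambda>i. real (2 * k choose i) * T ^ (2 * k - i) * \<sigma> ^ i"
  have exp: "(Xp * [:T, \<sigma>:]) ^ (2 * k) = (\<Sum>i\<le>2 * k. smult (?c i) (monom 1 (2 * k + i)))"
  proof (rule poly_eq_poly_eq_iff[THEN iffD1], rule ext)
    fix x
    have "poly ((Xp * [:T, \<sigma>:]) ^ (2 * k)) x = x ^ (2 * k) * (x * \<sigma> + T) ^ (2 * k)"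
      by (simp add: power_mult_distrib add.commute)
    also have "\<dots> = x ^ (2 * k) * (\<Sum>i\<le>2 * k. real (2 * k choose i) * (x * \<sigma>) ^ i * T ^ (2 * k - i))"
      by (simp only: binomial_ring)
    also have "\<dots> = poly (\<Sum>i\<le>2 * k. smult (?c i) (monom 1 (2 * k + i))) x"
      by (simp add: poly_sum poly_monom sum_distrib_left power_add power_mult_distrib mult_ac)
    finally show "poly ((Xp * [:T, \<sigma>:]) ^ (2 * k)) x =
        poly (\<Sum>i\<le>2 * k. smult (?c i) (monom 1 (2 * k + i))) x" .
  qed
  have s2: "\<sigma>\<^sup>2 = 1" using \<sigma> by (metis abs_1 power2_abs one_power2)
  have termwise: "?c i * (r ^ (2 * k) * (r ^ i + (- r) ^ i) / 2 / real (4 * k + 1)) \<le> ?c i * nu m j (monom 1 (2 * k + i))"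
    if i: "i \<le> 2 * k" for i
  proof (cases "even i")
    case True
    then obtain l where l: "i = 2 * l" by (elim evenE)
    have "r ^ (2 * (k + l)) / real (4 * k + 1) \<le> edge (real L) (real m) ^ (2 * (k + l)) / real (2 * (k + l) + 1)"
      using r i l by (intro frac_le power_mono zero_le_power) auto
    also have "\<dots> \<le> nu m j (monom 1 (2 * (k + l)))"
      using i j l by (intro nu_monom_ge) auto
    finally have "r ^ (2 * k) * (r ^ i + (- r) ^ i) / 2 / real (4 * k + 1) \<le> nu m j (monom 1 (2 * k + i))"
      using True by (simp add: l power_add distrib_left)
    moreover have "?c i \<ge> 0" using T s2 by (simp add: l power_mult)
    ultimately show ?thesis by (rule mult_left_mono)
  next
    case False
    then show ?thesis by (simp add: nu_monom_odd)
  qed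
  have bin: "(\<Sum>i\<le>2 * k. ?c i * y ^ i) = (\<sigma> * y + T) ^ (2 * k)" for y
    by (simp only: binomial_ring) (simp add: power_mult_distrib mult_ac)
  have "(r + T) ^ (2 * k) \<le> (\<sigma> * r + T) ^ (2 * k) + (\<sigma> * (- r) + T) ^ (2 * k)"
  proof -
    have "\<sigma> = 1 \<or> \<sigma> = -1" using \<sigma> by linarith
    moreover have "(T - r) ^ (2 * k) \<ge> 0" by (rule zero_le_even_power) simp
    ultimately show ?thesis by (auto simp: add.commute)
  qed
  then have "(r * (r + T)) ^ (2 * k) / (2 * real (4 * k + 1)) \<le>
      r ^ (2 * k) * ((\<sigma> * r + T) ^ (2 * k) + (\<sigma> * (- r) + T) ^ (2 * k)) / (2 * real (4 * k + 1))"
    unfolding power_mult_distrib using r by (intro divide_right_mono mult_left_mono) auto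
  also have "\<dots> = (\<Sum>i\<le>2 * k. ?c i * (r ^ (2 * k) * (r ^ i + (- r) ^ i) / 2 / real (4 * k + 1)))"
    unfolding bin[symmetric] sum.distrib[symmetric] sum_distrib_left sum_divide_distrib
    by (intro sum.cong refl) (simp add: algebra_simps)
  also have "\<dots> \<le> (\<Sum>i\<le>2 * k. ?c i * nu m j (monom 1 (2 * k + i)))"
    using termwise by (intro sum_mono) auto
  also have "\<dots> = nu m j ((Xp * [:T, \<sigma>:]) ^ (2 * k))" unfolding exp nu_sum nu_smult ..
  finally show ?thesis .
qed

text \<open>The bump is nonnegative, so it may be dropped for the indices below \<open>L + 2 k\<close>, to which the lower moment
  bound does not apply.\<close>

lemma sum_nu_low_poly_le:
  assumes t: "t > 0" and \<sigma>: "\<bar>\<sigma>\<bar> = 1" and e: "edge (real (n + 2 * q)) (real m) \<le> e"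
    and r: "0 \<le> r" "r \<le> edge (real L) (real m)" and L: "L + 2 * k \<le> n"
  shows "(\<Sum>j<n. nu m j (low_poly \<sigma> t k q) - 1) \<le>
    real n * ((3 / 8) ^ (2 * k) + (e / (2 * t)) ^ (2 * q)) -
    real (n - (L + 2 * k)) * ((r * (r + 2 * t) / (8 * t\<^sup>2)) ^ (2 * k) / (2 * real (4 * k + 1)))"
proof -
  let ?a = "(3 / 8) ^ (2 * k) + (e / (2 * t)) ^ (2 * q)"
  let ?g = "(r * (r + 2 * t) / (8 * t\<^sup>2)) ^ (2 * k) / (2 * real (4 * k + 1))"
  let ?s = "(Xp * [:2 * t, \<sigma>:]) ^ (2 * k)"
  have e0: "0 \<le> edge (real (n + 2 * q)) (real m)" by (simp add: edge_def)
  have ind: "nu m j (low_poly \<sigma> t k q) - 1 \<le> ?a - (if L + 2 * k \<le> j then ?g else 0)" if "j < n" for j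
  proof -
    have eq: "nu m j (low_poly \<sigma> t k q) - 1 = (3 / 8) ^ (2 * k) +
        1 / (2 * t) ^ (2 * q) * nu m j (monom 1 (2 * q)) - 1 / (8 * t\<^sup>2) ^ (2 * k) * nu m j ?s"
      unfolding low_poly_def nu_add nu_diff nu_smult nu_1 by simp
    have "nu m j (monom 1 (2 * q)) \<le> e ^ (2 * q)"
      using nu_monom_le[OF that, of m "2 * q"] power_mono[OF e e0, of "2 * q"] by linarith
    then have "1 / (2 * t) ^ (2 * q) * nu m j (monom 1 (2 * q)) \<le> 1 / (2 * t) ^ (2 * q) * e ^ (2 * q)"
      using t by (intro mult_left_mono) auto
    then have 1: "1 / (2 * t) ^ (2 * q) * nu m j (monom 1 (2 * q)) \<le> (e / (2 * t)) ^ (2 * q)"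
      by (simp add: power_divide)
    have 2: "(if L + 2 * k \<le> j then ?g else 0) \<le> 1 / (8 * t\<^sup>2) ^ (2 * k) * nu m j ?s"
    proof (cases "L + 2 * k \<le> j")
      case True
      then have "1 / (8 * t\<^sup>2) ^ (2 * k) * ((r * (r + 2 * t)) ^ (2 * k) / (2 * real (4 * k + 1))) \<le>
          1 / (8 * t\<^sup>2) ^ (2 * k) * nu m j ?s"
        using t r \<sigma> by (intro mult_left_mono nu_bump_ge[of _ _ _ L]) auto
      then show ?thesis using True by (simp add: power_divide)
    next
      case False
      have "nu m j ?s \<ge> 0" by (intro nu_nonneg) (simp add: poly_power zero_le_even_power)
      then show ?thesis using False t by simp
    qed
    show ?thesis unfolding eq using 1 2 by linarith
  qed
  have "(\<Sum>j<n. nu m j (low_poly \<sigma> t k q) - 1) \<le> (\<Sum>j<n. ?a - (if L + 2 * k \<le> j then ?g else 0))"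
    using ind by (intro sum_mono) auto
  also have "\<dots> = real n * ?a - (\<Sum>j<n. if L + 2 * k \<le> j then ?g else 0)"
    by (simp only: sum_subtractf sum_constant card_lessThan)
  also have "(\<Sum>j<n. if L + 2 * k \<le> j then ?g else 0) = (\<Sum>j\<in>{L + 2 * k..<n}. ?g)"
    by (simp only: sum.inter_filter[symmetric] finite_lessThan) (rule sum.cong, auto)
  also have "\<dots> = real (n - (L + 2 * k)) * ?g" by simp
  finally show ?thesis .
qed

section \<open>Asymptotics of the edge\<close>

lemma edge_scale: "x > 0 \<Longrightarrow> edge s m = sqrt x * edge (s / x) (m / x)"
  by (simp add: edge_def distrib_left real_sqrt_mult[symmetric] field_simps)

lemma edge_mono: "s \<le> s' \<Longrightarrow> edge s m \<le> edge s' m"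
  by (auto simp: edge_def intro!: add_mono)

lemma tendsto_edge: "(f \<longlongrightarrow> s) F \<Longrightarrow> (g \<longlongrightarrow> m) F \<Longrightarrow> ((\<lambda>x. edge (f x) (g x)) \<longlongrightarrow> edge s m) F"
  unfolding edge_def by (intro tendsto_intros) auto

text \<open>The number \<open>b\<close> of the theorem is the edge at \<open>s = 1\<close> and \<open>m = c\<close>.\<close>

lemma edge_1:
  assumes "c \<ge> 0"
  shows "edge 1 c = sqrt (1 + c + sqrt (1 + 2 * c))"
proof -
  have "(edge 1 c)\<^sup>2 = 1 / 2 + (1 / 2 + c) + 2 * (sqrt (1 / 2) * sqrt (1 / 2 + c))"
    using assms by (simp add: edge_def power2_sum)
  also have "sqrt (1 / 2) * sqrt (1 / 2 + c) = sqrt ((1 + 2 * c) / 4)"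
    by (simp add: real_sqrt_mult[symmetric] algebra_simps)
  also have "2 * sqrt ((1 + 2 * c) / 4) = sqrt (1 + 2 * c)"
    by (simp add: real_sqrt_divide)
  finally have "(edge 1 c)\<^sup>2 = 1 + c + sqrt (1 + 2 * c)" by simp
  moreover have "edge 1 c \<ge> 0" using assms by (simp add: edge_def)
  ultimately show ?thesis by (metis real_sqrt_unique)
qed

lemma eventually_edge_less:
  assumes m: "(\<lambda>n. real (m n) / real n) \<longlonglongrightarrow> c" and "edge s c < r"
    and l: "\<forall>\<^sub>F n in sequentially. real (l n) \<le> s' n * real n" and s': "s' \<longlonglongrightarrow> s"
  shows "\<forall>\<^sub>F n in sequentially. edge (real (l n)) (real (m n)) < r * sqrt (real n)"
proof -
  have "(\<lambda>n. edge (s' n) (real (m n) / real n)) \<longlonglongrightarrow> edge s c" by (intro tendsto_edge s' m)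
  then have "\<forall>\<^sub>F n in sequentially. edge (s' n) (real (m n) / real n) < r"
    using assms(2) by (rule order_tendstoD(2))
  then show ?thesis using l eventually_gt_at_top[of 0]
  proof eventually_elim
    case (elim n)
    have "edge (real (l n)) (real (m n)) \<le> edge (s' n * real n) (real (m n))"
      using elim by (intro edge_mono)
    also have "\<dots> = sqrt (real n) * edge (s' n) (real (m n) / real n)"
      using elim edge_scale[of "real n" "s' n * real n" "real (m n)"] by simp
    also have "\<dots> < sqrt (real n) * r" using elim by (intro mult_strict_left_mono) auto
    finally show ?case by (simp add: mult.commute)
  qed
qed

lemma eventually_edge_greater:
  assumes m: "(\<lambda>n. real (m n) / real n) \<longlonglongrightarrow> c" and "r < edge s c"
    and l: "\<forall>\<^sub>F n in sequentially. s' n * real n \<le> real (l n)" and s': "s' \<longlonglongrightarrow> s"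
  shows "\<forall>\<^sub>F n in sequentially. r * sqrt (real n) < edge (real (l n)) (real (m n))"
proof -
  have "(\<lambda>n. edge (s' n) (real (m n) / real n)) \<longlonglongrightarrow> edge s c" by (intro tendsto_edge s' m)
  then have "\<forall>\<^sub>F n in sequentially. r < edge (s' n) (real (m n) / real n)"
    using assms(2) by (rule order_tendstoD(1))
  then show ?thesis using l eventually_gt_at_top[of 0]
  proof eventually_elim
    case (elim n)
    have "sqrt (real n) * r < sqrt (real n) * edge (s' n) (real (m n) / real n)"
      using elim by (intro mult_strict_left_mono) auto
    also have "\<dots> = edge (s' n * real n) (real (m n))"
      using elim edge_scale[of "real n" "s' n * real n" "real (m n)"] by simp
    also have "\<dots> \<le> edge (real (l n)) (real (m n))" using elim by (intro edge_mono)
    finally show ?case by (simp add: mult.commute)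
  qed
qed

lemma nat_div_bounds:
  assumes "N > 0"
  shows "real n / real N - 1 \<le> real (n div N)" "real (n div N) \<le> real n / real N"
proof -
  have "real n = real N * real (n div N) + real (n mod N)"
    by (metis div_mult_mod_eq mult.commute of_nat_add of_nat_mult)
  moreover have "real (n mod N) < real N" using assms by simp
  ultimately show "real n / real N - 1 \<le> real (n div N)" "real (n div N) \<le> real n / real N"
    using assms by (auto simp: field_simps)
qed

lemma exists_edge_less:
  assumes "edge 1 c < r"
  obtains N where "N > 0" "edge (1 + 2 / real N) c < r"
proof -
  have "(\<lambda>N. edge (1 + 2 / real N) c) \<longlonglongrightarrow> edge 1 c"
    by (intro tendsto_edge tendsto_const) real_asymp
  then have "\<forall>\<^sub>F N in sequentially. edge (1 + 2 / real N) c < r \<and> N > 0"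
    using assms by (intro eventually_conj order_tendstoD(2) eventually_gt_at_top)
  then show ?thesis using that by (auto dest!: eventually_happens)
qed

lemma exists_edge_greater:
  assumes "r < edge 1 c"
  obtains N where "N > 0" "r < edge (1 - 1 / real N) c"
proof -
  have "(\<lambda>N. edge (1 - 1 / real N) c) \<longlonglongrightarrow> edge 1 c"
    by (intro tendsto_edge tendsto_const) real_asymp
  then have "\<forall>\<^sub>F N in sequentially. r < edge (1 - 1 / real N) c \<and> N > 0"
    using assms by (intro eventually_conj order_tendstoD(1) eventually_gt_at_top)
  then show ?thesis using that by (auto dest!: eventually_happens)
qed

text \<open>The parameters are chosen in this order: \<open>r\<close> between \<open>t\<close> and the edge; \<open>N\<close> so large that the edge at index
  \<open>(1 - 1 / N) n\<close> still exceeds \<open>r sqrt n\<close>; then \<open>k\<close>, such that the bump, gained for about \<open>n / N\<close> indices, beats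
  the constant \<open>(3 / 8)\<^sup>2\<^sup>k\<close>, paid for all of them; finally \<open>q\<close>, which makes the outer term negligible.\<close>

lemma eventually_sum_nu_low_poly:
  assumes t: "edge 1 c / 2 < t" "t < edge 1 c" and c: "c \<ge> 0" and \<sigma>: "\<bar>\<sigma>\<bar> = 1"
  obtains k q \<delta> where "2 * k \<le> q" "\<delta> > 0"
    "\<And>m. (\<lambda>n. real (m n) / real n) \<longlonglongrightarrow> c \<Longrightarrow>
      \<forall>\<^sub>F n in sequentially. (\<Sum>j<n. nu (m n) j (low_poly \<sigma> (t * sqrt (real n)) k q) - 1) \<le> - \<delta> * real n"
proof -
  define r where "r = (t + edge 1 c) / 2"
  define e where "e = (2 * t + edge 1 c) / 2"
  define \<beta> where "\<beta> = r * (r + 2 * t) / (8 * t\<^sup>2)"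
  have e1: "edge 1 c > 0" using c by (simp add: edge_def add_pos_nonneg)
  have tpos: "t > 0" and r: "t < r" "r < edge 1 c" and e: "edge 1 c < e" "e < 2 * t"
    using t e1 by (auto simp: r_def e_def)
  obtain N where N: "N > 0" "r < edge (1 - 1 / real N) c" using exists_edge_greater[OF r(2)] .
  have "t * (t + 2 * t) < r * (r + 2 * t)" using r tpos by (intro mult_strict_mono) auto
  then have \<beta>: "3 / 8 < \<beta>" using tpos by (simp add: \<beta>_def pos_less_divide_eq power2_eq_square)
  \<comment> \<open>The bump decays more slowly in \<open>k\<close> than the constant, so a large \<open>k\<close> makes up for any fixed \<open>N\<close>.\<close>
  have "(\<lambda>k. ((3 / 8) / \<beta>) ^ (2 * k) * (4 * real N * (2 * real (4 * k + 1)))) \<longlonglongrightarrow> 0"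
  proof -
    define u where "u = - ln ((3 / 8) / \<beta>)"
    have "u > 0" using \<beta> by (simp add: u_def)
    have "x ^ i = exp (real i * ln x)" if "x > 0" for x :: real and i
      using that by (simp add: exp_of_nat_mult)
    from this[of "(3 / 8) / \<beta>" "2 * k" for k]
    have "((3 / 8) / \<beta>) ^ (2 * k) = exp (- u * real (2 * k))" for k
      unfolding u_def using \<beta> by (simp only: minus_minus mult.commute) simp
    moreover have "(\<lambda>k. exp (- u * real (2 * k)) * (4 * real N * (2 * real (4 * k + 1)))) \<longlonglongrightarrow> 0"
      using \<open>u > 0\<close> by real_asymp
    ultimately show ?thesis by simp
  qed
  then have "\<forall>\<^sub>F k in sequentially. ((3 / 8) / \<beta>) ^ (2 * k) * (4 * real N * (2 * real (4 * k + 1))) < 1"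
    by (rule order_tendstoD(2)) simp
  then obtain k where k: "((3 / 8) / \<beta>) ^ (2 * k) * (4 * real N * (2 * real (4 * k + 1))) < 1"
    by (auto dest!: eventually_happens)
  define g where "g = \<beta> ^ (2 * k) / (2 * real (4 * k + 1))"
  have gpos: "g > 0" using \<beta> by (simp add: g_def)
  have kg: "(3 / 8) ^ (2 * k) < g / (4 * real N)"
    using k \<beta> N(1) by (simp add: g_def power_divide pos_less_divide_eq pos_divide_less_eq mult_ac)
  have "(\<lambda>q. (e / (2 * t)) ^ (2 * q)) \<longlonglongrightarrow> 0"
  proof -
    have "(\<lambda>q. ((e / (2 * t))\<^sup>2) ^ q) \<longlonglongrightarrow> 0"
      using e e1 tpos by (intro LIMSEQ_power_zero) (simp add: power_less_one_iff abs_square_less_1)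
    then show ?thesis by (simp add: power_mult)
  qed
  then have "\<forall>\<^sub>F q in sequentially. (e / (2 * t)) ^ (2 * q) < g / (8 * real N) \<and> 2 * k \<le> q"
    using gpos N(1) by (intro eventually_conj order_tendstoD(2) eventually_ge_at_top) auto
  then obtain q where q: "(e / (2 * t)) ^ (2 * q) < g / (8 * real N)" "2 * k \<le> q"
    by (auto dest!: eventually_happens)
  define \<delta> where "\<delta> = g / (8 * real N)"
  have "\<forall>\<^sub>F n in sequentially.
      (\<Sum>j<n. nu (m n) j (low_poly \<sigma> (t * sqrt (real n)) k q) - 1) \<le> - \<delta> * real n"
    if m: "(\<lambda>n. real (m n) / real n) \<longlonglongrightarrow> c" for m
  proof -
    have "\<forall>\<^sub>F n in sequentially. edge (real (n + 2 * q)) (real (m n)) < e * sqrt (real n)"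
    proof (rule eventually_edge_less[OF m e(1)])
      show "(\<lambda>n. 1 + 2 * real q / real n) \<longlonglongrightarrow> 1" by real_asymp
      show "\<forall>\<^sub>F n in sequentially. real (n + 2 * q) \<le> (1 + 2 * real q / real n) * real n"
        using eventually_gt_at_top[of 0] by eventually_elim (simp add: field_simps)
    qed
    moreover have "\<forall>\<^sub>F n in sequentially. r * sqrt (real n) < edge (real (n - n div N)) (real (m n))"
    proof (rule eventually_edge_greater[OF m N(2)])
      show "(\<lambda>n. 1 - 1 / real N) \<longlonglongrightarrow> 1 - 1 / real N" by simp
      show "\<forall>\<^sub>F n in sequentially. (1 - 1 / real N) * real n \<le> real (n - n div N)"
        using nat_div_bounds(2)[OF N(1)] by (intro always_eventually) (simp add: of_nat_diff algebra_simps)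
    qed
    moreover have "\<forall>\<^sub>F n in sequentially. real n \<ge> 2 * real N * (1 + 2 * real k)" by real_asymp
    moreover have "\<forall>\<^sub>F n in sequentially. n > 0" by (rule eventually_gt_at_top)
    ultimately show ?thesis
    proof eventually_elim
      case (elim n)
      let ?t = "t * sqrt (real n)" and ?r = "r * sqrt (real n)" and ?L = "n - n div N"
      have n2: "real n / (2 * real N) \<ge> 1 + 2 * real k" using elim(3) N(1) by (simp add: field_simps)
      then have d: "real (n div N) - 2 * real k \<ge> real n / (2 * real N)"
        using nat_div_bounds(1)[OF N(1), of n] by (simp add: field_simps)
      then have "real (2 * k) \<le> real (n div N)" using n2 by simp
      then have kd: "2 * k \<le> n div N" by (simp only: of_nat_le_iff)
      have dn: "n div N \<le> n" by (rule div_le_dividend)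
      have Lk: "?L + 2 * k \<le> n" using kd dn by arith
      have "n - (?L + 2 * k) = n div N - 2 * k" using kd dn by arith
      then have cnt: "real (n - (?L + 2 * k)) \<ge> real n / (2 * real N)"
        using d kd by (simp add: of_nat_diff)
      have "(\<Sum>j<n. nu (m n) j (low_poly \<sigma> ?t k q) - 1) \<le>
          real n * ((3 / 8) ^ (2 * k) + (e * sqrt (real n) / (2 * ?t)) ^ (2 * q)) -
          real (n - (?L + 2 * k)) * ((?r * (?r + 2 * ?t) / (8 * ?t\<^sup>2)) ^ (2 * k) / (2 * real (4 * k + 1)))"
        using elim tpos r \<sigma> Lk by (intro sum_nu_low_poly_le) auto
      also have "e * sqrt (real n) / (2 * ?t) = e / (2 * t)" using elim(4) by simp
      also have "?r * (?r + 2 * ?t) / (8 * ?t\<^sup>2) = \<beta>"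
      proof -
        have "?r * (?r + 2 * ?t) = real n * (r * (r + 2 * t))"
        proof -
          have "(r * w) * (r * w + 2 * (t * w)) = (w * w) * (r * (r + 2 * t))" for w :: real
            by (simp add: algebra_simps)
          from this[of "sqrt (real n)"] show ?thesis by simp
        qed
        moreover have "8 * ?t\<^sup>2 = real n * (8 * t\<^sup>2)" by (simp add: power_mult_distrib)
        ultimately have "?r * (?r + 2 * ?t) / (8 * ?t\<^sup>2) =
            (real n * (r * (r + 2 * t))) / (real n * (8 * t\<^sup>2))" by (simp only:)
        also have "\<dots> = \<beta>"
          unfolding \<beta>_def using elim(4) by (intro nonzero_mult_divide_mult_cancel_left) simp
        finally show ?thesis .
      qed
      also have "real n * ((3 / 8) ^ (2 * k) + (e / (2 * t)) ^ (2 * q)) -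
          real (n - (?L + 2 * k)) * (\<beta> ^ (2 * k) / (2 * real (4 * k + 1))) \<le>
          real n * (g / (4 * real N) + g / (8 * real N)) - real n / (2 * real N) * g"
        unfolding g_def[symmetric] using kg q(1) cnt gpos
        by (intro diff_mono mult_left_mono mult_right_mono add_mono) auto
      also have "\<dots> = - \<delta> * real n" using N(1) by (simp add: \<delta>_def field_simps)
      finally show ?case .
    qed
  qed
  moreover have "\<delta> > 0" using gpos N(1) by (simp add: \<delta>_def)
  ultimately show ?thesis using that q(2) by blast
qed

section \<open>Almost sure convergence\<close>

locale herm_sequence = prob_space M for M :: "'w measure" +
  fixes \<mu> :: "nat \<Rightarrow> real" and c :: real and X :: "nat \<Rightarrow> 'w \<Rightarrow> complex mat"
  assumes \<mu>_pos: "\<And>n. n \<ge> 1 \<Longrightarrow> \<mu> n > 0"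
    and \<mu>_lim: "(\<lambda>n. \<mu> n / real n) \<longlonglongrightarrow> c"
    and X_meas: "\<And>n. n \<ge> 1 \<Longrightarrow> X n \<in> M \<rightarrow>\<^sub>M herm_borel n"
    and X_distr: "\<And>n. n \<ge> 1 \<Longrightarrow> distr M (herm_borel n) (X n) = herm_measure n (\<mu> n)"
begin

lemma c_nonneg: "c \<ge> 0"
  by (rule LIMSEQ_le_const[OF \<mu>_lim]) (auto intro!: exI[of _ 1] divide_nonneg_nonneg less_imp_le[OF \<mu>_pos])

lemma floor_lim: "(\<lambda>n. real (nat \<lfloor>\<mu> n\<rfloor> + i) / real n) \<longlonglongrightarrow> c"
proof (rule tendsto_sandwich)
  show "\<forall>\<^sub>F n in sequentially. \<mu> n / real n - 1 / real n \<le> real (nat \<lfloor>\<mu> n\<rfloor> + i) / real n"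
    using eventually_ge_at_top[of 1]
  proof eventually_elim
    case (elim n)
    have "\<mu> n - 1 \<le> real (nat \<lfloor>\<mu> n\<rfloor> + i)" using \<mu>_pos[OF elim] by linarith
    then have "(\<mu> n - 1) / real n \<le> real (nat \<lfloor>\<mu> n\<rfloor> + i) / real n" by (rule divide_right_mono) simp
    then show ?case by (simp add: diff_divide_distrib)
  qed
  show "\<forall>\<^sub>F n in sequentially. real (nat \<lfloor>\<mu> n\<rfloor> + i) / real n \<le> \<mu> n / real n + real i / real n"
    using eventually_ge_at_top[of 1]
  proof eventually_elim
    case (elim n)
    have "real (nat \<lfloor>\<mu> n\<rfloor> + i) \<le> \<mu> n + real i" using \<mu>_pos[OF elim] by simp
    then have "real (nat \<lfloor>\<mu> n\<rfloor> + i) / real n \<le> (\<mu> n + real i) / real n" by (rule divide_right_mono) simp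
    then show ?case by (simp add: add_divide_distrib)
  qed
  have "(\<lambda>n. 1 / real n) \<longlonglongrightarrow> 0" "(\<lambda>n. real i / real n) \<longlonglongrightarrow> 0" by real_asymp+
  with tendsto_diff[OF \<mu>_lim this(1)] tendsto_add[OF \<mu>_lim this(2)]
  show "(\<lambda>n. \<mu> n / real n - 1 / real n) \<longlonglongrightarrow> c" "(\<lambda>n. \<mu> n / real n + real i / real n) \<longlonglongrightarrow> c"
    by simp_all
qed

text \<open>Markov's inequality and the first Borel-Cantelli lemma, which sees only the individual laws of the \<open>X n\<close>.
  The sets to which it is applied are described by polynomials in the entries, hence measurable.\<close>

lemma AE_eventually_spec_less:
  fixes h :: "nat \<Rightarrow> real poly" and A B :: "nat \<Rightarrow> real"
  assumes ev: "\<forall>\<^sub>F n in sequentially. A n > 0 \<and> (\<forall>x. poly (h n) x \<ge> 0) \<and>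
      (\<forall>i\<in>{0, 1}. (\<Sum>j<n. nu (nat \<lfloor>\<mu> n\<rfloor> + i) j (h n) - 1) \<le> B n)"
    and summ: "summable (\<lambda>n. (real n + 1)\<^sup>2 * exp (B n) / A n)"
  shows "AE \<omega> in M. \<forall>\<^sub>F n in sequentially. spec_real n (h n) (X n \<omega>) < A n"
proof -
  from ev eventually_ge_at_top[of 1] have "\<forall>\<^sub>F n in sequentially. n \<ge> 1 \<and> A n > 0 \<and> (\<forall>x. poly (h n) x \<ge> 0) \<and>
      (\<forall>i\<in>{0, 1}. (\<Sum>j<n. nu (nat \<lfloor>\<mu> n\<rfloor> + i) j (h n) - 1) \<le> B n)"
    by eventually_elim blast
  then obtain n0 where n0: "\<And>n. n \<ge> n0 \<Longrightarrow> n \<ge> 1 \<and> A n > 0 \<and> (\<forall>x. poly (h n) x \<ge> 0) \<and>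
      (\<forall>i\<in>{0, 1}. (\<Sum>j<n. nu (nat \<lfloor>\<mu> n\<rfloor> + i) j (h n) - 1) \<le> B n)"
    unfolding eventually_sequentially by blast
  define S where "S n = (if n \<ge> n0 then {\<omega> \<in> space M. 1 \<le> ennreal (1 / A n) * ennreal (spec_real n (h n) (X n \<omega>))} else {})" for n
  have meas: "(\<lambda>\<omega>. ennreal (spec_real n (h n) (X n \<omega>))) \<in> borel_measurable M" if "n \<ge> n0" for n
    using measurable_compose[OF X_meas measurable_spec_real[of n "h n"]] n0[OF that] by simp
  have sets: "S n \<in> sets M" for n
    using meas[of n] by (auto simp: S_def)
  have bound: "measure M (S n) \<le> 8 * ((real n + 1)\<^sup>2 * exp (B n) / A n)" if n: "n \<ge> n0" for n
  proof -
    note n1 = n0[OF n]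
    let ?f = "\<lambda>\<omega>. ennreal (spec_real n (h n) (X n \<omega>))"
    have "(\<integral>\<^sup>+\<omega>. ?f \<omega> \<partial>M) = (\<integral>\<^sup>+x. ennreal (spec_real n (h n) x) \<partial>distr M (herm_borel n) (X n))"
      using n1 by (intro nn_integral_distr[symmetric] X_meas) auto
    also have "\<dots> = (\<integral>\<^sup>+x. ennreal (spec_real n (h n) x) \<partial>herm_measure n (\<mu> n))"
      using n1 X_distr[of n] by simp
    also have "\<dots> \<le> ennreal (4 * (real n + 1)\<^sup>2 * (exp (\<Sum>j<n. nu (nat \<lfloor>\<mu> n\<rfloor>) j (h n) - 1) +
        exp (\<Sum>j<n. nu (nat \<lfloor>\<mu> n\<rfloor> + 1) j (h n) - 1)))"
      using n1 \<mu>_pos[of n] by (intro herm_measure_spec_real_le) auto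
    also have "\<dots> \<le> ennreal (4 * (real n + 1)\<^sup>2 * (exp (B n) + exp (B n)))"
      using n1 by (intro ennreal_leI mult_left_mono add_mono) auto
    finally have I: "(\<integral>\<^sup>+\<omega>. ?f \<omega> \<partial>M) \<le> ennreal (8 * ((real n + 1)\<^sup>2 * exp (B n)))" by simp
    have "emeasure M (S n) \<le> ennreal (1 / A n) * (\<integral>\<^sup>+\<omega>. ?f \<omega> * indicator (space M) \<omega> \<partial>M)"
      unfolding S_def if_P[OF n]
      by (rule nn_integral_Markov_inequality)
        (intro borel_measurable_times_ennreal meas n borel_measurable_indicator, simp_all)
    also have "(\<integral>\<^sup>+\<omega>. ?f \<omega> * indicator (space M) \<omega> \<partial>M) = (\<integral>\<^sup>+\<omega>. ?f \<omega> \<partial>M)"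
      by (intro nn_integral_cong) simp
    also have "ennreal (1 / A n) * \<dots> \<le> ennreal (1 / A n) * ennreal (8 * ((real n + 1)\<^sup>2 * exp (B n)))"
      by (intro mult_left_mono I) simp
    also have "\<dots> = ennreal (8 * ((real n + 1)\<^sup>2 * exp (B n) / A n))"
      using n1 by (subst ennreal_mult[symmetric]) auto
    finally show ?thesis
      using n1 unfolding emeasure_eq_measure by (subst (asm) ennreal_le_iff) auto
  qed
  have "summable (\<lambda>n. measure M (S n))"
  proof (rule summable_comparison_test_ev)
    show "\<forall>\<^sub>F n in sequentially. norm (measure M (S n)) \<le> 8 * ((real n + 1)\<^sup>2 * exp (B n) / A n)"
      using eventually_ge_at_top[of n0]       by eventually_elim (simp only: real_norm_def abs_of_nonneg[OF measure_nonneg] bound)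
    show "summable (\<lambda>n. 8 * ((real n + 1)\<^sup>2 * exp (B n) / A n))" using summ by (rule summable_mult)
  qed
  then have "AE \<omega> in M. \<forall>\<^sub>F n in sequentially. \<omega> \<in> space M - S n"
    by (intro borel_cantelli_AE1 sets) (auto simp: emeasure_eq_measure)
  then show ?thesis
  proof eventually_elim
    case (elim \<omega>)
    then show ?case using eventually_ge_at_top[of n0]
    proof eventually_elim
      case (elim n)
      note n1 = n0[OF elim(2)]
      have "\<not> 1 \<le> ennreal (1 / A n) * ennreal (spec_real n (h n) (X n \<omega>))"
        using elim by (auto simp: S_def)
      moreover have "spec_real n (h n) (X n \<omega>) \<ge> 0" using n1 by (intro spec_real_nonneg) auto
      ultimately have "\<not> 1 \<le> 1 / A n * spec_real n (h n) (X n \<omega>)"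
        using n1 by (simp add: ennreal_mult[symmetric] del: ennreal_1 flip: ennreal_1)
      then show ?case using n1 by (simp add: field_simps)
    qed
  qed
qed

lemma summable_poly_exp:
  assumes "\<delta> > 0"
  shows "summable (\<lambda>n. (real n + 1) ^ 3 * exp (- \<delta> * real n))"
proof (rule summable_comparison_test_bigo)
  show "summable (\<lambda>n. norm (1 / real n ^ 2))"
    using inverse_power_summable[of 2, where 'a = real] by (simp add: field_simps)
  show "(\<lambda>n. (real n + 1) ^ 3 * exp (- \<delta> * real n)) \<in> O(\<lambda>n. 1 / real n ^ 2)"
    using assms by real_asymp
qed

text \<open>The degree \<open>2 k\<close> grows in proportion to \<open>n\<close>, so that the gain \<open>(T / t)\<^sup>2\<^sup>k\<close> is exponential; the proportion
  \<open>1 / N\<close> is small enough to keep the edge at index \<open>n + 2 k\<close> below \<open>t sqrt n\<close>.\<close>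

lemma AE_eventually_eigs_less:
  assumes T: "edge 1 c < T"
  shows "AE \<omega> in M. \<forall>\<^sub>F n in sequentially. \<forall>i<n. \<bar>eigs n (X n \<omega>) i\<bar> < T * sqrt (real n)"
proof -
  define t where "t = (edge 1 c + T) / 2"
  have "edge 1 c > 0" using c_nonneg by (simp add: edge_def add_pos_nonneg)
  then have t: "0 < t" "edge 1 c < t" "t < T" using T by (auto simp: t_def)
  obtain N where N: "N > 0" "edge (1 + 2 / real N) c < t" using exists_edge_less[OF t(2)] .
  define k where "k n = n div N" for n
  define s where "s n = 1 / (real n * (t * sqrt (real n)) ^ (2 * k n))" for n
  define A where "A n = s n * (T * sqrt (real n)) ^ (2 * k n)" for n
  have edge: "\<forall>\<^sub>F n in sequentially. edge (real (n + 2 * k n)) (real (nat \<lfloor>\<mu> n\<rfloor> + i)) < t * sqrt (real n)" for i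
  proof (rule eventually_edge_less[OF floor_lim N(2)])
    show "\<forall>\<^sub>F n in sequentially. real (n + 2 * k n) \<le> (1 + 2 / real N) * real n"
    proof (intro always_eventually allI)
      fix n
      have "(1 + 2 / real N) * real n = real n + 2 * (real n / real N)" by (simp add: distrib_right)
      then show "real (n + 2 * k n) \<le> (1 + 2 / real N) * real n"
        using nat_div_bounds(2)[OF N(1), of n] by (simp add: k_def)
    qed
    show "(\<lambda>n. 1 + 2 / real N) \<longlonglongrightarrow> 1 + 2 / real N" by simp
  qed
  have "AE \<omega> in M. \<forall>\<^sub>F n in sequentially. spec_real n (up_poly (s n) (k n)) (X n \<omega>) < A n"
  proof (rule AE_eventually_spec_less[where B = "\<lambda>_. 1"])
    show "\<forall>\<^sub>F n in sequentially. A n > 0 \<and> (\<forall>x. poly (up_poly (s n) (k n)) x \<ge> 0) \<and>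
        (\<forall>i\<in>{0, 1}. (\<Sum>j<n. nu (nat \<lfloor>\<mu> n\<rfloor> + i) j (up_poly (s n) (k n)) - 1) \<le> 1)"
      using edge[of 0] edge[of 1] eventually_ge_at_top[of 1]
    proof eventually_elim
      case (elim n)
      then have s: "s n > 0" using t by (simp add: s_def)
      have "(\<Sum>j<n. nu (nat \<lfloor>\<mu> n\<rfloor> + i) j (up_poly (s n) (k n)) - 1) \<le> 1" if "i \<in> {0, 1}" for i
      proof (rule sum_nu_up_poly_le[of _ _ _ _ "t * sqrt (real n)"])
        show "edge (real (n + 2 * k n)) (real (nat \<lfloor>\<mu> n\<rfloor> + i)) \<le> t * sqrt (real n)"
          using that elim(1)[THEN less_imp_le] elim(2)[THEN less_imp_le]
          by (elim insertE emptyE) (simp_all only:)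
        show "s n * (real n * (t * sqrt (real n)) ^ (2 * k n)) \<le> 1"
          by (simp add: s_def)
      qed (use s in auto)
      moreover have "poly (up_poly (s n) (k n)) x \<ge> 0" for x
        unfolding poly_up_poly using s by (intro add_nonneg_nonneg mult_nonneg_nonneg zero_le_even_power) auto
      moreover have "A n > 0" unfolding A_def using s t elim(3) by (intro mult_pos_pos zero_less_power) auto
      ultimately show ?case by blast
    qed
    define u where "u = (t / T)\<^sup>2"
    have u: "0 < u" "u < 1" using t by (auto simp: u_def power_less_one_iff)
    have "summable (\<lambda>n. exp 1 / u * ((real n + 1) ^ 3 * exp (- (- ln u / real N) * real n)))"
      using u N(1) by (intro summable_mult summable_poly_exp) (simp add: divide_neg_pos)
    moreover have "\<forall>\<^sub>F n in sequentially. norm ((real n + 1)\<^sup>2 * exp 1 / A n) \<le>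
        exp 1 / u * ((real n + 1) ^ 3 * exp (- (- ln u / real N) * real n))"
      using eventually_ge_at_top[of 1]
    proof eventually_elim
      case (elim n)
      then have A: "1 / A n = real n * u ^ k n"
        using t by (simp add: A_def s_def u_def power_mult power_mult_distrib power_divide)
      have "u ^ k n = exp (real (k n) * ln u)" using u by (simp add: exp_of_nat_mult)
      also have "\<dots> \<le> exp ((real n / real N - 1) * ln u)"
        using nat_div_bounds(1)[OF N(1), of n] u by (simp add: k_def mult_right_mono_neg)
      also have "\<dots> = exp (- (- ln u / real N) * real n) / u"
      proof -
        have "(real n / real N - 1) * ln u = - (- ln u / real N) * real n - ln u"
          by (simp add: left_diff_distrib)
        then show ?thesis using u(1) by (simp only: exp_diff exp_ln)
      qed
      finally have uk: "u ^ k n \<le> exp (- (- ln u / real N) * real n) / u" .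
      have "(real n + 1)\<^sup>2 * exp 1 / A n = exp 1 * ((real n + 1)\<^sup>2 * real n) * u ^ k n"
      proof -
        have "(real n + 1)\<^sup>2 * exp 1 / A n = (real n + 1)\<^sup>2 * exp 1 * (1 / A n)" by simp
        then show ?thesis unfolding A by (simp only: mult_ac)
      qed
      also have "\<dots> \<le> exp 1 * ((real n + 1) ^ 3) * (exp (- (- ln u / real N) * real n) / u)"
        using uk u by (intro mult_mono) (auto simp: power2_eq_square power3_eq_cube mult_left_mono)
      finally have "(real n + 1)\<^sup>2 * exp 1 / A n \<le>
          exp 1 / u * ((real n + 1) ^ 3 * exp (- (- ln u / real N) * real n))" by (simp add: mult_ac)
      moreover have "A n > 0"
        unfolding A_def s_def using t elim
        by (intro mult_pos_pos divide_pos_pos zero_less_power) auto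
      then have "(real n + 1)\<^sup>2 * exp 1 / A n \<ge> 0"
        by (intro divide_nonneg_pos mult_nonneg_nonneg) auto
      ultimately show ?case by (simp only: real_norm_def abs_of_nonneg)
    qed
    ultimately show "summable (\<lambda>n. (real n + 1)\<^sup>2 * exp 1 / A n)"
      by (rule summable_comparison_test_ev[rotated])
  qed
  then show ?thesis
  proof eventually_elim
    case (elim \<omega>)
    then show ?case using eventually_ge_at_top[of 1]
    proof eventually_elim
      case (elim n)
      show ?case
      proof (intro allI impI, rule ccontr)
        fix i assume i: "i < n" and "\<not> \<bar>eigs n (X n \<omega>) i\<bar> < T * sqrt (real n)"
        then have ge: "T * sqrt (real n) \<le> \<bar>eigs n (X n \<omega>) i\<bar>" by simp
        let ?p = "\<lambda>i. poly (up_poly (s n) (k n)) (eigs n (X n \<omega>) i)"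
        have s: "s n > 0" using t elim(2) by (simp add: s_def)
        have one: "?p l \<ge> 1" for l
          unfolding poly_up_poly using s by (simp add: zero_le_even_power)
        have "(T * sqrt (real n)) ^ (2 * k n) \<le> \<bar>eigs n (X n \<omega>) i\<bar> ^ (2 * k n)"
          using ge t by (intro power_mono) auto
        then have "A n \<le> ?p i"
          unfolding A_def poly_up_poly using s by (simp add: power_even_abs add_increasing)
        also have "\<dots> \<le> ?p i * (\<Prod>l\<in>{..<n} - {i}. ?p l)"
        proof -
          have "1 \<le> (\<Prod>l\<in>{..<n} - {i}. ?p l)" by (intro prod_ge_1 one)
          from mult_left_mono[OF this, of "?p i"] one[of i] show ?thesis by simp
        qed
        also have "\<dots> = spec_real n (up_poly (s n) (k n)) (X n \<omega>)"
          unfolding spec_real_def using i by (subst prod.remove[of "{..<n}" i]) auto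
        finally show False using elim(1) by simp
      qed
    qed
  qed
qed

text \<open>If all \<open>\<sigma> \<lambda>\<^sub>i\<close> were at most \<open>t sqrt n\<close>, every factor \<open>h(\<lambda>\<^sub>i)\<close> would be at least \<open>1\<close>, although the expectation of the
  product is exponentially small.  Both signs \<open>\<sigma>\<close> are used.\<close>

lemma AE_eventually_eigs_greater:
  assumes t: "edge 1 c / 2 < t" "t < edge 1 c" and \<sigma>: "\<bar>\<sigma>\<bar> = 1"
  shows "AE \<omega> in M. \<forall>\<^sub>F n in sequentially. \<exists>i<n. t * sqrt (real n) < \<sigma> * eigs n (X n \<omega>) i"
proof -
  obtain k q \<delta> where q: "2 * k \<le> q" and \<delta>: "\<delta> > 0"
    and S: "\<And>m. (\<lambda>n. real (m n) / real n) \<longlonglongrightarrow> c \<Longrightarrow>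
      \<forall>\<^sub>F n in sequentially. (\<Sum>j<n. nu (m n) j (low_poly \<sigma> (t * sqrt (real n)) k q) - 1) \<le> - \<delta> * real n"
    using eventually_sum_nu_low_poly[OF t c_nonneg \<sigma>] by blast
  have "edge 1 c > 0" using c_nonneg by (simp add: edge_def add_pos_nonneg)
  then have tpos: "t > 0" using t by linarith
  let ?h = "\<lambda>n. low_poly \<sigma> (t * sqrt (real n)) k q"
  have "AE \<omega> in M. \<forall>\<^sub>F n in sequentially. spec_real n (?h n) (X n \<omega>) < 1"
  proof (rule AE_eventually_spec_less[where B = "\<lambda>n. - \<delta> * real n"])
    show "\<forall>\<^sub>F n in sequentially. (1::real) > 0 \<and> (\<forall>x. poly (?h n) x \<ge> 0) \<and>
        (\<forall>i\<in>{0, 1}. (\<Sum>j<n. nu (nat \<lfloor>\<mu> n\<rfloor> + i) j (?h n) - 1) \<le> - \<delta> * real n)"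
      using S[OF floor_lim[of 0]] S[OF floor_lim[of 1]] eventually_ge_at_top[of 1]
    proof eventually_elim
      case (elim n)
      then show ?case using tpos \<sigma> q low_poly_nonneg[of "t * sqrt (real n)" \<sigma> k q] by simp
    qed
    show "summable (\<lambda>n. (real n + 1)\<^sup>2 * exp (- \<delta> * real n) / 1)"
    proof (rule summable_comparison_test'[OF summable_poly_exp[OF \<delta>]])
      fix n :: nat
      show "norm ((real n + 1)\<^sup>2 * exp (- \<delta> * real n) / 1) \<le> (real n + 1) ^ 3 * exp (- \<delta> * real n)"
        by (auto simp: intro!: mult_right_mono power_increasing)
    qed
  qed
  then show ?thesis
  proof eventually_elim
    case (elim \<omega>)
    then show ?case using eventually_ge_at_top[of 1]
    proof eventually_elim
      case (elim n)
      show ?case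
      proof (rule ccontr)
        assume "\<not> (\<exists>i<n. t * sqrt (real n) < \<sigma> * eigs n (X n \<omega>) i)"
        then have "\<sigma> * eigs n (X n \<omega>) i \<le> t * sqrt (real n)" if "i < n" for i
          using that not_less by blast
        then have "1 \<le> poly (?h n) (eigs n (X n \<omega>) i)" if "i < n" for i
          using tpos \<sigma> q elim(2) that by (intro low_poly_ge_1) auto
        then have "1 \<le> spec_real n (?h n) (X n \<omega>)" unfolding spec_real_def by (intro prod_ge_1) auto
        with elim(1) show False by simp
      qed
    qed
  qed
qed

lemma lambda_eigs:
  assumes "n \<ge> 1" "\<omega> \<in> space M"
  shows "lambda_max (X n \<omega>) = Max (eigs n (X n \<omega>) ` {..<n})"
    "lambda_min (X n \<omega>) = Min (eigs n (X n \<omega>) ` {..<n})"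
proof -
  have "X n \<omega> \<in> Herm n"
    using measurable_space[OF X_meas[OF assms(1)] assms(2)] by (simp add: space_herm_borel)
  then show "lambda_max (X n \<omega>) = Max (eigs n (X n \<omega>) ` {..<n})"
    "lambda_min (X n \<omega>) = Min (eigs n (X n \<omega>) ` {..<n})"
    using is_spectrum_eigs[of "X n \<omega>" n] by (simp_all add: lambda_max_def lambda_min_def is_spectrum_def)
qed

lemma AE_eventually_close:
  assumes \<epsilon>: "0 < \<epsilon>" "\<epsilon> < edge 1 c / 2"
  shows "AE \<omega> in M. \<forall>\<^sub>F n in sequentially. \<bar>lambda_max (X n \<omega>) / sqrt (real n) - edge 1 c\<bar> < \<epsilon> \<and>
    \<bar>lambda_min (X n \<omega>) / sqrt (real n) + edge 1 c\<bar> < \<epsilon>"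
proof -
  let ?b = "edge 1 c"
  have "AE \<omega> in M. \<forall>\<^sub>F n in sequentially. \<forall>i<n. \<bar>eigs n (X n \<omega>) i\<bar> < (?b + \<epsilon>) * sqrt (real n)"
    using \<epsilon> by (intro AE_eventually_eigs_less) simp
  moreover have "AE \<omega> in M. \<forall>\<^sub>F n in sequentially. \<exists>i<n. (?b - \<epsilon>) * sqrt (real n) < 1 * eigs n (X n \<omega>) i"
    using \<epsilon> by (intro AE_eventually_eigs_greater) auto
  moreover have "AE \<omega> in M. \<forall>\<^sub>F n in sequentially. \<exists>i<n. (?b - \<epsilon>) * sqrt (real n) < -1 * eigs n (X n \<omega>) i"
    using \<epsilon> by (intro AE_eventually_eigs_greater) auto
  moreover have "AE \<omega> in M. \<omega> \<in> space M" by (rule AE_space)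
  ultimately show ?thesis
  proof eventually_elim
    case (elim \<omega>)
    from elim(1-3) eventually_ge_at_top[of 1] show ?case
    proof eventually_elim
      case (elim n)
      let ?e = "eigs n (X n \<omega>)" and ?w = "sqrt (real n)"
      let ?S = "eigs n (X n \<omega>) ` {..<n}"
      have fin: "finite ?S" "?S \<noteq> {}" using elim(4) by (auto simp: lessThan_empty_iff)
      have w: "?w > 0" using elim(4) by simp
      obtain i j where ij: "i < n" "(?b - \<epsilon>) * ?w < ?e i" "j < n" "(?b - \<epsilon>) * ?w < - ?e j"
        using elim(2,3) by auto
      have "Max ?S < (?b + \<epsilon>) * ?w" using fin elim(1) by (auto simp: abs_less_iff)
      moreover have "(?b - \<epsilon>) * ?w < Max ?S" using fin ij by (auto simp: Max_gr_iff)
      moreover have "- ((?b + \<epsilon>) * ?w) < Min ?S" using fin elim(1) by (auto simp: abs_less_iff)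
      moreover have "?e j < - ((?b - \<epsilon>) * ?w)" using ij(4) by linarith
      then have "Min ?S < - ((?b - \<epsilon>) * ?w)" using fin ij(3) by (auto simp: Min_less_iff)
      ultimately have "Max ?S / ?w < ?b + \<epsilon>" "?b - \<epsilon> < Max ?S / ?w"
        "- (?b + \<epsilon>) < Min ?S / ?w" "Min ?S / ?w < - (?b - \<epsilon>)"
        by (simp_all only: pos_divide_less_eq[OF w] pos_less_divide_eq[OF w] mult_minus_left)
      then show ?case
        unfolding lambda_eigs[OF elim(4) \<open>\<omega> \<in> space M\<close>] by (simp add: abs_less_iff)
    qed
  qed
qed

theorem AE_extreme_eigenvalues:
  "AE \<omega> in M. (\<lambda>n. lambda_max (X n \<omega>) / sqrt (real n)) \<longlonglongrightarrow> edge 1 c \<and>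
     (\<lambda>n. lambda_min (X n \<omega>) / sqrt (real n)) \<longlonglongrightarrow> - edge 1 c"
proof -
  let ?b = "edge 1 c"
  have b: "?b > 0" using c_nonneg by (simp add: edge_def add_pos_nonneg)
  have "AE \<omega> in M. \<forall>l::nat. \<forall>\<^sub>F n in sequentially.
      \<bar>lambda_max (X n \<omega>) / sqrt (real n) - ?b\<bar> < ?b / (real l + 3) \<and>
      \<bar>lambda_min (X n \<omega>) / sqrt (real n) + ?b\<bar> < ?b / (real l + 3)"
    unfolding AE_all_countable
  proof
    fix l :: nat
    have "?b / (real l + 3) < ?b / 2" using b by (intro divide_strict_left_mono) auto
    then show "AE \<omega> in M. \<forall>\<^sub>F n in sequentially.
        \<bar>lambda_max (X n \<omega>) / sqrt (real n) - ?b\<bar> < ?b / (real l + 3) \<and>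
        \<bar>lambda_min (X n \<omega>) / sqrt (real n) + ?b\<bar> < ?b / (real l + 3)"
      using b by (intro AE_eventually_close) auto
  qed
  then show ?thesis
  proof eventually_elim
    case (elim \<omega>)
    have small: "\<exists>l::nat. ?b / (real l + 3) < r" if "r > 0" for r
    proof -
      have "(\<lambda>l. ?b / (real l + 3)) \<longlonglongrightarrow> 0" by real_asymp
      then have "\<forall>\<^sub>F l in sequentially. ?b / (real l + 3) < r" using that by (rule order_tendstoD(2))
      then show ?thesis by (auto dest!: eventually_happens)
    qed
    have "\<forall>\<^sub>F n in sequentially. \<bar>lambda_max (X n \<omega>) / sqrt (real n) - ?b\<bar> < r \<and>
        \<bar>lambda_min (X n \<omega>) / sqrt (real n) + ?b\<bar> < r" if r: "r > 0" for r
    proof -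
      obtain l :: nat where l: "?b / (real l + 3) < r"
        using small[OF r] by blast
      show ?thesis using elim[rule_format, of l] by eventually_elim (use l in linarith)
    qed
    then show ?case
      unfolding tendsto_iff dist_real_def by (simp add: eventually_conj_iff)
  qed
qed

end

theorem proposition3p1:
  fixes \<mu> :: "nat \<Rightarrow> real" and c :: real
    and M :: "'w measure" and X :: "nat \<Rightarrow> 'w \<Rightarrow> complex mat"
  assumes pos: "\<And>n. n \<ge> 1 \<Longrightarrow> \<mu> n > 0"
    and lim: "(\<lambda>n. \<mu> n / real n) \<longlonglongrightarrow> c"
    and M: "prob_space M"
    and X: "\<And>n. n \<ge> 1 \<Longrightarrow> X n \<in> M \<rightarrow>\<^sub>M herm_borel n"
    and distr_X: "\<And>n. n \<ge> 1 \<Longrightarrow> distr M (herm_borel n) (X n) = herm_measure n (\<mu> n)"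
  defines "b \<equiv> sqrt (1 + c + sqrt (1 + 2 * c))"
  shows "(AE \<omega> in M. (\<lambda>n. lambda_max (X n \<omega>) / sqrt (real n)) \<longlonglongrightarrow> b) \<and>
         (AE \<omega> in M. (\<lambda>n. lambda_min (X n \<omega>) / sqrt (real n)) \<longlonglongrightarrow> - b)"
proof -
  interpret prob_space M by (rule M)
  interpret herm_sequence M \<mu> c X
    by unfold_locales (use pos lim X distr_X in auto)
  have "b = edge 1 c" unfolding b_def using c_nonneg by (rule edge_1[symmetric])
  with AE_extreme_eigenvalues show ?thesis by simp
qed

end
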